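(* Let $1<p_1,p_2,q<\infty$ and $\omega,\nu,\eta\in\mathcal{D}$ be such that $q^{-1}=p_1^{-1}+p_2^{-1}$ and $$\widetilde{\eta}^{\frac1q}\asymp\widetilde{\omega}^{\frac1{p_1}}\,\widetilde{\nu}^{\frac1{p_2}}\quad\text{on }[0,1).$$ Then $$A^q_\eta=A^{p_1}_\omega\odot A^{p_2}_\nu,$$ that is, $A^q_\eta$ and $A^{p_1}_\omega\odot A^{p_2}_\nu$ are the same as function spaces and their norms are equivalent.
   Context: $\mathbb{D}$ is the open unit disc in $\mathbb{C}$, $\mathcal{H}(\mathbb{D})$ the space of analytic functions on $\mathbb{D}$, and $dA=\frac{dx\,dy}{\pi}$ normalized area measure. A radial weight is a non-negative $\omega\in L^1(\mathbb{D},dA)$ with $\omega(z)=\omega(|z|)$. Write $\widehat{\omega}(z)=\int_{|z|}^1\omega(s)\,ds$; all radial weights are assumed to satisfy $\widehat{\omega}(z)>0$ for all $z\in\mathbb{D}$. Write $\widetilde{\omega}(r)=\widehat{\omega}(r)/(1-r)$ for $0\le r<1$. For $0<p<\infty$, $\|f\|_{A^p_\omega}^p=\int_{\mathbb{D}}|f|^p\omega\,dA$ and $A^p_\omega=\{f\in\mathcal{H}(\mathbb{D}):\|f\|_{A^p_\omega}<\infty\}$. A radial weight $\omega$ belongs to $\widehat{\mathcal{D}}$ if there is $C\ge1$ with $\widehat{\omega}(r)\le C\,\widehat{\omega}(\frac{1+r}{2})$ for all $0\le r<1$; it belongs to $\check{\mathcal{D}}$ if there are $K>1$ and $C>1$ with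 $\widehat{\omega}(r)\ge C\,\widehat{\omega}(1-\frac{1-r}{K})$ for all $0\le r<1$. Set $\mathcal{D}=\widehat{\mathcal{D}}\cap\check{\mathcal{D}}$. Given two Banach spaces $A,B$ of functions defined on the same domain, the weakly factored space $A\odot B$ is the completion of the space of finite sums $f=\sum_k\varphi_k\psi_k$ with $\{\varphi_k\}\subset A$, $\{\psi_k\}\subset B$, with respect to the norm $$\|f\|_{A\odot B}=\inf\Big\{\sum_k\|\varphi_k\|_A\|\psi_k\|_B:\ f=\sum_k\varphi_k\psi_k,\ \varphi_k\in A,\ \psi_k\in B\Big\}.$$ $a\asymp b$ means $C^{-1}a\le b\le Ca$ for some constant $C>0$ (uniformly in the variable $r\in[0,1)$). *)

theory Defs
  imports "HOL-Complex_Analysis.Complex_Analysis"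
begin

abbreviation unit_disc :: "complex set" where
  "unit_disc \<equiv> ball 0 1"

definition disc_area :: "complex measure" where
  "disc_area = density (lebesgue_on unit_disc) (\<lambda>_. ennreal (1 / pi))"

definition comparable_on :: "'a set \<Rightarrow> ('a \<Rightarrow> real) \<Rightarrow> ('a \<Rightarrow> real) \<Rightarrow> bool" where
  "comparable_on S a b \<longleftrightarrow> (\<exists>C>0. \<forall>x\<in>S. a x / C \<le> b x \<and> b x \<le> C * a x)"


section \<open>Radial weights\<close>

text \<open>
  The tail integral is extended-real valued: integrability over the disc does not exclude
  a singularity at the origin for which the tail integral at \<open>r = 0\<close> is infinite. The
  doubling condition below does exclude it.
\<close>

definition weight_hat :: "(complex \<Rightarrow> real) \<Rightarrow> real \<Rightarrow> ennreal" where
  "weight_hat \<omega> r = (\<integral>\<^sup>+s\<in>{r..<1}. ennreal (\<omega> (complex_of_real s)) \<partial>lebesgue)"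

definition weight_tilde :: "(complex \<Rightarrow> real) \<Rightarrow> real \<Rightarrow> real" where
  "weight_tilde \<omega> r = enn2real (weight_hat \<omega> r) / (1 - r)"

definition radial_weight :: "(complex \<Rightarrow> real) \<Rightarrow> bool" where
  "radial_weight \<omega> \<longleftrightarrow>
     integrable disc_area \<omega> \<and>
     (\<forall>z\<in>unit_disc. 0 \<le> \<omega> z \<and> \<omega> z = \<omega> (complex_of_real (cmod z))) \<and>
     (\<forall>z\<in>unit_disc. 0 < weight_hat \<omega> (cmod z))"

definition D_hat :: "(complex \<Rightarrow> real) set" where
  "D_hat = {\<omega>. radial_weight \<omega> \<and>
     (\<exists>C::real. C \<ge> 1 \<and>
        (\<forall>r\<in>{0..<1}. weight_hat \<omega> r \<le> ennreal C * weight_hat \<omega> ((1 + r) / 2)))}"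

definition D_check :: "(complex \<Rightarrow> real) set" where
  "D_check = {\<omega>. radial_weight \<omega> \<and>
     (\<exists>(K::real) (C::real). K > 1 \<and> C > 1 \<and>
        (\<forall>r\<in>{0..<1}. weight_hat \<omega> r \<ge> ennreal C * weight_hat \<omega> (1 - (1 - r) / K)))}"

definition D_class :: "(complex \<Rightarrow> real) set" where
  "D_class = D_hat \<inter> D_check"


section \<open>Weighted Bergman spaces\<close>

text \<open>
  A function on the disc is represented by its extension by zero, so that equality of
  representatives is equality on the disc.
\<close>

definition disc_holo :: "(complex \<Rightarrow> complex) set" where
  "disc_holo = {f. f holomorphic_on unit_disc \<and> (\<forall>z. z \<notin> unit_disc \<longrightarrow> f z = 0)}"

definition bergman :: "real \<Rightarrow> (complex \<Rightarrow> real) \<Rightarrow> (complex \<Rightarrow> complex) set" where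
  "bergman p \<omega> = {f \<in> disc_holo. integrable disc_area (\<lambda>z. cmod (f z) powr p * \<omega> z)}"

definition bergman_norm :: "real \<Rightarrow> (complex \<Rightarrow> real) \<Rightarrow> (complex \<Rightarrow> complex) \<Rightarrow> real" where
  "bergman_norm p \<omega> f = (\<integral>z. cmod (f z) powr p * \<omega> z \<partial>disc_area) powr (1 / p)"


section \<open>Completion of a normed function space\<close>

text \<open>
  A normed space of functions is given by its carrier and its norm. Its completion consists
  of the classes of Cauchy sequences modulo null sequences.
\<close>

definition cauchy_seqs ::
  "('a \<Rightarrow> complex) set \<Rightarrow> (('a \<Rightarrow> complex) \<Rightarrow> real) \<Rightarrow> (nat \<Rightarrow> 'a \<Rightarrow> complex) set" where
  "cauchy_seqs S N = {F. (\<forall>n. F n \<in> S) \<and>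
     (\<forall>e>0. \<exists>M. \<forall>m\<ge>M. \<forall>n\<ge>M. N (\<lambda>z. F m z - F n z) < e)}"

definition cauchy_rel ::
  "('a \<Rightarrow> complex) set \<Rightarrow> (('a \<Rightarrow> complex) \<Rightarrow> real) \<Rightarrow> (nat \<Rightarrow> 'a \<Rightarrow> complex) rel" where
  "cauchy_rel S N = {(F, G). F \<in> cauchy_seqs S N \<and> G \<in> cauchy_seqs S N \<and>
     (\<lambda>n. N (\<lambda>z. F n z - G n z)) \<longlonglongrightarrow> 0}"

definition completion ::
  "('a \<Rightarrow> complex) set \<Rightarrow> (('a \<Rightarrow> complex) \<Rightarrow> real) \<Rightarrow> (nat \<Rightarrow> 'a \<Rightarrow> complex) set set" where
  "completion S N = cauchy_seqs S N // cauchy_rel S N"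

definition completion_norm ::
  "(('a \<Rightarrow> complex) \<Rightarrow> real) \<Rightarrow> (nat \<Rightarrow> 'a \<Rightarrow> complex) set \<Rightarrow> real" where
  "completion_norm N x = (THE c. \<forall>F\<in>x. (\<lambda>n. N (F n)) \<longlonglongrightarrow> c)"

definition represents :: "(nat \<Rightarrow> 'a \<Rightarrow> complex) set \<Rightarrow> ('a \<Rightarrow> complex) \<Rightarrow> bool" where
  "represents x f \<longleftrightarrow> (\<forall>F\<in>x. \<forall>z. (\<lambda>n. F n z) \<longlonglongrightarrow> f z)"

text \<open>
  An abstract completion \<open>X\<close> with norm \<open>NX\<close> is the function space \<open>Y\<close> with an equivalent
  norm \<open>NY\<close>: pointwise limits give a well-defined bijection from \<open>X\<close> onto \<open>Y\<close> that
  preserves norms up to constants. In particular, no nonzero element of the completion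
  represents the zero function.
\<close>

definition same_function_space ::
  "(nat \<Rightarrow> 'a \<Rightarrow> complex) set set \<Rightarrow> ((nat \<Rightarrow> 'a \<Rightarrow> complex) set \<Rightarrow> real) \<Rightarrow>
   ('a \<Rightarrow> complex) set \<Rightarrow> (('a \<Rightarrow> complex) \<Rightarrow> real) \<Rightarrow> bool" where
  "same_function_space X NX Y NY \<longleftrightarrow>
     (\<forall>x\<in>X. \<exists>!f. f \<in> Y \<and> represents x f) \<and>
     (\<forall>f\<in>Y. \<exists>!x. x \<in> X \<and> represents x f) \<and>
     comparable_on {(x, f). x \<in> X \<and> f \<in> Y \<and> represents x f}
       (\<lambda>(x, f). NY f) (\<lambda>(x, f). NX x)"


section \<open>Weakly factored spaces\<close>

definition factorization ::
  "('a \<Rightarrow> complex) set \<Rightarrow> ('a \<Rightarrow> complex) set \<Rightarrow> ('a \<Rightarrow> complex) \<Rightarrow>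
   nat \<Rightarrow> (nat \<Rightarrow> 'a \<Rightarrow> complex) \<Rightarrow> (nat \<Rightarrow> 'a \<Rightarrow> complex) \<Rightarrow> bool" where
  "factorization A B f n \<phi> \<psi> \<longleftrightarrow>
     (\<forall>k<n. \<phi> k \<in> A \<and> \<psi> k \<in> B) \<and> f = (\<lambda>z. \<Sum>k<n. \<phi> k z * \<psi> k z)"

definition product_sums ::
  "('a \<Rightarrow> complex) set \<Rightarrow> ('a \<Rightarrow> complex) set \<Rightarrow> ('a \<Rightarrow> complex) set" where
  "product_sums A B = {f. \<exists>n \<phi> \<psi>. factorization A B f n \<phi> \<psi>}"

definition product_norm ::
  "('a \<Rightarrow> complex) set \<Rightarrow> (('a \<Rightarrow> complex) \<Rightarrow> real) \<Rightarrow>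
   ('a \<Rightarrow> complex) set \<Rightarrow> (('a \<Rightarrow> complex) \<Rightarrow> real) \<Rightarrow> ('a \<Rightarrow> complex) \<Rightarrow> real" where
  "product_norm A NA B NB f =
     Inf {\<Sum>k<n. NA (\<phi> k) * NB (\<psi> k) | n \<phi> \<psi>. factorization A B f n \<phi> \<psi>}"

definition weak_factored ::
  "('a \<Rightarrow> complex) set \<Rightarrow> (('a \<Rightarrow> complex) \<Rightarrow> real) \<Rightarrow>
   ('a \<Rightarrow> complex) set \<Rightarrow> (('a \<Rightarrow> complex) \<Rightarrow> real) \<Rightarrow> (nat \<Rightarrow> 'a \<Rightarrow> complex) set set" where
  "weak_factored A NA B NB = completion (product_sums A B) (product_norm A NA B NB)"

definition weak_factored_norm ::
  "('a \<Rightarrow> complex) set \<Rightarrow> (('a \<Rightarrow> complex) \<Rightarrow> real) \<Rightarrow>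
   ('a \<Rightarrow> complex) set \<Rightarrow> (('a \<Rightarrow> complex) \<Rightarrow> real) \<Rightarrow> (nat \<Rightarrow> 'a \<Rightarrow> complex) set \<Rightarrow> real" where
  "weak_factored_norm A NA B NB = completion_norm (product_norm A NA B NB)"

end

theory Submission
  imports Defs
begin

text \<open>
  The norm of \<open>A\<^sup>p\<^sub>\<omega>\<close> is comparable to a discrete one. With \<open>r\<^sub>n = 1 - 2\<^sup>-\<^sup>n\<close>, with \<open>h\<^sub>n\<close> the tail
  integral of \<open>\<omega>\<close> over \<open>[r\<^sub>n, 1)\<close> and with \<open>M(r)\<close> the mean of \<open>|f|\<^sup>p\<close> over the circle of radius \<open>r\<close>, the
  integral of \<open>|f|\<^sup>p \<omega>\<close> over the disc is comparable to the sum of \<open>h\<^sub>n M(r\<^sub>n\<^sub>+\<^sub>1)\<close>, because \<open>M\<close>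
  increases and the two doubling conditions say that \<open>h\<^sub>n\<close> decays geometrically, neither slower
  nor faster (\<open>bergman_integral_dyadic\<close>). In these terms the hypothesis on the weights is
  \<open>k\<^sub>n powr (1/q) \<asymp> h\<^sub>n powr (1/p1) * g\<^sub>n powr (1/p2)\<close> for the tails \<open>h, g, k\<close> of \<open>\<omega>, \<nu>, \<eta>\<close>, and Young's
  inequality under the sums gives the easy half: a product of functions in \<open>A\<^sup>p\<^sup>1\<^sub>\<omega>\<close> and \<open>A\<^sup>p\<^sup>2\<^sub>\<nu>\<close>
  lies in \<open>A\<^sup>q\<^sub>\<eta>\<close> with control of norms (\<open>bergman_mult\<close>).

  The other half has to bound the product norm by the norm of \<open>A\<^sup>q\<^sub>\<eta>\<close>. A polynomial \<open>f\<close> is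
  reproduced by the kernel \<open>(1 - cnj w * z)\<^sup>-\<^sup>2\<^sup>s\<close>, integrated in \<open>w\<close> against
  \<open>f(w) (1 - |w|\<^sup>2)\<^sup>2\<^sup>s\<^sup>-\<^sup>2\<close> up to a constant. A fine quadrature of this integral
  splits into families that contain one node \<open>w\<close> in each dyadic box, so up to a small error \<open>f\<close> is an average of
  sums \<open>\<Sum> c\<^sub>i K\<^sub>i\<^sup>2\<close>, where \<open>K\<^sub>i\<close> is the kernel of exponent \<open>s\<close> at the \<open>i\<close>-th node
  (\<open>quadrature_approx\<close>). For one family write \<open>c = a b\<close>. With the \<open>N\<close>-th roots of unity \<open>\<zeta>\<close>,
  orthogonality gives
  \<open>\<Sum>\<^sub>i a\<^sub>i b\<^sub>i K\<^sub>i\<^sup>2 = (1/N) \<Sum>\<^sub>\<zeta> (\<Sum>\<^sub>i \<zeta>\<^sup>i a\<^sub>i K\<^sub>i) (\<Sum>\<^sub>j \<zeta>\<^sup>-\<^sup>j b\<^sub>j K\<^sub>j)\<close>,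
  a finite sum of products (\<open>product_norm_diagonal\<close>). The norm of each factor is bounded by a
  weighted \<open>\<ell>\<^sup>p\<close> norm of its coefficients, by a Schur test, and does not see the
  unimodular factors (\<open>atom_sum_bound\<close>). Dividing \<open>c\<close> between \<open>a\<close> and \<open>b\<close> as in the equality case
  of Hoelder's inequality leaves a weighted \<open>\<ell>\<^sup>q\<close> norm of the values of \<open>f\<close> at the nodes, and its average
  over the families is bounded by the norm of \<open>f\<close> in \<open>A\<^sup>q\<^sub>\<eta>\<close> (\<open>polynomial_product_norm\<close>).

  The product norm is an infimum over finite sums, so no limit may be taken inside it without
  care. Here the quadrature error is uniformly small, and a bounded function \<open>f = f * 1\<close> has a
  product norm controlled by its supremum. Since polynomials are dense in both factors, the estimate passes to all
  finite sums of products. The product norm and the norm of \<open>A\<^sup>q\<^sub>\<eta>\<close> are therefore equivalent on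
  a dense subspace of \<open>A\<^sup>q\<^sub>\<eta>\<close>; as \<open>A\<^sup>q\<^sub>\<eta>\<close> is complete with continuous point evaluations, it is the
  completion (\<open>same_function_space_completion\<close>).
\<close>

section \<open>Completion of a seminormed function space\<close>

text \<open>
  Closure under differences and the bound for a difference already give closure under negation, symmetry
  and the triangle inequality, which is all that a completion refers to.
\<close>
locale function_seminorm =
  fixes S :: "('a \<Rightarrow> complex) set" and N :: "('a \<Rightarrow> complex) \<Rightarrow> real"
  assumes zero_mem: "(\<lambda>_. 0) \<in> S"
    and diff_mem: "f \<in> S \<Longrightarrow> g \<in> S \<Longrightarrow> (\<lambda>z. f z - g z) \<in> S"
    and norm_zero: "N (\<lambda>_. 0) = 0"
    and norm_nonneg: "f \<in> S \<Longrightarrow> 0 \<le> N f"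
    and norm_diff: "f \<in> S \<Longrightarrow> g \<in> S \<Longrightarrow> N (\<lambda>z. f z - g z) \<le> N f + N g"
begin

lemma norm_uminus: "f \<in> S \<Longrightarrow> N (\<lambda>z. - f z) = N f"
proof -
  have a: "N (\<lambda>z. - g z) \<le> N g" if "g \<in> S" for g
    using norm_diff[OF zero_mem that] norm_zero by simp
  assume f: "f \<in> S"
  have "(\<lambda>z. - f z) \<in> S" using diff_mem[OF zero_mem f] by simp
  from a[OF this] a[OF f] show ?thesis by simp
qed

lemma norm_commute: "f \<in> S \<Longrightarrow> g \<in> S \<Longrightarrow> N (\<lambda>z. f z - g z) = N (\<lambda>z. g z - f z)"
  using norm_uminus[OF diff_mem[of f g]] by simp

lemma norm_triangle: "f \<in> S \<Longrightarrow> g \<in> S \<Longrightarrow> h \<in> S \<Longrightarrow>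
    N (\<lambda>z. f z - h z) \<le> N (\<lambda>z. f z - g z) + N (\<lambda>z. g z - h z)"
  using norm_diff[OF diff_mem[of f g] diff_mem[of h g]] norm_commute[of g h] by simp

lemma norm_reverse: "f \<in> S \<Longrightarrow> g \<in> S \<Longrightarrow> \<bar>N f - N g\<bar> \<le> N (\<lambda>z. f z - g z)"
  using norm_triangle[of f g "\<lambda>_. 0"] norm_triangle[of g f "\<lambda>_. 0"] zero_mem norm_commute[of f g]
  by (simp add: abs_le_iff)

lemma norm_cauchy_limit:
  assumes F: "F \<in> cauchy_seqs S N"
  shows "convergent (\<lambda>n. N (F n))"
proof -
  have FS: "F n \<in> S" for n using F by (auto simp: cauchy_seqs_def)
  have "Cauchy (\<lambda>n. N (F n))"
  proof (rule CauchyI)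
    fix e :: real assume "e > 0"
    then obtain M where M: "\<forall>m\<ge>M. \<forall>n\<ge>M. N (\<lambda>z. F m z - F n z) < e"
      using F unfolding cauchy_seqs_def by blast
    then have "\<forall>m\<ge>M. \<forall>n\<ge>M. norm (N (F m) - N (F n)) < e"
      using norm_reverse[OF FS FS] by (metis le_less_trans real_norm_def)
    then show "\<exists>M. \<forall>m\<ge>M. \<forall>n\<ge>M. norm (N (F m) - N (F n)) < e" by blast
  qed
  then show ?thesis by (simp add: Cauchy_convergent_iff)
qed

lemma equiv_cauchy_rel: "equiv (cauchy_seqs S N) (cauchy_rel S N)"
proof (rule equivI)
  have S: "F n \<in> S" if "F \<in> cauchy_seqs S N" for F n using that by (auto simp: cauchy_seqs_def)
  show "cauchy_rel S N \<subseteq> cauchy_seqs S N \<times> cauchy_seqs S N" by (auto simp: cauchy_rel_def)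
  show "refl_on (cauchy_seqs S N) (cauchy_rel S N)"
    by (auto simp: refl_on_def cauchy_rel_def norm_zero)
  show "sym (cauchy_rel S N)"
  proof (rule symI)
    fix F G assume "(F, G) \<in> cauchy_rel S N"
    then show "(G, F) \<in> cauchy_rel S N"
      using norm_commute[OF S S, of F G] by (auto simp: cauchy_rel_def)
  qed
  show "trans (cauchy_rel S N)"
  proof (rule transI)
    fix F G H assume a: "(F, G) \<in> cauchy_rel S N" "(G, H) \<in> cauchy_rel S N"
    have "(\<lambda>n. N (\<lambda>z. F n z - H n z)) \<longlonglongrightarrow> 0"
    proof (rule tendsto_sandwich[of "\<lambda>_. 0"])
      show "(\<lambda>n. N (\<lambda>z. F n z - G n z) + N (\<lambda>z. G n z - H n z)) \<longlonglongrightarrow> 0"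
        using a by (auto simp: cauchy_rel_def intro!: tendsto_add_zero)
      show "\<forall>\<^sub>F n in sequentially. 0 \<le> N (\<lambda>z. F n z - H n z)"
        using a S by (auto simp: cauchy_rel_def intro!: always_eventually norm_nonneg diff_mem)
      show "\<forall>\<^sub>F n in sequentially. N (\<lambda>z. F n z - H n z) \<le> N (\<lambda>z. F n z - G n z) + N (\<lambda>z. G n z - H n z)"
        using a S by (auto simp: cauchy_rel_def intro!: always_eventually norm_triangle)
    qed simp
    then show "(F, H) \<in> cauchy_rel S N" using a by (auto simp: cauchy_rel_def)
  qed
qed

lemma completion_norm_limit:
  assumes x: "x \<in> completion S N" and F: "F \<in> x"
  shows "(\<lambda>n. N (F n)) \<longlonglongrightarrow> completion_norm N x"
proof -
  have sub: "G \<in> cauchy_seqs S N" if "G \<in> x" for G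
    using in_quotient_imp_subset[OF equiv_cauchy_rel] x that unfolding completion_def by blast
  have S: "G n \<in> S" if "G \<in> x" for G n using sub[OF that] by (auto simp: cauchy_seqs_def)
  obtain c where c: "(\<lambda>n. N (F n)) \<longlonglongrightarrow> c"
    using norm_cauchy_limit[OF sub[OF F]] by (auto simp: convergent_def)
  have cG: "(\<lambda>n. N (G n)) \<longlonglongrightarrow> c" if G: "G \<in> x" for G
  proof -
    have "(G, F) \<in> cauchy_rel S N"
      using quotient_eq_iff[OF equiv_cauchy_rel, of x x G F] x F G unfolding completion_def by simp
    then have l: "(\<lambda>n. N (\<lambda>z. G n z - F n z)) \<longlonglongrightarrow> 0" by (simp add: cauchy_rel_def)
    have "(\<lambda>n. N (G n) - N (F n)) \<longlonglongrightarrow> 0"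
      by (rule Lim_null_comparison[OF _ l])
         (use norm_reverse[OF S[OF G] S[OF F]] in \<open>auto intro: always_eventually\<close>)
    from tendsto_add[OF this c] show ?thesis by simp
  qed
  have "completion_norm N x = c"
    unfolding completion_norm_def
    by (rule the_equality) (use cG c F LIMSEQ_unique in blast)+
  then show ?thesis using c by simp
qed

end

text \<open>
  A Cauchy sequence for \<open>N\<close> is one for \<open>NY\<close>, so it converges in \<open>Y\<close>, hence pointwise; this gives
  the represented function. Two Cauchy sequences with the same pointwise limit have the same
  limit in \<open>Y\<close>, so their difference tends to zero for \<open>NY\<close> and, by equivalence of the norms, for \<open>N\<close>:
  this is why an element of the completion is determined by its function.
\<close>
theorem same_function_space_completion:
  assumes S: "function_seminorm S N" and Y: "function_seminorm Y NY"
    and SY: "S \<subseteq> Y" and C: "C > 0"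
    and le1: "\<And>f. f \<in> S \<Longrightarrow> NY f \<le> C * N f"
    and le2: "\<And>f. f \<in> S \<Longrightarrow> N f \<le> C * NY f"
    and point: "\<And>z. \<exists>K. \<forall>f\<in>Y. cmod (f z) \<le> K * NY f"
    and complete: "\<And>F. F \<in> cauchy_seqs Y NY \<Longrightarrow> \<exists>f\<in>Y. (\<lambda>n. NY (\<lambda>z. F n z - f z)) \<longlonglongrightarrow> 0"
    and dense: "\<And>f e. f \<in> Y \<Longrightarrow> e > 0 \<Longrightarrow> \<exists>g\<in>S. NY (\<lambda>z. f z - g z) < e"
  shows "same_function_space (completion S N) (completion_norm N) Y NY"
proof -
  interpret S: function_seminorm S N by (rule S)
  interpret Y: function_seminorm Y NY by (rule Y)
  note eqv = S.equiv_cauchy_rel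
  have memS: "F n \<in> S" if "F \<in> cauchy_seqs S N" for F n using that by (auto simp: cauchy_seqs_def)
  have pw: "(\<lambda>n. F n z) \<longlonglongrightarrow> f z"
    if "\<And>n. F n \<in> Y" "f \<in> Y" "(\<lambda>n. NY (\<lambda>z. F n z - f z)) \<longlonglongrightarrow> 0" for F f z
  proof -
    obtain K where K: "\<forall>f\<in>Y. cmod (f z) \<le> K * NY f" using point by blast
    have "(\<lambda>n. F n z - f z) \<longlonglongrightarrow> 0"
    proof (rule Lim_null_comparison)
      show "(\<lambda>n. K * NY (\<lambda>z. F n z - f z)) \<longlonglongrightarrow> 0" using tendsto_mult_right_zero[OF that(3)] by simp
      show "\<forall>\<^sub>F n in sequentially. cmod (F n z - f z) \<le> K * NY (\<lambda>z. F n z - f z)"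
        using K Y.diff_mem[OF that(1,2)] by (auto intro!: always_eventually)
    qed
    then show ?thesis by (simp add: LIM_zero_iff)
  qed
  have lim: "\<exists>f\<in>Y. (\<lambda>n. NY (\<lambda>z. F n z - f z)) \<longlonglongrightarrow> 0" if F: "F \<in> cauchy_seqs S N" for F
  proof (rule complete)
    show "F \<in> cauchy_seqs Y NY"
      unfolding cauchy_seqs_def
    proof (intro CollectI conjI allI impI)
      show "F n \<in> Y" for n using memS[OF F] SY by auto
      fix e :: real assume "e > 0"
      then have "e / C > 0" using C by simp
      then obtain M where M: "\<forall>m\<ge>M. \<forall>n\<ge>M. N (\<lambda>z. F m z - F n z) < e / C"
        using F unfolding cauchy_seqs_def by blast
      have "NY (\<lambda>z. F m z - F n z) < e" if "m \<ge> M" "n \<ge> M" for m n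
      proof -
        have "NY (\<lambda>z. F m z - F n z) \<le> C * N (\<lambda>z. F m z - F n z)"
          by (intro le1 S.diff_mem memS[OF F])
        also have "\<dots> < C * (e / C)" using M that C by (intro mult_strict_left_mono) auto
        finally show ?thesis using C by simp
      qed
      then show "\<exists>M. \<forall>m\<ge>M. \<forall>n\<ge>M. NY (\<lambda>z. F m z - F n z) < e" by blast
    qed
  qed
  have NYlim: "(\<lambda>n. NY (\<lambda>z. G n z - f z)) \<longlonglongrightarrow> 0"
    if FG: "(F, G) \<in> cauchy_rel S N" and f: "f \<in> Y" "(\<lambda>n. NY (\<lambda>z. F n z - f z)) \<longlonglongrightarrow> 0" for F G f
  proof (rule tendsto_sandwich[of "\<lambda>_. 0"])
    have m: "\<And>n. F n \<in> S" "\<And>n. G n \<in> S" using FG memS by (auto simp: cauchy_rel_def)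
    have mY: "\<And>n. F n \<in> Y" "\<And>n. G n \<in> Y" using m SY by auto
    show "(\<lambda>n. C * N (\<lambda>z. F n z - G n z) + NY (\<lambda>z. F n z - f z)) \<longlonglongrightarrow> 0"
      using FG f by (auto simp: cauchy_rel_def intro!: tendsto_add_zero tendsto_mult_right_zero)
    show "\<forall>\<^sub>F n in sequentially. 0 \<le> NY (\<lambda>z. G n z - f z)"
      using mY f by (auto intro!: always_eventually Y.norm_nonneg Y.diff_mem)
    show "\<forall>\<^sub>F n in sequentially. NY (\<lambda>z. G n z - f z) \<le> C * N (\<lambda>z. F n z - G n z) + NY (\<lambda>z. F n z - f z)"
    proof (intro always_eventually allI)
      fix n
      show "NY (\<lambda>z. G n z - f z) \<le> C * N (\<lambda>z. F n z - G n z) + NY (\<lambda>z. F n z - f z)"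
        using Y.norm_triangle[OF mY(2)[of n] mY(1)[of n] f(1)] Y.norm_commute[OF mY(2)[of n] mY(1)[of n]]
          le1[OF S.diff_mem[OF m(1)[of n] m(2)[of n]]] by simp
    qed
  qed simp
  have nonempty: "\<exists>F. F \<in> x" if "x \<in> completion S N" for x
    using in_quotient_imp_non_empty[OF eqv] that unfolding completion_def by blast
  have sub: "F \<in> cauchy_seqs S N" if "x \<in> completion S N" "F \<in> x" for x F
    using in_quotient_imp_subset[OF eqv] that unfolding completion_def by blast
  have rel: "(F, G) \<in> cauchy_rel S N" if "x \<in> completion S N" "F \<in> x" "G \<in> x" for x F G
    using quotient_eq_iff[OF eqv, of x x F G] that unfolding completion_def by simp
  have rep: "represents x f"
    if x: "x \<in> completion S N" "F \<in> x" and f: "f \<in> Y" "(\<lambda>n. NY (\<lambda>z. F n z - f z)) \<longlonglongrightarrow> 0" for x F f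
    unfolding represents_def
  proof (intro ballI allI)
    fix G z assume G: "G \<in> x"
    show "(\<lambda>n. G n z) \<longlonglongrightarrow> f z"
      using NYlim[OF rel[OF x G] f] f(1) memS[OF sub[OF x(1) G]] SY by (intro pw) auto
  qed
  have rep_uniq: "f = g" if x: "x \<in> completion S N" and fg: "represents x f" "represents x g" for x f g
  proof -
    obtain F where "F \<in> x" using nonempty[OF x] by blast
    then have "f z = g z" for z using fg unfolding represents_def using LIMSEQ_unique by blast
    then show ?thesis by blast
  qed
  have rep_lim: "(\<lambda>n. NY (\<lambda>z. F n z - f z)) \<longlonglongrightarrow> 0"
    if x: "x \<in> completion S N" "F \<in> x" and f: "represents x f" for x F f
  proof -
    obtain g where g: "g \<in> Y" "(\<lambda>n. NY (\<lambda>z. F n z - g z)) \<longlonglongrightarrow> 0" using lim[OF sub[OF x]] by blast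
    with rep[OF x g] rep_uniq[OF x(1) f] show ?thesis by blast
  qed
  have 1: "\<exists>!f. f \<in> Y \<and> represents x f" if x: "x \<in> completion S N" for x
  proof -
    obtain F where F: "F \<in> x" using nonempty[OF x] by blast
    obtain f where f: "f \<in> Y" "(\<lambda>n. NY (\<lambda>z. F n z - f z)) \<longlonglongrightarrow> 0" using lim[OF sub[OF x F]] by blast
    show ?thesis using f(1) rep[OF x F f] rep_uniq[OF x] by blast
  qed
  have 2: "\<exists>!x. x \<in> completion S N \<and> represents x f" if f: "f \<in> Y" for f
  proof (rule ex_ex1I)
    have "\<forall>n. \<exists>g\<in>S. NY (\<lambda>z. f z - g z) < 1 / Suc n" using dense[OF f] by simp
    then obtain G where G: "\<And>n. G n \<in> S" "\<And>n. NY (\<lambda>z. f z - G n z) < 1 / Suc n" by metis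
    have GY: "G n \<in> Y" for n using G SY by auto
    have G2: "NY (\<lambda>z. G n z - f z) < 1 / Suc n" for n using G(2)[of n] Y.norm_commute[OF f GY] by simp
    have Gc: "G \<in> cauchy_seqs S N"
      unfolding cauchy_seqs_def
    proof (intro CollectI conjI allI impI)
      fix e :: real assume e: "e > 0"
      obtain M :: nat where M: "real M > 2 * C / e" using reals_Archimedean2 by blast
      have "N (\<lambda>z. G m z - G n z) < e" if mn: "m \<ge> M" "n \<ge> M" for m n
      proof -
        have MM: "real (Suc M) > 0" "2 * C / e < real (Suc M)" using M by auto
        have "N (\<lambda>z. G m z - G n z) \<le> C * NY (\<lambda>z. G m z - G n z)" by (intro le2 S.diff_mem G)
        also have "\<dots> \<le> C * (NY (\<lambda>z. G m z - f z) + NY (\<lambda>z. f z - G n z))"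
          using C by (intro mult_left_mono Y.norm_triangle GY f) auto
        also have "\<dots> \<le> C * (1 / Suc M + 1 / Suc M)"
        proof -
          have "1 / real (Suc m) \<le> 1 / Suc M" "1 / real (Suc n) \<le> 1 / Suc M"
            using mn by (auto simp: frac_le)
          then show ?thesis using C G(2)[of n] G2[of m] by (intro mult_left_mono) auto
        qed
        also have "\<dots> = 2 * C / Suc M" by simp
        also have "\<dots> < e" using MM e C by (simp add: field_simps)
        finally show ?thesis .
      qed
      then show "\<exists>M. \<forall>m\<ge>M. \<forall>n\<ge>M. N (\<lambda>z. G m z - G n z) < e" by blast
    qed (use G in auto)
    define x where "x = cauchy_rel S N `` {G}"
    have x: "x \<in> completion S N" unfolding x_def completion_def by (rule quotientI[OF Gc])
    have Gx: "G \<in> x" unfolding x_def using equiv_class_self[OF eqv Gc] .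
    have "(\<lambda>n. NY (\<lambda>z. G n z - f z)) \<longlonglongrightarrow> 0"
    proof (rule tendsto_sandwich[of "\<lambda>_. 0" _ _ "\<lambda>n. 1 / Suc n"])
      show "(\<lambda>n. 1 / real (Suc n)) \<longlonglongrightarrow> 0" using LIMSEQ_inverse_real_of_nat by (simp add: inverse_eq_divide)
      show "\<forall>\<^sub>F n in sequentially. 0 \<le> NY (\<lambda>z. G n z - f z)"
        using GY f by (auto intro!: always_eventually Y.norm_nonneg Y.diff_mem)
      show "\<forall>\<^sub>F n in sequentially. NY (\<lambda>z. G n z - f z) \<le> 1 / Suc n"
        using G2 by (auto intro!: always_eventually less_imp_le)
    qed simp
    then have "represents x f" by (rule rep[OF x Gx f])
    then show "\<exists>x. x \<in> completion S N \<and> represents x f" using x by blast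
  next
    fix x y assume xy: "x \<in> completion S N \<and> represents x f" "y \<in> completion S N \<and> represents y f"
    obtain F G where F: "F \<in> x" and G: "G \<in> y" using nonempty xy by metis
    have Fc: "F \<in> cauchy_seqs S N" and Gc: "G \<in> cauchy_seqs S N" using sub xy F G by blast+
    have mY: "\<And>n. F n \<in> Y" "\<And>n. G n \<in> Y" using memS Fc Gc SY by blast+
    have lF: "(\<lambda>n. NY (\<lambda>z. F n z - f z)) \<longlonglongrightarrow> 0" and lG: "(\<lambda>n. NY (\<lambda>z. G n z - f z)) \<longlonglongrightarrow> 0"
      using rep_lim xy F G by blast+
    have "(\<lambda>n. N (\<lambda>z. F n z - G n z)) \<longlonglongrightarrow> 0"
    proof (rule tendsto_sandwich[of "\<lambda>_. 0"])
      show "(\<lambda>n. C * (NY (\<lambda>z. F n z - f z) + NY (\<lambda>z. G n z - f z))) \<longlonglongrightarrow> 0"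
        by (intro tendsto_mult_right_zero tendsto_add_zero lF lG)
      show "\<forall>\<^sub>F n in sequentially. 0 \<le> N (\<lambda>z. F n z - G n z)"
        by (intro always_eventually allI S.norm_nonneg S.diff_mem memS[OF Fc] memS[OF Gc])
      show "\<forall>\<^sub>F n in sequentially. N (\<lambda>z. F n z - G n z) \<le> C * (NY (\<lambda>z. F n z - f z) + NY (\<lambda>z. G n z - f z))"
      proof (intro always_eventually allI)
        fix n
        have "N (\<lambda>z. F n z - G n z) \<le> C * NY (\<lambda>z. F n z - G n z)"
          by (intro le2 S.diff_mem memS[OF Fc] memS[OF Gc])
        also have "\<dots> \<le> C * (NY (\<lambda>z. F n z - f z) + NY (\<lambda>z. f z - G n z))"
          using C by (intro mult_left_mono Y.norm_triangle mY f) auto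
        also have "NY (\<lambda>z. f z - G n z) = NY (\<lambda>z. G n z - f z)" by (rule Y.norm_commute[OF f mY(2)])
        finally show "N (\<lambda>z. F n z - G n z) \<le> C * (NY (\<lambda>z. F n z - f z) + NY (\<lambda>z. G n z - f z))" .
      qed
    qed simp
    then have "(F, G) \<in> cauchy_rel S N" using Fc Gc by (simp add: cauchy_rel_def)
    then show "x = y" using quotient_eq_iff[OF eqv, of x y F G] xy F G unfolding completion_def by simp
  qed
  have 3: "NY f / C \<le> completion_norm N x \<and> completion_norm N x \<le> C * NY f"
    if x: "x \<in> completion S N" and f: "f \<in> Y" and r: "represents x f" for x f
  proof -
    obtain F where F: "F \<in> x" using nonempty[OF x] by blast
    have m: "F n \<in> S" for n using sub[OF x F] memS by blast
    have mY: "F n \<in> Y" for n using m SY by auto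
    have l1: "(\<lambda>n. N (F n)) \<longlonglongrightarrow> completion_norm N x" by (rule S.completion_norm_limit[OF x F])
    have "(\<lambda>n. NY (F n) - NY f) \<longlonglongrightarrow> 0"
      by (rule Lim_null_comparison[OF _ rep_lim[OF x F r]])
         (use Y.norm_reverse[OF mY f] in \<open>auto intro: always_eventually\<close>)
    then have l2: "(\<lambda>n. NY (F n)) \<longlonglongrightarrow> NY f" by (simp add: LIM_zero_iff)
    have "NY f \<le> C * completion_norm N x"
      by (rule LIMSEQ_le[OF l2 tendsto_mult_left[OF l1]]) (use le1 m in auto)
    moreover have "completion_norm N x \<le> C * NY f"
      by (rule LIMSEQ_le[OF l1 tendsto_mult_left[OF l2]]) (use le2 m in auto)
    ultimately show ?thesis using C by (simp add: field_simps)
  qed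
  show ?thesis
    unfolding same_function_space_def comparable_on_def
    using 1 2 3 C by (intro conjI ballI exI[of _ C]) auto
qed

context function_seminorm
begin

lemma add_mem: "f \<in> S \<Longrightarrow> g \<in> S \<Longrightarrow> (\<lambda>z. f z + g z) \<in> S"
  using diff_mem[of f "\<lambda>z. - g z"] diff_mem[OF zero_mem, of g] by simp

lemma norm_add: "f \<in> S \<Longrightarrow> g \<in> S \<Longrightarrow> N (\<lambda>z. f z + g z) \<le> N f + N g"
  using norm_diff[of f "\<lambda>z. - g z"] diff_mem[OF zero_mem, of g] norm_uminus[of g] by simp

lemma sum_mem: "finite I \<Longrightarrow> (\<And>i. i \<in> I \<Longrightarrow> F i \<in> S) \<Longrightarrow> (\<lambda>z. \<Sum>i\<in>I. F i z) \<in> S"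
  by (induction I rule: finite_induct) (auto intro: zero_mem add_mem)

lemma norm_sum_le: "finite I \<Longrightarrow> (\<And>i. i \<in> I \<Longrightarrow> F i \<in> S) \<Longrightarrow> N (\<lambda>z. \<Sum>i\<in>I. F i z) \<le> (\<Sum>i\<in>I. N (F i))"
proof (induction I rule: finite_induct)
  case (insert i I)
  have "N (\<lambda>z. F i z + (\<Sum>i\<in>I. F i z)) \<le> N (F i) + N (\<lambda>z. \<Sum>i\<in>I. F i z)"
    using insert by (intro norm_add sum_mem) auto
  then show ?case using insert by simp
qed (simp add: norm_zero)

end

section \<open>Circle means and roots of unity\<close>

lemma riemann_sum_close:
  fixes g :: "real \<Rightarrow> real"
  assumes g: "g integrable_on {0..1}" and N: "N > 0"
    and osc: "\<And>j t. j < N \<Longrightarrow> real j / real N \<le> t \<Longrightarrow> t \<le> (real j + 1) / real N \<Longrightarrow> \<bar>g t - g (real j / real N)\<bar> \<le> e"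
  shows "\<bar>integral {0..1} g - (\<Sum>j<N. g (real j / real N)) / real N\<bar> \<le> e"
proof -
  have N0: "real N > 0" using N by simp
  have sub: "g integrable_on {a..b}" if "0 \<le> a" "b \<le> 1" for a b
    using integrable_on_subinterval[OF g] that by auto
  have step: "\<bar>integral {real j / N..(real j + 1) / N} g - g (real j / N) / N\<bar> \<le> e / N" if j: "j < N" for j
  proof -
    define a where "a = real j / N"
    have b: "(real j + 1) / N = a + 1 / N" by (simp add: a_def add_divide_distrib)
    have le1: "a + 1 / N \<le> 1" using j N0 unfolding b[symmetric] by (simp add: field_simps) 
    have a0: "0 \<le> a" by (simp add: a_def)
    have i: "g integrable_on {a..a + 1 / N}" using sub a0 le1 by blast
    have "integral {a..a + 1 / N} g - g a / N = integral {a..a + 1 / N} (\<lambda>t. g t - g a)"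
      using i N0 by (subst integral_diff) auto
    also have "norm \<dots> \<le> integral {a..a + 1 / N} (\<lambda>t. e)"
      using i osc[OF j] by (intro integral_norm_bound_integral integrable_diff) (auto simp: a_def add_divide_distrib)
    also have "\<dots> = e / N" using N0 by simp
    finally show ?thesis by (simp add: b flip: a_def)
  qed
  have ind: "k \<le> N \<Longrightarrow> integral {0..real k / N} g = (\<Sum>j<k. integral {real j / N..(real j + 1) / N} g)" for k
  proof (induction k)
    case (Suc k)
    have "integral {0..real k / N} g + integral {real k / N..real (Suc k) / N} g = integral {0..real (Suc k) / N} g"
      using Suc.prems N0 by (intro Henstock_Kurzweil_Integration.integral_combine sub) (auto simp: field_simps)
    then show ?case using Suc by (simp add: add.commute)
  qed simp
  have "integral {0..1} g = (\<Sum>j<N. integral {real j / N..(real j + 1) / N} g)"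
    using ind[of N] N0 by simp
  then have "\<bar>integral {0..1} g - (\<Sum>j<N. g (real j / real N)) / real N\<bar>
     = \<bar>\<Sum>j<N. integral {real j / N..(real j + 1) / N} g - g (real j / N) / N\<bar>"
    by (simp add: sum_subtractf sum_divide_distrib)
  also have "\<dots> \<le> (\<Sum>j<N. e / N)"
    by (rule order_trans[OF sum_abs sum_mono]) (use step in auto)
  also have "\<dots> = e" using N0 by simp
  finally show ?thesis .
qed

definition circle_mean :: "(complex \<Rightarrow> real) \<Rightarrow> complex \<Rightarrow> real" where
  "circle_mean u z = integral {0..1} (\<lambda>t. u (z * cis (2 * pi * t)))"

definition root_of_one :: "nat \<Rightarrow> nat \<Rightarrow> complex" where
  "root_of_one N j = cis (2 * pi * (real j / real N))"

lemma norm_root_of_one [simp]: "cmod (root_of_one N j) = 1"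
  by (simp add: root_of_one_def)

lemma dist_cis_le: "cmod (cis a - cis b) \<le> \<bar>a - b\<bar>"
proof -
  have "cis a - cis b = cis b * (cis (a - b) - 1)" by (simp add: algebra_simps cis_mult)
  then have "cmod (cis a - cis b) = cmod (exp (\<i> * of_real (a - b)) - 1)"
    by (simp add: norm_mult cis_conv_exp)
  also have "\<dots> \<le> \<bar>a - b\<bar>"
  proof -
    have "cmod (exp (\<i> * of_real (a - b)) - 1) = 2 * \<bar>sin ((a - b) / 2)\<bar>"
      by (simp add: dist_exp_i_1 del: of_real_diff)
    also have "\<dots> \<le> 2 * \<bar>(a - b) / 2\<bar>" by (intro mult_left_mono abs_sin_x_le_abs_x) auto
    finally show ?thesis by simp
  qed
  finally show ?thesis .
qed

lemma circle_mean_integrable: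
  fixes u :: "complex \<Rightarrow> real"
  assumes u: "continuous_on (cball 0 R) u" and z: "cmod z \<le> R"
  shows "(\<lambda>t. u (z * cis (2 * pi * t))) integrable_on {a..b}"
  by (intro integrable_continuous_real continuous_on_compose2[OF u] continuous_intros) (auto simp: norm_mult z)

text \<open>
  The point is that the threshold does not depend on \<open>z\<close>: the modulus of continuity of \<open>u\<close> on the
  closed ball serves all circles at once.
\<close>
lemma circle_mean_riemann:
  fixes u :: "complex \<Rightarrow> real"
  assumes u: "continuous_on (cball 0 R) u" and e: "e > 0"
  shows "\<exists>N0>0. \<forall>N\<ge>N0. \<forall>z. cmod z \<le> R \<longrightarrow>
     \<bar>circle_mean u z - (\<Sum>j<N. u (z * root_of_one N j)) / real N\<bar> \<le> e"
proof (cases "R \<ge> 0")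
  case R: True
  obtain d where d: "d > 0" "\<And>x y. x \<in> cball 0 R \<Longrightarrow> y \<in> cball 0 R \<Longrightarrow> dist x y < d \<Longrightarrow> dist (u x) (u y) < e"
    using compact_uniformly_continuous[OF u compact_cball] e unfolding uniformly_continuous_on_def by metis
  obtain N0 :: nat where N0: "real N0 > R * 2 * pi / d" using reals_Archimedean2 by blast
  show ?thesis
  proof (intro exI[of _ "Suc N0"] conjI allI impI)
    fix N z assume N: "Suc N0 \<le> N" and z: "cmod z \<le> R"
    have Np: "real N > 0" using N by simp
    have "R * 2 * pi / d < real N" using N0 N by linarith
    then have small: "R * (2 * pi / N) < d" using d(1) Np by (simp add: field_simps)
    show "\<bar>circle_mean u z - (\<Sum>j<N. u (z * root_of_one N j)) / real N\<bar> \<le> e"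
      unfolding circle_mean_def root_of_one_def
    proof (rule riemann_sum_close)
      show "(\<lambda>t. u (z * cis (2 * pi * t))) integrable_on {0..1}"
        by (rule circle_mean_integrable[OF u z])
      show "N > 0" using N by simp
      fix j t assume t: "real j / N \<le> t" "t \<le> (real j + 1) / N"
      have "dist (z * cis (2 * pi * t)) (z * cis (2 * pi * (real j / N)))
         = cmod z * cmod (cis (2 * pi * t) - cis (2 * pi * (real j / N)))"
        by (simp add: dist_norm flip: right_diff_distrib norm_mult)
      also have "\<dots> \<le> R * \<bar>2 * pi * t - 2 * pi * (real j / N)\<bar>"
        using z R by (intro mult_mono dist_cis_le) auto
      also have "\<dots> \<le> R * (2 * pi / N)"
      proof -
        have "t - real j / N \<le> 1 / N" using t by (simp add: add_divide_distrib)
        then have "2 * pi * (t - real j / N) \<le> 2 * pi * (1 / N)" by (intro mult_left_mono) auto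
        moreover have "\<bar>2 * pi * t - 2 * pi * (real j / N)\<bar> = 2 * pi * (t - real j / N)"
        proof -
          have "2 * pi * t - 2 * pi * (real j / N) = 2 * pi * (t - real j / N)" by (simp add: right_diff_distrib)
          moreover have "0 \<le> t - real j / N" using t by simp
          ultimately show ?thesis by (simp only: abs_mult) simp
        qed
        ultimately show ?thesis using R by (intro mult_left_mono) auto
      qed
      also have "\<dots> < d" by (rule small)
      finally have "dist (u (z * cis (2 * pi * t))) (u (z * cis (2 * pi * (real j / N)))) < e"
        using z by (intro d(2)) (auto simp: norm_mult)
      then show "\<bar>u (z * cis (2 * pi * t)) - u (z * cis (2 * pi * (real j / N)))\<bar> \<le> e"
        by (simp add: dist_real_def)
    qed
  qed simp
next
  case False
  then have "\<not> cmod z \<le> R" for z using norm_ge_zero[of z] by linarith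
  then show ?thesis by blast
qed

lemma circle_mean_rotate_frac:
  fixes u :: "complex \<Rightarrow> real"
  assumes u: "continuous_on (cball 0 R) u" and z: "cmod z \<le> R" and b: "0 \<le> b" "b \<le> 1"
  shows "circle_mean u (z * cis (2 * pi * b)) = circle_mean u z"
proof -
  define G where "G = (\<lambda>t. u (z * cis (2 * pi * t)))"
  have i: "G integrable_on {x..y}" for x y unfolding G_def by (rule circle_mean_integrable[OF u z])
  have per: "G (t + 1) = G t" for t
    by (simp add: G_def distrib_left cis_mult[symmetric])
  have "circle_mean u (z * cis (2 * pi * b)) = integral {0..1} (\<lambda>t. G (t + b))"
    by (simp add: circle_mean_def G_def distrib_left cis_mult[symmetric] mult_ac)
  also have "\<dots> = integral {b..1+b} G"
    using integral_shift_real_ivl[of b b "1+b" G] by simp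
  also have "\<dots> = integral {b..1} G + integral {1..1+b} G"
    using b by (intro Henstock_Kurzweil_Integration.integral_combine[symmetric] i) auto
  also have "integral {1..1+b} G = integral {0..b} (\<lambda>t. G (t + 1))"
    using integral_shift_real_ivl[of 1 1 "1+b" G] by simp
  also have "\<dots> = integral {0..b} G" by (simp add: per)
  also have "integral {b..1} G + integral {0..b} G = integral {0..1} G"
    using Henstock_Kurzweil_Integration.integral_combine[of 0 b 1 G] b i by simp
  finally show ?thesis by (simp add: circle_mean_def G_def)
qed

lemma circle_mean_eq_norm:
  fixes u :: "complex \<Rightarrow> real"
  assumes u: "continuous_on (cball 0 R) u" and z: "cmod z \<le> R"
  shows "circle_mean u z = circle_mean u (of_real (cmod z))"
proof -
  define b where "b = frac (Arg z / (2 * pi))"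
  have "cis (2 * pi * b) = cis (Arg z)"
  proof -
    have "2 * pi * b = Arg z + 2 * pi * of_int (- \<lfloor>Arg z / (2 * pi)\<rfloor>)"
      by (simp add: b_def frac_def right_diff_distrib)
    then show ?thesis by (simp only: cis_mult[symmetric] cis_multiple_2pi Ints_of_int mult_1_right)
  qed
  then have zz: "z = of_real (cmod z) * cis (2 * pi * b)"
    by (metis rcis_cmod_Arg rcis_def)
  show ?thesis
    by (subst zz, rule circle_mean_rotate_frac[OF u])
       (use z in \<open>auto simp: b_def intro: less_imp_le[OF frac_lt_1]\<close>)
qed

abbreviation pmean :: "real \<Rightarrow> (complex \<Rightarrow> complex) \<Rightarrow> real \<Rightarrow> real" where
  "pmean p f r \<equiv> circle_mean (\<lambda>z. cmod (f z) powr p) (of_real r)"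

lemma continuous_powr_holo:
  assumes "f holomorphic_on unit_disc" "R < 1" "p > 0"
  shows "continuous_on (cball 0 R) (\<lambda>z. cmod (f z) powr p)"
proof -
  have "continuous_on (cball 0 R) f"
    using holomorphic_on_imp_continuous_on[OF assms(1)] by (rule continuous_on_subset) (use assms(2) in auto)
  then show ?thesis using assms(3) by (intro continuous_on_powr' continuous_intros) auto
qed

lemma circle_mean_mono_fun:
  assumes "continuous_on (cball 0 R) u" "continuous_on (cball 0 R) v" "cmod z \<le> R"
    "\<And>w. cmod w = cmod z \<Longrightarrow> u w \<le> v w"
  shows "circle_mean u z \<le> circle_mean v z"
  unfolding circle_mean_def
  by (intro integral_le circle_mean_integrable[OF assms(1,3)] circle_mean_integrable[OF assms(2,3)])
     (auto simp: norm_mult assms(4))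

lemma circle_mean_nonneg: "(\<And>w. 0 \<le> u w) \<Longrightarrow> 0 \<le> circle_mean u z"
  unfolding circle_mean_def
  by (cases "(\<lambda>t. u (z * cis (2 * pi * t))) integrable_on {0..1}")
     (auto intro!: integral_nonneg simp: not_integrable_integral)

text \<open>
  The classical monotonicity of integral means. For the mean over the \<open>N\<close> rotations of a point \<open>z0\<close>,
  dualise: with \<open>g\<^sub>j = cnj (f (z0 \<zeta>\<^sub>j)) |f (z0 \<zeta>\<^sub>j)|\<^sup>p\<^sup>-\<^sup>2\<close> the analytic function
  \<open>F(z) = \<Sum> f (z \<zeta>\<^sub>j) g\<^sub>j\<close> takes the value \<open>\<Sum> |f (z0 \<zeta>\<^sub>j)|\<^sup>p\<close> at \<open>z0\<close>, while Young's inequality bounds it on the larger circle.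
  The maximum modulus principle compares the two, and \<open>N \<rightarrow> \<infinity>\<close> turns the discrete means into
  integrals.
\<close>
lemma pmean_mono:
  assumes f: "f holomorphic_on unit_disc" and p: "p > 1" and r: "0 \<le> r" "r \<le> R" "R < 1"
  shows "pmean p f r \<le> pmean p f R"
proof (cases "r = R")
  case False
  then have rR: "r < R" using r by simp
  define u where "u = (\<lambda>z. cmod (f z) powr p)"
  have cu: "continuous_on (cball 0 R) u" unfolding u_def using f p r by (intro continuous_powr_holo) auto
  have "pmean p f r \<le> pmean p f R + (1 + p) * e" if e: "e > 0" for e
  proof -
    obtain N where N: "N > 0" and NN: "\<And>z. cmod z \<le> R \<Longrightarrow>
        \<bar>circle_mean u z - (\<Sum>j<N. u (z * root_of_one N j)) / real N\<bar> \<le> e"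
      using circle_mean_riemann[OF cu e] by blast
    define S where "S = (\<lambda>z. (\<Sum>j<N. u (z * root_of_one N j)) / real N)"
    define z0 where "z0 = complex_of_real r"
    define g where "g = (\<lambda>j. cnj (f (z0 * root_of_one N j)) * of_real (cmod (f (z0 * root_of_one N j)) powr (p - 2)))"
    define F where "F = (\<lambda>z. \<Sum>j<N. f (z * root_of_one N j) * g j)"
    have holF: "F holomorphic_on ball 0 1"
      unfolding F_def
      by (intro holomorphic_intros holomorphic_on_compose_gen[OF _ f, unfolded o_def]) (auto simp: norm_mult)
    have pw: "x ^ 2 * x powr (p - 2) = x powr p" if "x \<ge> 0" for x
      using that p by (cases "x = 0") (auto simp: powr_diff power2_eq_square)
    have gn: "cmod (g j) = cmod (f (z0 * root_of_one N j)) powr (p - 1)" for j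
    proof (cases "f (z0 * root_of_one N j) = 0")
      case False
      then have "cmod (f (z0 * root_of_one N j)) * cmod (f (z0 * root_of_one N j)) powr (p - 2)
          = cmod (f (z0 * root_of_one N j)) powr (p - 1)"
        by (simp add: powr_mult_base)
      then show ?thesis by (simp add: g_def norm_mult)
    qed (simp add: g_def)
    have Fz0: "F z0 = of_real (real N * S z0)"
    proof -
      have "f (z0 * root_of_one N j) * g j = of_real (u (z0 * root_of_one N j))" for j
        unfolding g_def u_def mult.assoc[symmetric] complex_norm_square[symmetric]
        by (simp only: of_real_mult[symmetric] of_real_power[symmetric] pw norm_ge_zero)
      then show ?thesis using N by (simp add: F_def S_def)
    qed
    have bd: "cmod (F w) \<le> real N * ((pmean p f R + e) / p + S z0 * (1 - 1 / p))" if w: "cmod w = R" for w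
    proof -
      have "cmod (F w) \<le> (\<Sum>j<N. cmod (f (w * root_of_one N j)) * cmod (g j))"
        unfolding F_def by (rule order_trans[OF norm_sum]) (simp add: norm_mult)
      also have "\<dots> \<le> (\<Sum>j<N. u (w * root_of_one N j) / p + u (z0 * root_of_one N j) * (1 - 1 / p))"
      proof (rule sum_mono)
        fix j
        have "cmod (f (w * root_of_one N j)) * cmod (g j)
          \<le> cmod (f (w * root_of_one N j)) powr p / p + cmod (g j) powr (p / (p - 1)) / (p / (p - 1))"
          using p by (intro Youngs_inequality) (auto simp: field_simps)
        also have "\<dots> = u (w * root_of_one N j) / p + u (z0 * root_of_one N j) * (1 - 1 / p)"
        proof -
          have "(p - 1) * (p / (p - 1)) = p" using p by simp
          then have "cmod (g j) powr (p / (p - 1)) = u (z0 * root_of_one N j)"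
            by (simp add: gn u_def powr_powr)
          moreover have "a / (p / (p - 1)) = a * (1 - 1 / p)" for a using p by (simp add: field_simps)
          ultimately show ?thesis by (simp add: u_def)
        qed
        finally show "cmod (f (w * root_of_one N j)) * cmod (g j)
           \<le> u (w * root_of_one N j) / p + u (z0 * root_of_one N j) * (1 - 1 / p)" .
      qed
      also have "\<dots> = real N * (S w / p + S z0 * (1 - 1 / p))"
        unfolding sum.distrib sum_divide_distrib[symmetric] sum_distrib_right[symmetric]
        using N by (simp add: S_def distrib_left)
      also have "\<dots> \<le> real N * ((pmean p f R + e) / p + S z0 * (1 - 1 / p))"
      proof -
        have "S w \<le> circle_mean u w + e" using NN[of w] w by (simp add: S_def abs_le_iff)
        also have "circle_mean u w = pmean p f R"
          using circle_mean_eq_norm[OF cu, of w] w by (simp add: u_def)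
        finally show ?thesis using p by (intro mult_left_mono add_right_mono divide_right_mono) auto
      qed
      finally show ?thesis .
    qed
    have "cmod (F z0) \<le> real N * ((pmean p f R + e) / p + S z0 * (1 - 1 / p))"
    proof (rule maximum_modulus_frontier[of F "ball 0 R"])
      show "F holomorphic_on interior (ball 0 R)"
        using holF by (rule holomorphic_on_subset) (use r in auto)
      show "continuous_on (closure (ball 0 R)) F"
        using holomorphic_on_imp_continuous_on[OF holF] by (rule continuous_on_subset) (use r rR in auto)
      show "cmod (F w) \<le> real N * ((pmean p f R + e) / p + S z0 * (1 - 1 / p))" if "w \<in> frontier (ball 0 R)" for w
        using that bd r rR by auto
    qed (use r rR in \<open>auto simp: z0_def\<close>)
    moreover have "S z0 \<ge> 0" by (auto simp: S_def u_def intro!: divide_nonneg_nonneg sum_nonneg)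
    ultimately have "real N * S z0 \<le> real N * ((pmean p f R + e) / p + S z0 * (1 - 1 / p))"
      unfolding Fz0 by (simp del: of_real_mult)
    then have "S z0 \<le> (pmean p f R + e) / p + S z0 * (1 - 1 / p)" using N by simp
    then have "S z0 / p \<le> (pmean p f R + e) / p" by (simp add: right_diff_distrib)
    then have "S z0 \<le> pmean p f R + e" using p by (simp add: divide_le_cancel)
    moreover have "circle_mean u z0 \<le> S z0 + e" using NN[of z0] r by (simp add: S_def z0_def abs_le_iff)
    ultimately have "pmean p f r \<le> pmean p f R + 2 * e" by (simp add: z0_def u_def)
    also have "\<dots> \<le> pmean p f R + (1 + p) * e" using p e by simp
    finally show ?thesis .
  qed
  then have "pmean p f r \<le> pmean p f R + e" if "e > 0" for e
    using that[THEN divide_pos_pos, of "1 + p"] p by fastforce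
  then show ?thesis by (rule field_le_epsilon)
qed simp

text \<open>
  Cauchy's formula bounds \<open>f z\<close> by the mean of \<open>|f|\<close> over a larger circle, and
  \<open>y \<le> B + B\<^sup>1\<^sup>-\<^sup>p y\<^sup>p\<close> bounds that mean by \<open>2 B\<close>. Asking for a positive \<open>B\<close> avoids a case distinction on
  whether the mean vanishes.
\<close>
lemma pmean_point_bound:
  assumes f: "f holomorphic_on unit_disc" and p: "p > 1" and r: "0 \<le> r" "r < R" "R < 1"
    and B: "B > 0" "pmean p f R \<le> B powr p" and z: "cmod z \<le> r"
  shows "cmod (f z) \<le> 2 * B / (R - r)"
proof -
  have "((\<lambda>u. f u / (u - z)) has_contour_integral (2 * of_real pi * \<i> * f z)) (circlepath 0 R)"
    using r z by (intro Cauchy_integral_circlepath_simple holomorphic_on_subset[OF f]) auto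
  then have "((\<lambda>t. f (circlepath 0 R t) / (circlepath 0 R t - z)
      * vector_derivative (circlepath 0 R) (at t within {0..1})) has_integral (2 * of_real pi * \<i> * f z)) {0..1}"
    by (simp add: has_contour_integral_def)
  then have "((\<lambda>t::real. f (of_real R * exp (2 * of_real pi * \<i> * of_real t)) / (of_real R * exp (2 * of_real pi * \<i> * of_real t) - z)
      * (2 * pi * \<i> * R * exp (2 * of_real pi * \<i> * of_real t))) has_integral (2 * of_real pi * \<i> * f z)) {0..1}"
    by (rule has_integral_eq[rotated]) (simp add: vector_derivative_circlepath01, simp add: circlepath)
  then have hi: "((\<lambda>t. f (of_real R * cis (2 * pi * t)) / (of_real R * cis (2 * pi * t) - z)
      * (2 * pi * \<i> * R * cis (2 * pi * t))) has_integral (2 * of_real pi * \<i> * f z)) {0..1}"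
    by (simp add: cis_conv_exp mult_ac)
  have i2: "(\<lambda>t. cmod (f (of_real R * cis (2 * pi * t))) powr p) integrable_on {0..1}"
    using r p by (intro circle_mean_integrable[where R = R] continuous_powr_holo[OF f]) auto
  have "cmod (2 * of_real pi * \<i> * f z) \<le> integral {0..1} (\<lambda>t. 2 * pi / (R - r) * (B + B powr (1 - p) * cmod (f (of_real R * cis (2 * pi * t))) powr p))"
    unfolding integral_unique[OF hi, symmetric]
  proof (rule integral_norm_bound_integral)
    show "(\<lambda>t. 2 * pi / (R - r) * (B + B powr (1 - p) * cmod (f (of_real R * cis (2 * pi * t))) powr p)) integrable_on {0..1}"
      by (intro integrable_on_mult_right integrable_add i2 integrable_const_ivl)
    fix t
    define w where "w = of_real R * cis (2 * pi * t)"
    have wR: "cmod w = R" using r by (simp add: w_def norm_mult)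
    have d: "R - r \<le> cmod (w - z)" using norm_triangle_ineq2[of w z] wR z by simp
    define y where "y = cmod (f w)"
    have y: "y \<le> B + B powr (1 - p) * y powr p"
    proof (cases "y \<le> B")
      case False
      then have y0: "y > 0" using B by linarith
      have "y = y powr (1 - p) * y powr p" using y0 by (simp flip: powr_add)
      also have "\<dots> \<le> B powr (1 - p) * y powr p"
        using False B p by (intro mult_right_mono powr_mono2') auto
      finally show ?thesis using B by simp
    qed (auto intro: order_trans[OF _ le_add_same_cancel1[THEN iffD2]])
    have "cmod (f w / (w - z) * (2 * pi * \<i> * R * cis (2 * pi * t))) = y / cmod (w - z) * (2 * pi * R)"
      using r by (simp add: norm_mult norm_divide y_def)
    also have "\<dots> \<le> (B + B powr (1 - p) * y powr p) / (R - r) * (2 * pi * 1)"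
      using y d r B by (intro mult_mono frac_le) (auto simp: y_def)
    finally show "cmod (f (of_real R * cis (2 * pi * t)) / (of_real R * cis (2 * pi * t) - z)
      * (2 * pi * \<i> * R * cis (2 * pi * t))) \<le> 2 * pi / (R - r) * (B + B powr (1 - p) * cmod (f (of_real R * cis (2 * pi * t))) powr p)"
      by (simp add: w_def y_def mult_ac)
  qed (use hi in blast)
  also have "\<dots> = 2 * pi / (R - r) * (B + B powr (1 - p) * pmean p f R)"
    using integral_unique[OF has_integral_add[OF has_integral_const_real[of B 0 1] has_integral_mult_right[OF integrable_integral[OF i2], of "B powr (1 - p)"]]]
    by (simp add: circle_mean_def)
  also have "\<dots> \<le> 2 * pi / (R - r) * (B + B powr (1 - p) * B powr p)"
    using r B by (intro mult_left_mono add_left_mono) auto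
  also have "B powr (1 - p) * B powr p = B" using B by (simp flip: powr_add)
  finally have "2 * pi * cmod (f z) \<le> 2 * pi * (2 * B / (R - r))"
    by (simp add: norm_mult)
  then show ?thesis by (rule mult_left_le_imp_le) simp
qed

lemma root_of_one_pow: "root_of_one N l ^ k = root_of_one N (k mod N)  ^ l" if "N > 0"
proof -
  have "root_of_one N l ^ k = cis (2 * pi * (real (l * k) / real N))"
    by (simp add: root_of_one_def Complex.DeMoivre mult_ac)
  also have "l * k = l * (k mod N) + N * (l * (k div N))"
    by (metis distrib_left mod_mult_div_eq mult.left_commute)
  also have "2 * pi * (real (l * (k mod N) + N * (l * (k div N))) / real N)
      = 2 * pi * (real l * real (k mod N) / N) + 2 * pi * real (l * (k div N))"
    using that by (simp add: field_simps)
  also have "cis \<dots> = cis (2 * pi * (real l * real (k mod N) / N))"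
    by (simp only: cis_mult[symmetric]) (simp add: cis_multiple_2pi)
  also have "\<dots> = root_of_one N (k mod N) ^ l"
    by (simp add: root_of_one_def Complex.DeMoivre mult_ac)
  finally show ?thesis .
qed

lemma root_of_one_orthogonal:
  assumes N: "N > 0"
  shows "(\<Sum>l<N. root_of_one N l ^ k * cnj (root_of_one N l) ^ m) = (if k mod N = m mod N then of_nat N else 0)"
proof -
  define x where "x = root_of_one N (k mod N) * cnj (root_of_one N (m mod N))"
  have trm: "root_of_one N l ^ k * cnj (root_of_one N l) ^ m = x ^ l" for l
    using root_of_one_pow[OF N, of l k] root_of_one_pow[OF N, of l m]
    by (simp add: x_def power_mult_distrib flip: complex_cnj_power)
  have nz: "root_of_one N (m mod N) * cnj (root_of_one N (m mod N)) = 1"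
    by (simp flip: complex_norm_square)
  show ?thesis
  proof (cases "k mod N = m mod N")
    case True
    then have "x = 1" using nz by (simp add: x_def)
    then show ?thesis using True by (simp add: trm)
  next
    case False
    have "root_of_one N (k mod N) \<noteq> root_of_one N (m mod N)"
    proof
      assume a: "root_of_one N (k mod N) = root_of_one N (m mod N)"
      have "inj_on (\<lambda>k. cis (2 * pi * real k / real N)) {..<N}"
        using Complex.bij_betw_roots_unity[OF N] by (simp add: bij_betw_def)
      then show False using a False N by (auto simp: inj_on_def root_of_one_def)
    qed
    then have x1: "x \<noteq> 1"
      unfolding x_def using nz by (metis mult_cancel_right mult_zero_right zero_neq_one)
    have "x ^ N = root_of_one N N ^ k * cnj (root_of_one N N) ^ m" by (rule trm[symmetric])
    also have "\<dots> = 1" using N by (simp add: root_of_one_def)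
    finally have "x ^ N = 1" .
    then show ?thesis using False x1 by (simp add: trm geometric_sum)
  qed
qed

section \<open>Finite sums of products\<close>

text \<open>
  The scalar that turns a sum of products into an average is absorbed by the first factor.
\<close>
locale factor_spaces = A: function_seminorm A NA + B: function_seminorm B NB
  for A B :: "('a \<Rightarrow> complex) set" and NA NB :: "('a \<Rightarrow> complex) \<Rightarrow> real" +
  assumes scale_A: "\<phi> \<in> A \<Longrightarrow> (\<lambda>z. c * \<phi> z) \<in> A \<and> NA (\<lambda>z. c * \<phi> z) \<le> cmod c * NA \<phi>"
begin

lemma product_norm_le:
  assumes "factorization A B f n \<phi> \<psi>"
  shows "product_norm A NA B NB f \<le> (\<Sum>k<n. NA (\<phi> k) * NB (\<psi> k))"
  unfolding product_norm_def
proof (rule cInf_lower)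
  show "bdd_below {\<Sum>k<n. NA (\<phi> k) * NB (\<psi> k) |n \<phi> \<psi>. factorization A B f n \<phi> \<psi>}"
    by (rule bdd_belowI[of _ 0])
       (auto simp: factorization_def intro!: sum_nonneg mult_nonneg_nonneg A.norm_nonneg B.norm_nonneg)
qed (use assms in blast)

lemma product_norm_nonneg:
  assumes "f \<in> product_sums A B"
  shows "0 \<le> product_norm A NA B NB f"
  unfolding product_norm_def
  by (rule cInf_greatest)
     (use assms in \<open>auto simp: product_sums_def factorization_def intro!: sum_nonneg mult_nonneg_nonneg A.norm_nonneg B.norm_nonneg\<close>)

lemma product_norm_approx:
  assumes "f \<in> product_sums A B" "e > 0"
  obtains n \<phi> \<psi> where "factorization A B f n \<phi> \<psi>"
    "(\<Sum>k<n. NA (\<phi> k) * NB (\<psi> k)) < product_norm A NA B NB f + e"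
proof -
  have "Inf {\<Sum>k<n. NA (\<phi> k) * NB (\<psi> k) |n \<phi> \<psi>. factorization A B f n \<phi> \<psi>} < product_norm A NA B NB f + e"
    using assms(2) by (simp add: product_norm_def)
  moreover have "{\<Sum>k<n. NA (\<phi> k) * NB (\<psi> k) |n \<phi> \<psi>. factorization A B f n \<phi> \<psi>} \<noteq> {}"
    using assms(1) by (auto simp: product_sums_def)
  ultimately obtain x where "x \<in> {\<Sum>k<n. NA (\<phi> k) * NB (\<psi> k) |n \<phi> \<psi>. factorization A B f n \<phi> \<psi>}"
     "x < product_norm A NA B NB f + e"
    by (rule cInf_lessD[rotated, THEN bexE]) blast
  then show thesis using that by blast
qed

lemma factorization_diff:
  assumes f: "factorization A B f n \<phi> \<psi>" and g: "factorization A B g m \<phi>' \<psi>'"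
  shows "\<exists>\<Phi> \<Psi>. factorization A B (\<lambda>z. f z - g z) (n + m) \<Phi> \<Psi> \<and>
    (\<Sum>k<n + m. NA (\<Phi> k) * NB (\<Psi> k)) = (\<Sum>k<n. NA (\<phi> k) * NB (\<psi> k)) + (\<Sum>k<m. NA (\<phi>' k) * NB (\<psi>' k))"
proof -
  define \<Phi> where "\<Phi> = (\<lambda>k. if k < n then \<phi> k else (\<lambda>z. - \<phi>' (k - n) z))"
  define \<Psi> where "\<Psi> = (\<lambda>k. if k < n then \<psi> k else \<psi>' (k - n))"
  have spl: "(\<Sum>k<n + m. h k) = (\<Sum>k<n. h k) + (\<Sum>k<m. h (n + k))" for h :: "nat \<Rightarrow> 'c::comm_monoid_add"
    by (induction m) (auto simp: add.assoc)
  have neg: "(\<lambda>z. - u z) \<in> A" if "u \<in> A" for u using A.diff_mem[OF A.zero_mem that] by simp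
  have "factorization A B (\<lambda>z. f z - g z) (n + m) \<Phi> \<Psi>"
    unfolding factorization_def
  proof
    show "\<forall>k<n + m. \<Phi> k \<in> A \<and> \<Psi> k \<in> B"
      using f g by (auto simp: factorization_def \<Phi>_def \<Psi>_def intro!: neg)
    show "(\<lambda>z. f z - g z) = (\<lambda>z. \<Sum>k<n + m. \<Phi> k z * \<Psi> k z)"
      using f g by (auto simp: factorization_def spl \<Phi>_def \<Psi>_def sum_negf)
  qed
  moreover have "(\<Sum>k<n + m. NA (\<Phi> k) * NB (\<Psi> k)) = (\<Sum>k<n. NA (\<phi> k) * NB (\<psi> k)) + (\<Sum>k<m. NA (\<phi>' k) * NB (\<psi>' k))"
    unfolding spl using g by (auto simp: \<Phi>_def \<Psi>_def A.norm_uminus factorization_def)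
  ultimately show ?thesis by blast
qed

lemma product_sums_seminorm: "function_seminorm (product_sums A B) (product_norm A NA B NB)"
proof
  have z: "factorization A B (\<lambda>_. 0) 0 \<phi> \<psi>" for \<phi> \<psi> by (simp add: factorization_def)
  then show z0: "(\<lambda>_. 0) \<in> product_sums A B" unfolding product_sums_def by blast
  show "product_norm A NA B NB (\<lambda>_. 0) = 0"
    using product_norm_le[OF z] product_norm_nonneg[OF z0] by simp
  fix f assume f: "f \<in> product_sums A B"
  show "0 \<le> product_norm A NA B NB f" by (rule product_norm_nonneg[OF f])
  fix g assume g: "g \<in> product_sums A B"
  show "(\<lambda>z. f z - g z) \<in> product_sums A B"
    using f g factorization_diff unfolding product_sums_def by blast
  show "product_norm A NA B NB (\<lambda>z. f z - g z) \<le> product_norm A NA B NB f + product_norm A NA B NB g"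
  proof (rule field_le_epsilon)
    fix e :: real assume "e > 0"
    then have e: "e / 2 > 0" by simp
    obtain n \<phi> \<psi> where 1: "factorization A B f n \<phi> \<psi>"
      "(\<Sum>k<n. NA (\<phi> k) * NB (\<psi> k)) < product_norm A NA B NB f + e / 2"
      by (rule product_norm_approx[OF f e])
    obtain m \<phi>' \<psi>' where 2: "factorization A B g m \<phi>' \<psi>'"
      "(\<Sum>k<m. NA (\<phi>' k) * NB (\<psi>' k)) < product_norm A NA B NB g + e / 2"
      by (rule product_norm_approx[OF g e])
    obtain \<Phi> \<Psi> where "factorization A B (\<lambda>z. f z - g z) (n + m) \<Phi> \<Psi>"
      "(\<Sum>k<n + m. NA (\<Phi> k) * NB (\<Psi> k)) = (\<Sum>k<n. NA (\<phi> k) * NB (\<psi> k)) + (\<Sum>k<m. NA (\<phi>' k) * NB (\<psi>' k))"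
      using factorization_diff[OF 1(1) 2(1)] by blast
    then show "product_norm A NA B NB (\<lambda>z. f z - g z) \<le> product_norm A NA B NB f + product_norm A NA B NB g + e"
      using product_norm_le 1(2) 2(2) by fastforce
  qed
qed

lemma product_mem:
  assumes "\<phi> \<in> A" "\<psi> \<in> B"
  shows "(\<lambda>z. \<phi> z * \<psi> z) \<in> product_sums A B"
    and "product_norm A NA B NB (\<lambda>z. \<phi> z * \<psi> z) \<le> NA \<phi> * NB \<psi>"
proof -
  have f: "factorization A B (\<lambda>z. \<phi> z * \<psi> z) 1 (\<lambda>_. \<phi>) (\<lambda>_. \<psi>)"
    using assms by (simp add: factorization_def)
  then show "(\<lambda>z. \<phi> z * \<psi> z) \<in> product_sums A B" unfolding product_sums_def by blast
  show "product_norm A NA B NB (\<lambda>z. \<phi> z * \<psi> z) \<le> NA \<phi> * NB \<psi>"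
    using product_norm_le[OF f] by simp
qed

text \<open>
  Averaging over the roots of unity recovers the diagonal of a double sum: if \<open>\<zeta>\<close> runs through the \<open>N\<close>-th
  roots of unity, \<open>N = card I\<close>, then the mean of \<open>(\<Sum> \<zeta>\<^sup>i \<Phi>\<^sub>i) (\<Sum> \<zeta>\<^sup>-\<^sup>j \<Psi>\<^sub>j)\<close> is \<open>\<Sum> \<Phi>\<^sub>i \<Psi>\<^sub>i\<close>.
  A bound on the factors that is uniform in unimodular coefficients therefore costs nothing,
  although the number of products grows with \<open>I\<close>.
\<close>
lemma product_norm_diagonal:
  assumes I: "finite I"
    and A: "\<And>c. (\<And>i. i \<in> I \<Longrightarrow> cmod (c i) = 1) \<Longrightarrow>
        (\<lambda>z. \<Sum>i\<in>I. c i * \<Phi> i z) \<in> A \<and> NA (\<lambda>z. \<Sum>i\<in>I. c i * \<Phi> i z) \<le> U"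
    and B: "\<And>c. (\<And>i. i \<in> I \<Longrightarrow> cmod (c i) = 1) \<Longrightarrow>
        (\<lambda>z. \<Sum>i\<in>I. c i * \<Psi> i z) \<in> B \<and> NB (\<lambda>z. \<Sum>i\<in>I. c i * \<Psi> i z) \<le> V"
  shows "(\<lambda>z. \<Sum>i\<in>I. \<Phi> i z * \<Psi> i z) \<in> product_sums A B \<and>
     product_norm A NA B NB (\<lambda>z. \<Sum>i\<in>I. \<Phi> i z * \<Psi> i z) \<le> U * V"
proof (cases "I = {}")
  case True
  interpret P: function_seminorm "product_sums A B" "product_norm A NA B NB" by (rule product_sums_seminorm)
  have "0 \<le> U" "0 \<le> V" using A[of "\<lambda>_. 1"] B[of "\<lambda>_. 1"] True A.norm_zero B.norm_zero by auto
  then show ?thesis using True P.zero_mem P.norm_zero by simp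
next
  case False
  define N where "N = card I"
  have N: "N > 0" using False I by (simp add: N_def card_gt_0_iff)
  obtain h where h: "bij_betw h I {0..<N}"
    using ex_bij_betw_finite_nat[OF I] unfolding N_def by blast
  have hlt: "h i < N" if "i \<in> I" for i using h that by (auto simp: bij_betw_def)
  have hinj: "h i = h j \<longleftrightarrow> i = j" if "i \<in> I" "j \<in> I" for i j
    using h that by (auto simp: bij_betw_def inj_on_def)
  define w where "w = root_of_one N"
  define \<phi> where "\<phi> = (\<lambda>l z. (1 / of_nat N) * (\<Sum>i\<in>I. w l ^ h i * \<Phi> i z))"
  define \<psi> where "\<psi> = (\<lambda>l z. \<Sum>i\<in>I. cnj (w l) ^ h i * \<Psi> i z)"
  have phi: "\<phi> l \<in> A" "NA (\<phi> l) \<le> U / N" for l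
  proof -
    have a: "(\<lambda>z. \<Sum>i\<in>I. w l ^ h i * \<Phi> i z) \<in> A \<and> NA (\<lambda>z. \<Sum>i\<in>I. w l ^ h i * \<Phi> i z) \<le> U"
      by (rule A) (simp add: w_def norm_power)
    show "\<phi> l \<in> A" using scale_A a unfolding \<phi>_def by blast
    have "NA (\<phi> l) \<le> cmod (1 / of_nat N) * NA (\<lambda>z. \<Sum>i\<in>I. w l ^ h i * \<Phi> i z)"
      using scale_A a unfolding \<phi>_def by blast
    also have "\<dots> \<le> cmod (1 / of_nat N) * U" using a by (intro mult_left_mono) auto
    finally show "NA (\<phi> l) \<le> U / N" by (simp add: norm_divide)
  qed
  have psi: "\<psi> l \<in> B" "NB (\<psi> l) \<le> V" for l
    using B[of "\<lambda>i. cnj (w l) ^ h i"] by (simp_all add: \<psi>_def w_def norm_power)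
  have eq: "(\<Sum>l<N. \<phi> l z * \<psi> l z) = (\<Sum>i\<in>I. \<Phi> i z * \<Psi> i z)" for z
  proof -
    have "(\<Sum>l<N. \<phi> l z * \<psi> l z)
       = (\<Sum>l<N. \<Sum>i\<in>I. \<Sum>j\<in>I. (1 / of_nat N) * (\<Phi> i z * \<Psi> j z) * (w l ^ h i * cnj (w l) ^ h j))"
    proof (intro sum.cong refl)
      fix l
      have "\<phi> l z * \<psi> l z = (1 / of_nat N) * ((\<Sum>i\<in>I. w l ^ h i * \<Phi> i z) * (\<Sum>j\<in>I. cnj (w l) ^ h j * \<Psi> j z))"
        by (simp add: \<phi>_def \<psi>_def)
      also have "\<dots> = (\<Sum>i\<in>I. \<Sum>j\<in>I. (1 / of_nat N) * (\<Phi> i z * \<Psi> j z) * (w l ^ h i * cnj (w l) ^ h j))"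
        by (subst sum_product) (simp add: sum_distrib_left mult_ac)
      finally show "\<phi> l z * \<psi> l z = (\<Sum>i\<in>I. \<Sum>j\<in>I. (1 / of_nat N) * (\<Phi> i z * \<Psi> j z) * (w l ^ h i * cnj (w l) ^ h j))" .
    qed
    also have "\<dots> = (\<Sum>i\<in>I. \<Sum>l<N. \<Sum>j\<in>I. (1 / of_nat N) * (\<Phi> i z * \<Psi> j z) * (w l ^ h i * cnj (w l) ^ h j))"
      by (rule sum.swap)
    also have "\<dots> = (\<Sum>i\<in>I. \<Sum>j\<in>I. \<Sum>l<N. (1 / of_nat N) * (\<Phi> i z * \<Psi> j z) * (w l ^ h i * cnj (w l) ^ h j))"
      by (intro sum.cong refl sum.swap)
    also have "\<dots> = (\<Sum>i\<in>I. \<Sum>j\<in>I. if i = j then \<Phi> i z * \<Psi> i z else 0)"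
      using N hlt hinj
      unfolding sum_distrib_left[symmetric] w_def root_of_one_orthogonal[OF N]
      by (intro sum.cong refl) auto
    also have "\<dots> = (\<Sum>i\<in>I. \<Phi> i z * \<Psi> i z)" using I by simp
    finally show ?thesis .
  qed
  have f: "factorization A B (\<lambda>z. \<Sum>i\<in>I. \<Phi> i z * \<Psi> i z) N \<phi> \<psi>"
    using phi psi by (simp add: factorization_def eq)
  have "product_norm A NA B NB (\<lambda>z. \<Sum>i\<in>I. \<Phi> i z * \<Psi> i z) \<le> (\<Sum>l<N. NA (\<phi> l) * NB (\<psi> l))"
    by (rule product_norm_le[OF f])
  also have "\<dots> \<le> (\<Sum>l<N. U / N * V)"
    using phi psi by (intro sum_mono mult_mono' A.norm_nonneg B.norm_nonneg)
  also have "\<dots> = U * V" using N by simp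
  finally show ?thesis using f unfolding product_sums_def by blast
qed

end

section \<open>Radial weights in polar coordinates\<close>

lemma image_mult_eq_vimage:
  fixes c :: complex
  assumes "c \<noteq> 0"
  shows "(*) c ` U = (*) (inverse c) -` U"
proof safe
  fix x assume "inverse c * x \<in> U"
  then show "x \<in> (*) c ` U" using assms by (intro image_eqI[of _ _ "inverse c * x"]) auto
qed (use assms in \<open>auto simp: mult.assoc[symmetric]\<close>)

text \<open>
  By Vitali's covering theorem an open set is a disjoint union of balls up to a null set. Rotation
  maps these balls to disjoint balls of the same area. One inequality is enough, as it may be
  applied to the inverse rotation as well.
\<close>
lemma emeasure_rotate_open_le:
  fixes U :: "complex set"
  assumes U: "open U" and c: "cmod c = 1"
  shows "emeasure lborel U \<le> emeasure lborel ((*) c ` U)"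
proof -
  obtain C where C: "countable C" "C \<subseteq> {(a,r). 0 < r \<and> ball a r \<subseteq> U}"
      "pairwise (\<lambda>i j. disjnt (ball (fst i) (snd i)) (ball (fst j) (snd j))) C"
      "negligible (U - (\<Union>i\<in>C. ball (fst i) (snd i)))"
  proof (rule Vitali_covering_theorem_balls[of U "{(a,r). 0 < r \<and> ball a r \<subseteq> U}" fst snd])
    fix x and d :: real assume "x \<in> U" "0 < d"
    obtain e where "e > 0" "ball x e \<subseteq> U" using \<open>x \<in> U\<close> U openE by blast
    then show "\<exists>i. i \<in> {(a, r). 0 < r \<and> ball a r \<subseteq> U} \<and> x \<in> ball (fst i) (snd i) \<and> snd i < d"
      using \<open>0 < d\<close> by (intro exI[of _ "(x, min e (d/2))"]) auto
  qed blast
  define V where "V = (\<Union>i\<in>C. ball (fst i) (snd i))"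
  have VU: "V \<subseteq> U" using C(2) by (fastforce simp: V_def)
  have opV: "open V" by (auto simp: V_def)
  have img: "(*) c ` ball a r = ball (c * a) r" for a r
  proof -
    have c0: "c \<noteq> 0" using c by auto
    have "dist (c * a) (c * x) = dist a x" for x
      by (simp add: dist_norm c flip: right_diff_distrib norm_mult) (simp add: norm_mult c)
    then show ?thesis
      apply (auto simp: image_iff)
      subgoal for x using c0 by (intro bexI[of _ "x / c"]) (auto, metis nonzero_mult_div_cancel_left times_divide_eq_right)
      done
  qed
  have disj: "disjoint_family_on (\<lambda>i. ball (fst i) (snd i)) C"
    using C(3) by (auto simp: disjoint_family_on_def pairwise_def disjnt_def)
  have disj': "disjoint_family_on (\<lambda>i. ball (c * fst i) (snd i)) C"
  proof -
    have inj: "inj ((*) c)" using c by (auto simp: inj_on_def)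
    show ?thesis unfolding disjoint_family_on_def img[symmetric]
      using disj inj by (metis (no_types, lifting) disjoint_family_on_def image_Int image_empty)
  qed
  have nul: "U - V \<in> null_sets lborel"
    using C(4) U opV by (auto simp: V_def negligible_iff_null_sets null_sets_completion_iff)
  have "emeasure lborel U = emeasure lborel (V \<union> (U - V))" using VU by (simp add: Un_absorb1)
  also have "\<dots> = emeasure lborel V" using nul opV by (intro emeasure_Un_null_set) auto
  also have "\<dots> = (\<integral>\<^sup>+i. emeasure lborel (ball (fst i) (snd i)) \<partial>count_space C)"
    unfolding V_def by (rule emeasure_UN_countable[OF _ C(1) disj]) auto
  also have "\<dots> = (\<integral>\<^sup>+i. emeasure lborel (ball (c * fst i) (snd i)) \<partial>count_space C)"
    using C(2) by (intro nn_integral_cong) (auto simp: emeasure_ball)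
  also have "\<dots> = emeasure lborel (\<Union>i\<in>C. ball (c * fst i) (snd i))"
    by (rule emeasure_UN_countable[OF _ C(1) disj', symmetric]) auto
  also have "(\<Union>i\<in>C. ball (c * fst i) (snd i)) = (*) c ` V"
    unfolding V_def image_UN img ..
  also have "emeasure lborel ((*) c ` V) \<le> emeasure lborel ((*) c ` U)"
  proof (rule emeasure_mono)
    have "(*) c ` U = (\<lambda>z. inverse c * z) -` U"
      using c by (intro image_mult_eq_vimage) auto
    moreover have "open ((\<lambda>z. inverse c * z) -` U)"
      by (intro open_vimage U continuous_intros)
    ultimately show "(*) c ` U \<in> sets lborel" by simp
  qed (use VU in auto)
  finally show ?thesis .
qed

lemma lborel_complex_rotate:
  assumes c: "cmod c = 1"
  shows "distr lborel borel ((*) c) = (lborel :: complex measure)"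
proof (rule sym, rule lborel_eqI)
  fix l u :: complex
  assume le: "\<And>b. b \<in> Basis \<Longrightarrow> l \<bullet> b \<le> u \<bullet> b"
  have c0: "c \<noteq> 0" using c by auto
  have v: "(*) c -` box l u = (*) (inverse c) ` box l u"
    using image_mult_eq_vimage[of "inverse c" "box l u"] c0 by simp
  have w: "(*) c ` ((*) c -` box l u) = box l u"
    using image_mult_eq_vimage[of c "(*) c -` box l u"] c0 by (auto simp: vimage_def mult.assoc[symmetric])
  have op: "open ((*) c -` box l u)" by (intro open_vimage open_box continuous_intros)
  have "emeasure lborel ((*) c -` box l u) \<le> emeasure lborel (box l u)"
    using emeasure_rotate_open_le[OF op c] w by simp
  moreover have "emeasure lborel (box l u) \<le> emeasure lborel ((*) c -` box l u)"
    using emeasure_rotate_open_le[OF open_box, of "inverse c" l u] c v by (simp add: norm_inverse)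
  ultimately have "emeasure lborel ((*) c -` box l u) = emeasure lborel (box l u)" by simp
  then show "emeasure (distr lborel borel ((*) c)) (box l u) = (\<Prod>b\<in>Basis. (u - l) \<bullet> b)"
    using le by (simp add: emeasure_distr emeasure_lborel_box_eq)
qed simp

lemma nn_integral_rotate:
  fixes G :: "complex \<Rightarrow> ennreal"
  assumes c: "cmod c = 1" and [measurable]: "G \<in> borel_measurable borel"
  shows "(\<integral>\<^sup>+z. G (c * z) \<partial>lborel) = (\<integral>\<^sup>+z. G z \<partial>lborel)"
  by (subst (2) lborel_complex_rotate[OF c, symmetric]) (simp add: nn_integral_distr)

lemma distr_lborel_cmod:
  "distr lborel borel cmod = density lborel (\<lambda>s. ennreal (2 * pi * s) * indicator {0..} s)"
proof (rule measure_eqI_generator_eq)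
  let ?E = "range atMost :: real set set"
  have e1: "emeasure (distr lborel borel cmod) {..a} = ennreal (pi * (max 0 a)^2)" for a
  proof -
    have "cmod -` {..a} = cball 0 a" by auto
    then have "emeasure (distr lborel borel cmod) {..a} = emeasure lborel (cball 0 a :: complex set)"
      by (simp add: emeasure_distr)
    also have "\<dots> = ennreal (pi * (max 0 a)^2)"
    proof (cases "a \<ge> 0")
      case True
      then show ?thesis by (simp add: emeasure_cball eval_unit_ball_vol max_def)
    qed auto
    finally show ?thesis .
  qed
  have e2: "emeasure (density lborel (\<lambda>s. ennreal (2 * pi * s) * indicator {0..} s)) {..a}
          = ennreal (pi * (max 0 a)^2)" for a
  proof -
    have "emeasure (density lborel (\<lambda>s. ennreal (2 * pi * s) * indicator {0..} s)) {..a}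
       = (\<integral>\<^sup>+s. ennreal (2 * pi * s) * indicator {0..max 0 a} s \<partial>lborel)"
      apply (simp add: emeasure_density)
      apply (intro nn_integral_cong_AE)
      using AE_lborel_singleton[of "0::real"]
      apply eventually_elim
      apply (auto simp: indicator_def max_def)
      done
    also have "\<dots> = ennreal (pi * (max 0 a)^2 - pi * 0^2)"
      by (rule nn_integral_FTC_Icc) (auto intro!: derivative_eq_intros)
    finally show ?thesis by simp
  qed
  show "Int_stable ?E" by (auto simp: Int_stable_def)
  show "?E \<subseteq> Pow UNIV" by auto
  show "sets (distr lborel borel cmod) = sigma_sets UNIV ?E"
    by (simp add: borel_eq_atMost)
  show "sets (density lborel (\<lambda>s. ennreal (2 * pi * s) * indicator {0..} s)) = sigma_sets UNIV ?E"
    by (simp add: borel_eq_atMost)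
  show "range (\<lambda>n::nat. {..real n}) \<subseteq> ?E" by auto
  show "(\<Union>n::nat. {..real n}) = UNIV" using real_arch_simple by auto
  show "emeasure (distr lborel borel cmod) {..real n} \<noteq> \<infinity>" for n by (simp add: e1)
  show "emeasure (distr lborel borel cmod) X =
     emeasure (density lborel (\<lambda>s. ennreal (2 * pi * s) * indicator {0..} s)) X" if "X \<in> ?E" for X
    using that e1 e2 by auto
qed

text \<open>
  Integration in polar coordinates for functions of the modulus. It rests on the area of
  discs, which determines the image of Lebesgue measure under the modulus.
\<close>
lemma nn_integral_cmod:
  fixes g :: "real \<Rightarrow> ennreal"
  assumes [measurable]: "g \<in> borel_measurable borel"
  shows "(\<integral>\<^sup>+z. g (cmod z) \<partial>lborel) = (\<integral>\<^sup>+s. ennreal (2 * pi * s) * indicator {0..} s * g s \<partial>lborel)"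
proof -
  have "(\<integral>\<^sup>+z. g (cmod z) \<partial>lborel) = (\<integral>\<^sup>+s. g s \<partial>distr lborel borel cmod)"
    by (simp add: nn_integral_distr)
  also have "\<dots> = (\<integral>\<^sup>+s. ennreal (2 * pi * s) * indicator {0..} s * g s \<partial>lborel)"
    by (simp add: distr_lborel_cmod nn_integral_density)
  finally show ?thesis .
qed

lemma open_radii_of_open:
  fixes U :: "complex set"
  assumes U: "open U"
  shows "open {s. 0 < s \<and> sphere 0 s \<subseteq> U}"
  unfolding open_dist
proof safe
  fix s :: real assume s: "0 < s" "sphere 0 s \<subseteq> U"
  obtain e where e: "0 < e" "(\<Union>x\<in>sphere 0 s. ball x e) \<subseteq> U"
    using compact_subset_open_imp_ball_epsilon_subset[OF compact_sphere U s(2)] by blast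
  have "0 < s' \<and> sphere 0 s' \<subseteq> U" if s': "dist s' s < min e s" for s'
  proof -
    have p: "s' > 0" using that by (auto simp: dist_real_def)
    moreover have "z \<in> U" if z: "z \<in> sphere 0 s'" for z
    proof -
      have zz: "cmod z = s'" using z by simp
      define x where "x = of_real (s / s') * z"
      have x: "x \<in> sphere 0 s" using zz p s by (simp add: x_def norm_mult norm_divide)
      have "dist x z = cmod (of_real (s/s' - 1) * z)"
        by (simp add: x_def dist_norm algebra_simps)
      also have "\<dots> = \<bar>s / s' - 1\<bar> * s'" using zz by (simp add: norm_mult del: of_real_diff)
      also have "\<dots> = \<bar>s - s'\<bar>" using p by (simp add: field_simps abs_if)
      also have "\<dots> < e" using s' by (simp add: dist_real_def abs_minus_commute)
      finally have "z \<in> ball x e" by simp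
      then show ?thesis using e(2) x by blast
    qed
    ultimately show ?thesis by blast
  qed
  moreover have "min e s > 0" using e s by simp
  ultimately show "\<exists>e>0. \<forall>y. dist y s < e \<longrightarrow> y \<in> {s. 0 < s \<and> sphere 0 s \<subseteq> U}" by blast
qed

text \<open>
  A measurable set is almost contained in open sets \<open>U\<^sub>n\<close>, and the radii of the circles inside \<open>U\<^sub>n\<close> form an
  open set by compactness of circles. Intersecting over \<open>n\<close> gives a Borel set of radii.
\<close>
lemma borel_radii_hull:
  fixes T :: "complex set"
  assumes T: "T \<in> sets lebesgue"
  obtains N :: "real set" and Z :: "complex set"
    where "N \<in> sets borel" "\<And>s. s > 0 \<Longrightarrow> sphere 0 s \<subseteq> T \<Longrightarrow> s \<in> N"
      "N \<subseteq> {0<..}" "Z \<in> null_sets lebesgue" "\<And>z. cmod z \<in> N \<Longrightarrow> z \<in> T \<union> Z"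
proof -
  have "\<exists>U. open U \<and> T \<subseteq> U \<and> U - T \<in> lmeasurable \<and> emeasure lebesgue (U - T) < ennreal (1 / Suc n)" for n
    using sets_lebesgue_outer_open[OF T, of "1 / Suc n"] by (metis of_nat_0_less_iff zero_less_Suc zero_less_divide_1_iff)
  then obtain U where U: "\<And>n. open (U n)" "\<And>n. T \<subseteq> U n" "\<And>n. U n - T \<in> lmeasurable"
      "\<And>n. emeasure lebesgue (U n - T) < ennreal (1 / Suc n)" by metis
  define Z where "Z = (\<Inter>n. U n - T)"
  have Zs: "Z \<in> sets lebesgue" unfolding Z_def using U(3) by (intro sets.countable_INT) (auto simp: fmeasurableD)
  have Zl: "emeasure lebesgue Z \<le> ennreal (1 / Suc n)" for n
  proof -
    have "emeasure lebesgue Z \<le> emeasure lebesgue (U n - T)"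
      using U(3) by (intro emeasure_mono) (auto simp: Z_def fmeasurableD)
    then show ?thesis using U(4)[of n] by simp
  qed
  have "emeasure lebesgue Z \<le> ennreal 0"
  proof (rule LIMSEQ_le_const)
    show "(\<lambda>n. ennreal (1 / Suc n)) \<longlonglongrightarrow> ennreal 0"
      by (intro tendsto_ennrealI LIMSEQ_inverse_real_of_nat[unfolded inverse_eq_divide])
    show "\<exists>N. \<forall>n\<ge>N. emeasure lebesgue Z \<le> ennreal (1 / Suc n)" using Zl by blast
  qed
  then have Z0: "Z \<in> null_sets lebesgue" using Zs by (auto simp: null_sets_def)
  define N where "N = (\<Inter>n. {s. 0 < s \<and> sphere 0 s \<subseteq> U n})"
  have "N \<in> sets borel" unfolding N_def
    by (intro sets.countable_INT) (use open_radii_of_open[OF U(1)] in auto)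
  moreover have "s \<in> N" if "s > 0" "sphere 0 s \<subseteq> T" for s using that U(2) by (auto simp: N_def)
  moreover have "z \<in> T \<union> Z" if z: "cmod z \<in> N" for z
  proof -
    have "z \<in> sphere 0 (cmod z)" by simp
    then have "z \<in> U n" for n using z unfolding N_def by blast
    then show ?thesis by (auto simp: Z_def)
  qed
  moreover have "N \<subseteq> {0<..}" by (auto simp: N_def)
  ultimately show thesis using that[of N Z] Z0 by blast
qed

lemma null_radii:
  fixes N :: "real set"
  assumes N: "N \<in> sets borel" "N \<subseteq> {0<..}" and Z: "{z. cmod z \<in> N} \<in> null_sets lebesgue"
  shows "N \<in> null_sets lborel"
proof -
  have [measurable]: "N \<in> sets borel" by fact
  have m: "{z. cmod z \<in> N} \<in> sets borel" by measurable
  have "0 = emeasure lborel {z. cmod z \<in> N}" using Z m by (simp add: null_sets_completion_iff null_sets_def)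
  also have "\<dots> = (\<integral>\<^sup>+z. indicator N (cmod z) \<partial>lborel)"
  proof -
    have "(\<integral>\<^sup>+z. indicator N (cmod z) \<partial>lborel) = (\<integral>\<^sup>+z. indicator {z. cmod z \<in> N} z \<partial>lborel)"
      by (intro nn_integral_cong) (simp add: indicator_def)
    then show ?thesis using m by simp
  qed
  also have "\<dots> = (\<integral>\<^sup>+s. ennreal (2 * pi * s) * indicator {0..} s * indicator N s \<partial>lborel)"
    by (rule nn_integral_cmod) auto
  finally have "AE s in lborel. ennreal (2 * pi * s) * indicator {0..} s * indicator N s = 0"
    by (subst nn_integral_0_iff_AE[symmetric]) auto
  then have "AE s in lborel. s \<notin> N"
    by eventually_elim (use N(2) in \<open>auto simp: indicator_def mult_le_0_iff split: if_splits\<close>)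
  then show ?thesis using N(1) by (subst (asm) AE_iff_null_sets[symmetric]) auto
qed

text \<open>
  A rotation-invariant set in the plane is measurable only if its set of radii is. The Borel hull
  \<open>N\<close> of the radii is applied twice: the excess \<open>N - S\<close> has a hull of its own, which is null by polar coordinates.
\<close>
lemma lebesgue_radii:
  fixes S :: "real set"
  assumes S: "S \<subseteq> {0<..}" and T: "{z. cmod z \<in> S} \<in> sets lebesgue"
  shows "S \<in> sets lebesgue"
proof -
  obtain N and Z :: "complex set"
    where N: "N \<in> sets borel" "\<And>s. s > 0 \<Longrightarrow> sphere 0 s \<subseteq> {z. cmod z \<in> S} \<Longrightarrow> s \<in> N"
      "N \<subseteq> {0<..}" "Z \<in> null_sets lebesgue" "\<And>z. cmod z \<in> N \<Longrightarrow> z \<in> {z. cmod z \<in> S} \<union> Z"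
    using borel_radii_hull[OF T] by metis
  have SN: "S \<subseteq> N" using N(2) S by (auto simp: subset_iff)
  have Z': "{z. cmod z \<in> N - S} \<in> null_sets lebesgue"
    by (rule null_sets_completion_subset[OF _ N(4)]) (use N(5) in auto)
  obtain N2 and Z2 :: "complex set"
    where N2: "N2 \<in> sets borel" "\<And>s. s > 0 \<Longrightarrow> sphere 0 s \<subseteq> {z. cmod z \<in> N - S} \<Longrightarrow> s \<in> N2"
      "N2 \<subseteq> {0<..}" "Z2 \<in> null_sets lebesgue" "\<And>z. cmod z \<in> N2 \<Longrightarrow> z \<in> {z. cmod z \<in> N - S} \<union> Z2"
    using borel_radii_hull[of "{z. cmod z \<in> N - S}"] Z' by (metis null_setsD2)
  have "{z. cmod z \<in> N2} \<in> null_sets lebesgue"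
    by (rule null_sets_completion_subset[OF _ null_sets.Un[OF Z' N2(4)]]) (use N2(5) in auto)
  then have n2: "N2 \<in> null_sets lborel" using null_radii N2 by blast
  have "N - S \<subseteq> N2" using N2(2) N(3) by (auto simp: subset_iff)
  then have "N - S \<in> null_sets lebesgue"
    using n2 null_sets_completion_subset[of "N - S" N2 lborel] null_sets_completionI by blast
  then have "N - (N - S) \<in> sets lebesgue"
    using N(1) by (metis null_setsD2 sets.Diff sets_completionI_sets sets_lborel)
  moreover have "N - (N - S) = S" using SN by auto
  ultimately show ?thesis by simp
qed

lemma lebesgue_radial_profile:
  fixes \<omega> :: "complex \<Rightarrow> real"
  assumes m: "\<omega> \<in> borel_measurable (lebesgue_on unit_disc)"
    and nn: "\<And>z. z \<in> unit_disc \<Longrightarrow> 0 \<le> \<omega> z"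
    and w: "\<And>z. z \<in> unit_disc \<Longrightarrow> \<omega> z = \<omega> (complex_of_real (cmod z))"
  shows "(\<lambda>s. if 0 < s \<and> s < 1 then \<omega> (of_real s) else 0) \<in> borel_measurable lebesgue"
proof -
  define g where "g = (\<lambda>s::real. if 0 < s \<and> s < 1 then \<omega> (of_real s) else 0)"
  have "{s \<in> space lebesgue. a < g s} \<in> sets lebesgue" for a
  proof (cases "a < 0")
    case True
    have "0 \<le> g s" for s using nn[of "of_real s"] by (auto simp: g_def)
    then have "a < g s" for s using True less_le_trans by blast
    then have "{s \<in> space lebesgue. a < g s} = UNIV" by simp
    then show ?thesis by simp
  next
    case False
    have eq: "{z. cmod z \<in> {s \<in> space lebesgue. a < g s}} = {z \<in> unit_disc. a < \<omega> z} - {0}"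
    proof (rule set_eqI)
      fix z
      show "z \<in> {z. cmod z \<in> {s \<in> space lebesgue. a < g s}} \<longleftrightarrow> z \<in> {z \<in> unit_disc. a < \<omega> z} - {0}"
      proof (cases "z \<in> unit_disc")
        case True
        define c where "c = \<omega> (of_real (cmod z))"
        have "\<omega> z = c" unfolding c_def by (rule w[OF True])
        then show ?thesis using False True c_def by (simp add: g_def)
      next
        case out: False
        then show ?thesis using False by (simp add: g_def)
      qed
    qed
    have "{z \<in> space (lebesgue_on unit_disc). a < \<omega> z} \<in> sets (lebesgue_on unit_disc)"
      using m unfolding borel_measurable_iff_greater by blast
    then have "{z \<in> unit_disc. a < \<omega> z} \<in> sets lebesgue"
      by (simp add: sets_restrict_space_iff)
    then have "{z. cmod z \<in> {s \<in> space lebesgue. a < g s}} \<in> sets lebesgue"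
      unfolding eq by (rule sets.Diff) auto
    moreover have "{s \<in> space lebesgue. a < g s} \<subseteq> {0<..}" using False by (auto simp: g_def split: if_splits)
    ultimately show ?thesis by (rule lebesgue_radii[rotated])
  qed
then have "g \<in> borel_measurable lebesgue" by (rule borel_measurableI_greater)
  then show ?thesis by (simp only: g_def)
qed

text \<open>
  The tail integral of a weight is defined on the radius, its integrability over the disc in the plane. The
  two are related through a Borel function of the modulus that agrees with the weight almost everywhere in both
  senses; the section of a measurable radial function is measurable by \<open>lebesgue_radii\<close>.
\<close>
lemma radial_weight_profile:
  assumes rw: "radial_weight \<omega>"
  obtains g :: "real \<Rightarrow> real" where "g \<in> borel_measurable borel" "\<And>s. 0 \<le> g s"
    "AE z in lebesgue_on unit_disc. \<omega> z = g (cmod z)"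
    "\<And>r. 0 \<le> r \<Longrightarrow> weight_hat \<omega> r = (\<integral>\<^sup>+s. ennreal (g s) * indicator {r..<1} s \<partial>lborel)"
proof -
  have nn: "\<And>z. z \<in> unit_disc \<Longrightarrow> 0 \<le> \<omega> z"
    and w: "\<And>z. z \<in> unit_disc \<Longrightarrow> \<omega> z = \<omega> (complex_of_real (cmod z))"
    using rw unfolding radial_weight_def by blast+
  have "\<omega> \<in> borel_measurable disc_area"
    using rw unfolding radial_weight_def by (blast dest: borel_measurable_integrable)
  then have m: "\<omega> \<in> borel_measurable (lebesgue_on unit_disc)" by (simp add: disc_area_def)
  define g0 where "g0 = (\<lambda>s::real. if 0 < s \<and> s < 1 then \<omega> (of_real s) else 0)"
  have g0: "g0 \<in> borel_measurable lebesgue" unfolding g0_def by (rule lebesgue_radial_profile[OF m nn w])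
  have g0nn: "0 \<le> g0 s" for s using nn[of "of_real s"] by (auto simp: g0_def)
  obtain g1 where g1: "g1 \<in> borel_measurable lborel" "AE s in lborel. g0 s = g1 s"
    using completion_ex_borel_measurable_real[OF g0] by blast
  define g where "g = (\<lambda>s. max 0 (g1 s))"
  have [measurable]: "g \<in> borel_measurable borel" using g1(1) unfolding g_def by simp
  have ae: "AE s in lborel. g0 s = g s"
    using g1(2)
  proof eventually_elim
    case (elim s)
    then show ?case using g0nn[of s] by (simp add: g_def)
  qed
  obtain N where N: "N \<in> null_sets lborel" "{s. g0 s \<noteq> g s} \<subseteq> N"
    using ae by (auto simp: eventually_ae_filter)
  have [measurable]: "N \<in> sets borel" using N by auto
  have N2: "{z. cmod z \<in> N} \<in> sets (borel :: complex measure)" by measurable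
  have "emeasure lborel {z::complex. cmod z \<in> N} = (\<integral>\<^sup>+z. indicator {z::complex. cmod z \<in> N} z \<partial>lborel)"
    using N2 by simp
  also have "\<dots> = (\<integral>\<^sup>+z. indicator N (cmod z) \<partial>lborel)"
    by (intro nn_integral_cong) (simp add: indicator_def)
  also have "\<dots> = (\<integral>\<^sup>+s. ennreal (2 * pi * s) * indicator {0..} s * indicator N s \<partial>lborel)"
    by (rule nn_integral_cmod) auto
  also have "\<dots> = 0"
  proof -
    have "AE s in lborel. s \<notin> N" using N(1) AE_not_in by blast
    then have "AE s in lborel. ennreal (2 * pi * s) * indicator {0..} s * indicator N s = 0"
      by eventually_elim auto
    then show ?thesis by (subst nn_integral_0_iff_AE) auto
  qed
  finally have "{z::complex. cmod z \<in> N} \<in> null_sets lborel" using N2 by (auto simp: null_sets_def)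
  then have "AE z::complex in lborel. cmod z \<notin> N" using AE_not_in by fastforce
  then have "AE z::complex in lborel. z \<in> unit_disc \<longrightarrow> \<omega> z = g (cmod z)"
    using AE_lborel_singleton[of 0]
  proof eventually_elim
    case (elim z)
    then have "g0 (cmod z) = g (cmod z)" using N(2) by blast
    moreover have "g0 (cmod z) = \<omega> z" if "z \<in> unit_disc"
      unfolding w[OF that] using that elim by (simp add: g0_def)
    ultimately show ?case by simp
  qed
  then have "AE z in lebesgue. z \<in> unit_disc \<longrightarrow> \<omega> z = g (cmod z)" by (rule AE_completion)
  then have 3: "AE z in lebesgue_on unit_disc. \<omega> z = g (cmod z)"
    by (subst AE_restrict_space_iff) auto
  have 4: "weight_hat \<omega> r = (\<integral>\<^sup>+s. ennreal (g s) * indicator {r..<1} s \<partial>lborel)" if r: "0 \<le> r" for r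
  proof -
    have "weight_hat \<omega> r = (\<integral>\<^sup>+s. ennreal (g s) * indicator {r..<1} s \<partial>lebesgue)"
      unfolding weight_hat_def
    proof (rule nn_integral_cong_AE)
      have "AE s::real in lborel. s \<noteq> 0" by (rule AE_lborel_singleton)
      with ae have "AE s in lborel. ennreal (\<omega> (complex_of_real s)) * indicator {r..<1} s = ennreal (g s) * indicator {r..<1} s"
      proof eventually_elim
        case (elim s)
        then show ?case using r by (cases "s \<in> {r..<1}") (auto simp: g0_def)
      qed
      then show "AE s in lebesgue. ennreal (\<omega> (complex_of_real s)) * indicator {r..<1} s = ennreal (g s) * indicator {r..<1} s"
        by (rule AE_completion)
    qed
    then show ?thesis by (simp add: nn_integral_completion)
  qed
  have "0 \<le> g s" for s by (simp add: g_def)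
  then show thesis using that[OF \<open>g \<in> borel_measurable borel\<close> _ 3 4] by blast
qed

section \<open>Geometric decay of the tail integrals\<close>

definition dyadic_radius :: "nat \<Rightarrow> real" where
  "dyadic_radius n = 1 - 1 / 2 ^ n"

definition dyadic_tail :: "(complex \<Rightarrow> real) \<Rightarrow> nat \<Rightarrow> real" where
  "dyadic_tail \<omega> n = enn2real (weight_hat \<omega> (dyadic_radius n))"

text \<open>
  The two doubling conditions on a weight, read off at dyadic radii: the tail integrals lose at
  most a constant factor in one step, and at least a geometric factor in the long run.
\<close>
definition geometric_tail :: "(nat \<Rightarrow> real) \<Rightarrow> bool" where
  "geometric_tail h \<longleftrightarrow> (\<forall>n. 0 < h n) \<and> (\<exists>A\<ge>1. \<forall>n. h n \<le> A * h (Suc n)) \<and>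
     (\<exists>B\<ge>1. \<exists>d. 0 < d \<and> d < 1 \<and> (\<forall>n k. h (n + k) \<le> B * d ^ k * h n))"

lemma dyadic_radius_bounds: "0 \<le> dyadic_radius n" "dyadic_radius n < 1"
  by (auto simp: dyadic_radius_def)

lemma dyadic_radius_mono: "n \<le> m \<Longrightarrow> dyadic_radius n \<le> dyadic_radius m"
  by (auto simp: dyadic_radius_def intro!: divide_left_mono power_increasing)

lemma D_class_radial: "\<omega> \<in> D_class \<Longrightarrow> radial_weight \<omega>"
  unfolding D_class_def D_hat_def by blast

lemma weight_hat_antimono: "r \<le> s \<Longrightarrow> weight_hat \<omega> s \<le> weight_hat \<omega> r"
  unfolding weight_hat_def by (intro nn_integral_mono) (auto simp: indicator_def)

lemma nn_integral_disc_area_profile: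
  fixes F :: "complex \<Rightarrow> ennreal" and g :: "real \<Rightarrow> real"
  assumes m: "\<omega> \<in> borel_measurable (lebesgue_on unit_disc)"
    and [measurable]: "F \<in> borel_measurable borel" "g \<in> borel_measurable borel"
    and ae: "AE z in lebesgue_on unit_disc. \<omega> z = g (cmod z)" 
  shows "(\<integral>\<^sup>+z. F z * ennreal (\<omega> z) \<partial>disc_area) =
     (\<integral>\<^sup>+z. F z * (ennreal (g (cmod z) / pi) * indicator {0..<1} (cmod z)) \<partial>lborel)"
proof -
  have mF: "F \<in> borel_measurable (lebesgue_on unit_disc)"
    by (intro measurable_restrict_space1 measurable_completion) simp
  have "(\<integral>\<^sup>+z. F z * ennreal (\<omega> z) \<partial>disc_area)
      = (\<integral>\<^sup>+z. ennreal (1 / pi) * (F z * ennreal (\<omega> z)) \<partial>lebesgue_on unit_disc)"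
    unfolding disc_area_def using m mF by (subst nn_integral_density) auto
  also have "\<dots> = (\<integral>\<^sup>+z. ennreal (1 / pi) * (F z * ennreal (g (cmod z))) \<partial>lebesgue_on unit_disc)"
    using ae by (intro nn_integral_cong_AE) auto
  also have "\<dots> = (\<integral>\<^sup>+z. ennreal (1 / pi) * (F z * ennreal (g (cmod z))) * indicator unit_disc z \<partial>lebesgue)"
    by (subst nn_integral_restrict_space) auto
  also have "\<dots> = (\<integral>\<^sup>+z. ennreal (1 / pi) * (F z * ennreal (g (cmod z))) * indicator unit_disc z \<partial>lborel)"
    by (subst nn_integral_completion) auto
  also have "\<dots> = (\<integral>\<^sup>+z. F z * (ennreal (g (cmod z) / pi) * indicator {0..<1} (cmod z)) \<partial>lborel)"
  proof (intro nn_integral_cong)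
    fix z :: complex
    have "ennreal (g (cmod z) / pi) = ennreal (1 / pi) * ennreal (g (cmod z))"
      by (simp add: ennreal_mult'[symmetric])
    then show "ennreal (1 / pi) * (F z * ennreal (g (cmod z))) * indicator unit_disc z =
       F z * (ennreal (g (cmod z) / pi) * indicator {0..<1} (cmod z))"
      by (auto simp: indicator_def mult_ac)
  qed
  finally show ?thesis .
qed

lemma nn_integral_rotation_average:
  fixes F :: "complex \<Rightarrow> real" and W :: "real \<Rightarrow> ennreal"
  assumes [measurable]: "F \<in> borel_measurable borel" "W \<in> borel_measurable borel"
    and F: "\<And>z. 0 \<le> F z" and N: "N > 0"
  shows "(\<integral>\<^sup>+z. ennreal (F z) * W (cmod z) \<partial>lborel) =
    (\<integral>\<^sup>+z. ennreal ((\<Sum>j<N. F (z * root_of_one N j)) / real N) * W (cmod z) \<partial>lborel)"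
proof -
  have rot: "(\<integral>\<^sup>+z. ennreal (F (z * root_of_one N j) / N) * W (cmod z) \<partial>lborel) =
      (\<integral>\<^sup>+z. ennreal (F z / N) * W (cmod z) \<partial>lborel)" for j
    using nn_integral_rotate[of "root_of_one N j" "\<lambda>z. ennreal (F z / N) * W (cmod z)"]
    by (simp add: norm_mult mult.commute)
  have "(\<integral>\<^sup>+z. ennreal ((\<Sum>j<N. F (z * root_of_one N j)) / real N) * W (cmod z) \<partial>lborel)
     = (\<integral>\<^sup>+z. (\<Sum>j<N. ennreal (F (z * root_of_one N j) / N) * W (cmod z)) \<partial>lborel)"
    using F by (intro nn_integral_cong) (simp add: sum_divide_distrib sum_distrib_right flip: sum_ennreal)
  also have "\<dots> = (\<Sum>j<N. \<integral>\<^sup>+z. ennreal (F z / N) * W (cmod z) \<partial>lborel)"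
    by (subst nn_integral_sum) (auto simp: rot)
  also have "\<dots> = (\<Sum>j<N. ennreal (1 / N) * (\<integral>\<^sup>+z. ennreal (F z) * W (cmod z) \<partial>lborel))"
    using F by (subst nn_integral_cmult[symmetric])
       (auto intro!: nn_integral_cong simp: mult.assoc[symmetric] ennreal_mult[symmetric])
  also have "\<dots> = (\<integral>\<^sup>+z. ennreal (F z) * W (cmod z) \<partial>lborel)"
    using N by (simp add: mult.assoc[symmetric] ennreal_of_nat_eq_real_of_nat ennreal_mult[symmetric])
  finally show ?thesis ..
qed

text \<open>
  By rotation invariance \<open>|f|\<^sup>p\<close> may be replaced by its mean over \<open>N\<close> rotations, which for large \<open>N\<close> is
  uniformly close to the circle mean; the latter is monotone in the radius.
\<close>
lemma nn_integral_annulus_bounds: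
  fixes W :: "real \<Rightarrow> ennreal"
  assumes f: "f holomorphic_on unit_disc" and fb: "f \<in> borel_measurable borel" and p: "p > 1"
    and [measurable]: "W \<in> borel_measurable borel"
    and W: "\<And>s. s \<notin> {a..b} \<Longrightarrow> W s = 0" and ab: "0 \<le> a" "a \<le> b" "b < 1"
    and fin: "(\<integral>\<^sup>+z. W (cmod z) \<partial>lborel) = ennreal m" "0 \<le> m"
  shows "(\<integral>\<^sup>+z. ennreal (cmod (f z) powr p) * W (cmod z) \<partial>lborel) \<le> ennreal (pmean p f b * m)"
    and "ennreal (pmean p f a * m) \<le> (\<integral>\<^sup>+z. ennreal (cmod (f z) powr p) * W (cmod z) \<partial>lborel)"
proof -
  define u where "u = (\<lambda>z. cmod (f z) powr p)"
  have [measurable]: "f \<in> borel_measurable borel" by (rule fb)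
  have [measurable]: "u \<in> borel_measurable borel" unfolding u_def by measurable
  have cu: "continuous_on (cball 0 b) u" unfolding u_def using f p ab by (intro continuous_powr_holo) auto
  have nn: "0 \<le> circle_mean u z" for z by (rule circle_mean_nonneg) (simp add: u_def)
  define X where "X = (\<integral>\<^sup>+z. ennreal (u z) * W (cmod z) \<partial>lborel)"
  have approx: "X \<le> ennreal ((pmean p f b + e) * m) \<and> ennreal ((pmean p f a - e) * m) \<le> X" if e: "e > 0" for e
  proof -
    obtain N where N: "N > 0" and NN: "\<And>z. cmod z \<le> b \<Longrightarrow>
        \<bar>circle_mean u z - (\<Sum>j<N. u (z * root_of_one N j)) / real N\<bar> \<le> e"
      using circle_mean_riemann[OF cu e] by blast
    define A where "A = (\<lambda>z. (\<Sum>j<N. u (z * root_of_one N j)) / real N)"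
    have X: "X = (\<integral>\<^sup>+z. ennreal (A z) * W (cmod z) \<partial>lborel)"
      unfolding X_def A_def by (rule nn_integral_rotation_average) (use N in \<open>auto simp: u_def\<close>)
    have bounds: "A z \<le> pmean p f b + e \<and> pmean p f a - e \<le> A z" if "cmod z \<in> {a..b}" for z
    proof -
      have 1: "circle_mean u z = pmean p f (cmod z)"
        using circle_mean_eq_norm[OF cu, of z] that by (simp add: u_def)
      have "pmean p f (cmod z) \<le> pmean p f b" "pmean p f a \<le> pmean p f (cmod z)"
        using that ab by (auto intro!: pmean_mono[OF f p])
      then show ?thesis using NN[of z] that 1 by (auto simp: A_def abs_le_iff)
    qed
    have "X \<le> (\<integral>\<^sup>+z. ennreal (pmean p f b + e) * W (cmod z) \<partial>lborel)"
      unfolding X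
    proof (intro nn_integral_mono)
      fix z show "ennreal (A z) * W (cmod z) \<le> ennreal (pmean p f b + e) * W (cmod z)"
        using bounds[of z] W[of "cmod z"] by (cases "cmod z \<in> {a..b}") (auto intro!: mult_right_mono ennreal_leI)
    qed
    also have "\<dots> = ennreal ((pmean p f b + e) * m)"
      using fin nn[of "of_real b"] e by (subst nn_integral_cmult) (auto simp: u_def ennreal_mult)
    finally have 1: "X \<le> ennreal ((pmean p f b + e) * m)" .
    have "ennreal ((pmean p f a - e) * m) = (\<integral>\<^sup>+z. ennreal (pmean p f a - e) * W (cmod z) \<partial>lborel)"
      using fin by (subst nn_integral_cmult) (auto simp: ennreal_mult'')
    also have "\<dots> \<le> X"
      unfolding X
    proof (intro nn_integral_mono)
      fix z show "ennreal (pmean p f a - e) * W (cmod z) \<le> ennreal (A z) * W (cmod z)"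
        using bounds[of z] W[of "cmod z"] by (cases "cmod z \<in> {a..b}") (auto intro!: mult_right_mono ennreal_leI)
    qed
    finally show ?thesis using 1 by simp
  qed
  have l: "(\<lambda>n. 1 / real (Suc n)) \<longlonglongrightarrow> 0"
    using LIMSEQ_inverse_real_of_nat by (simp add: inverse_eq_divide)
  have "X \<le> ennreal ((pmean p f b + 0) * m)"
    by (rule LIMSEQ_le_const[OF tendsto_ennrealI[OF tendsto_mult_right[OF tendsto_add[OF tendsto_const l]]]])
       (use approx in \<open>auto intro!: exI[of _ 0]\<close>)
  then show "(\<integral>\<^sup>+z. ennreal (cmod (f z) powr p) * W (cmod z) \<partial>lborel) \<le> ennreal (pmean p f b * m)"
    by (simp add: X_def u_def)
  have "ennreal ((pmean p f a - 0) * m) \<le> X"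
    by (rule LIMSEQ_le_const2[OF tendsto_ennrealI[OF tendsto_mult_right[OF tendsto_diff[OF tendsto_const l]]]])
       (use approx in \<open>auto intro!: exI[of _ 0]\<close>)
  then show "ennreal (pmean p f a * m) \<le> (\<integral>\<^sup>+z. ennreal (cmod (f z) powr p) * W (cmod z) \<partial>lborel)"
    by (simp add: X_def u_def)
qed

lemma radial_weight_measurable: "radial_weight \<omega> \<Longrightarrow> \<omega> \<in> borel_measurable (lebesgue_on unit_disc)"
  unfolding radial_weight_def disc_area_def by (drule conjunct1, drule borel_measurable_integrable) simp

lemma space_disc_area: "space disc_area = unit_disc"
  by (simp add: disc_area_def space_restrict_space)

lemma radial_weight_nonneg: "radial_weight \<omega> \<Longrightarrow> z \<in> unit_disc \<Longrightarrow> 0 \<le> \<omega> z"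
  unfolding radial_weight_def by blast

lemma radial_weight_AE_nonneg: "radial_weight \<omega> \<Longrightarrow> AE z in disc_area. 0 \<le> \<omega> z"
  by (rule AE_I2) (simp only: space_disc_area radial_weight_nonneg)

text \<open>
  Integrability over the disc controls the weight away from the origin only; the upper
  doubling condition at \<open>r = 0\<close> carries the bound over from \<open>[1/2, 1)\<close> to \<open>[0, 1)\<close>.
\<close>
lemma D_class_weight_hat_finite:
  assumes "\<omega> \<in> D_class"
  shows "weight_hat \<omega> 0 < \<infinity>"
proof -
  have rw: "radial_weight \<omega>" using assms unfolding D_class_def D_hat_def by blast
  obtain C where C: "weight_hat \<omega> 0 \<le> ennreal C * weight_hat \<omega> (1 / 2)"
  proof -
    obtain C where "\<forall>r\<in>{0..<1}. weight_hat \<omega> r \<le> ennreal C * weight_hat \<omega> ((1 + r) / 2)"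
      using assms unfolding D_class_def D_hat_def by blast
    from bspec[OF this, of 0] show thesis using that by simp
  qed
  obtain g where g: "g \<in> borel_measurable borel" "\<And>s. 0 \<le> g s"
    "AE z in lebesgue_on unit_disc. \<omega> z = g (cmod z)"
    "\<And>r. 0 \<le> r \<Longrightarrow> weight_hat \<omega> r = (\<integral>\<^sup>+s. ennreal (g s) * indicator {r..<1} s \<partial>lborel)"
    using radial_weight_profile[OF rw] by metis
  note [measurable] = g(1)
  have "integrable disc_area \<omega>" using rw by (simp add: radial_weight_def)
  then have fin: "(\<integral>\<^sup>+z. ennreal (\<omega> z) \<partial>disc_area) < \<infinity>"
    using radial_weight_AE_nonneg[OF rw] by (subst nn_integral_eq_integral) auto
  have "weight_hat \<omega> (1/2) = (\<integral>\<^sup>+s. ennreal (g s) * indicator {1/2..<1} s \<partial>lborel)"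
    using g(4)[of "1/2"] by simp
  also have "\<dots> \<le> (\<integral>\<^sup>+s. ennreal (2 * pi * s) * indicator {0..} s * (ennreal (g s / pi) * indicator {0..<1} s) \<partial>lborel)"
  proof (intro nn_integral_mono)
    fix s :: real
    have "g s \<le> 2 * s * g s" if "1/2 \<le> s" using that g(2)[of s] mult_right_mono[of 1 "2 * s" "g s"] by simp
    then show "ennreal (g s) * indicator {1/2..<1} s \<le> ennreal (2 * pi * s) * indicator {0..} s * (ennreal (g s / pi) * indicator {0..<1} s)"
      using g(2)[of s] by (auto simp: indicator_def ennreal_mult[symmetric] intro!: ennreal_leI)
  qed
  also have "\<dots> = (\<integral>\<^sup>+z. 1 * (ennreal (g (cmod z) / pi) * indicator {0..<1} (cmod z)) \<partial>lborel)"
    by (subst nn_integral_cmod[symmetric]) auto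
  also have "\<dots> = (\<integral>\<^sup>+z. 1 * ennreal (\<omega> z) \<partial>disc_area)"
    by (rule nn_integral_disc_area_profile[symmetric]) (use radial_weight_measurable[OF rw] g in auto)
  finally have "weight_hat \<omega> (1/2) < \<infinity>" using fin by simp
  then have "ennreal C * weight_hat \<omega> (1 / 2) < \<infinity>" by (simp add: ennreal_mult_less_top)
  then show ?thesis using C by (rule le_less_trans[rotated])
qed

text \<open>
  The lower doubling condition uses an arbitrary ratio \<open>K\<close>. Replacing \<open>K\<close> by a power \<open>2\<^sup>k \<ge> K\<close> makes the
  tail integrals drop by the factor \<open>C\<close> after \<open>k\<close> dyadic steps, which is geometric decay with ratio \<open>C\<^sup>-\<^sup>1\<^sup>/\<^sup>k\<close>.
\<close>
lemma D_class_dyadic_tail: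
  assumes D: "\<omega> \<in> D_class"
  shows "weight_hat \<omega> (dyadic_radius n) = ennreal (dyadic_tail \<omega> n)"
    and "geometric_tail (dyadic_tail \<omega>)"
proof -
  have fin: "weight_hat \<omega> (dyadic_radius n) < \<infinity>" for n
    using weight_hat_antimono[OF dyadic_radius_bounds(1)] D_class_weight_hat_finite[OF D] by (rule le_less_trans)
  then show eq: "weight_hat \<omega> (dyadic_radius n) = ennreal (dyadic_tail \<omega> n)" for n
    by (simp add: dyadic_tail_def)
  have nn: "0 \<le> dyadic_tail \<omega> n" for n by (simp add: dyadic_tail_def)
  have pos: "0 < dyadic_tail \<omega> n" for n
  proof -
    have "\<forall>z\<in>unit_disc. 0 < weight_hat \<omega> (cmod z)"
      using D unfolding D_class_def D_hat_def radial_weight_def by blast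
    moreover have "complex_of_real (dyadic_radius n) \<in> unit_disc" using dyadic_radius_bounds[of n] by simp
    ultimately have "0 < weight_hat \<omega> (cmod (of_real (dyadic_radius n)))" by blast
    then show ?thesis using dyadic_radius_bounds[of n] by (simp add: eq)
  qed
  obtain A where A: "A \<ge> 1" "\<And>r. r \<in> {0..<1} \<Longrightarrow> weight_hat \<omega> r \<le> ennreal A * weight_hat \<omega> ((1 + r) / 2)"
    using D unfolding D_class_def D_hat_def by blast
  have half: "(1 + dyadic_radius n) / 2 = dyadic_radius (Suc n)" for n
    by (simp add: dyadic_radius_def field_simps)
  have hA: "dyadic_tail \<omega> n \<le> A * dyadic_tail \<omega> (Suc n)" for n
    using A(2)[of "dyadic_radius n"] dyadic_radius_bounds[of n] A(1) nn[of n] nn[of "Suc n"]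
    by (simp add: half eq ennreal_mult[symmetric])
  obtain K C where K: "K > 1" and C: "C > 1" and
    KC: "\<And>r. r \<in> {0..<1} \<Longrightarrow> weight_hat \<omega> r \<ge> ennreal C * weight_hat \<omega> (1 - (1 - r) / K)"
    using D unfolding D_class_def D_check_def by blast
  obtain k where k: "K < 2 ^ k" using real_arch_pow[of 2 K] by auto
  have k0: "k > 0" using k K by (cases k) auto
  have anti: "dyadic_tail \<omega> m \<le> dyadic_tail \<omega> n" if "n \<le> m" for n m
    using weight_hat_antimono[OF dyadic_radius_mono[OF that], of \<omega>] nn by (simp add: eq)
  have hk: "C * dyadic_tail \<omega> (n + k) \<le> dyadic_tail \<omega> n" for n
  proof -
    have "1 - (1 - dyadic_radius n) / K \<le> dyadic_radius (n + k)"
    proof -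
      have "1 / 2 ^ (n + k) \<le> (1 / 2 ^ n) / K"
        using K k by (simp add: power_add field_simps)
      then show ?thesis by (simp add: dyadic_radius_def)
    qed
    then have "ennreal C * weight_hat \<omega> (dyadic_radius (n + k)) \<le> ennreal C * weight_hat \<omega> (1 - (1 - dyadic_radius n) / K)"
      by (intro mult_left_mono weight_hat_antimono) auto
    also have "\<dots> \<le> weight_hat \<omega> (dyadic_radius n)" using KC dyadic_radius_bounds[of n] by simp
    finally show ?thesis using C nn by (simp add: eq ennreal_mult[symmetric])
  qed
  have iter: "C ^ j * dyadic_tail \<omega> (n + j * k) \<le> dyadic_tail \<omega> n" for n j
  proof (induction j)
    case (Suc j)
    have "C ^ Suc j * dyadic_tail \<omega> (n + Suc j * k) = C ^ j * (C * dyadic_tail \<omega> (n + j * k + k))"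
      by (simp add: algebra_simps)
    also have "\<dots> \<le> C ^ j * dyadic_tail \<omega> (n + j * k)" using C by (intro mult_left_mono hk) auto
    finally show ?case using Suc by simp
  qed simp
  define d where "d = (1 / C) powr (1 / k)"
  have d: "0 < d" "d < 1" using C k0 powr_less_mono2[of "1 / real k" "1 / C" 1] by (auto simp: d_def)
  have dk: "d ^ k = 1 / C" using C k0 by (simp add: d_def powr_powr flip: powr_realpow)
  have "dyadic_tail \<omega> (n + m) \<le> C * d ^ m * dyadic_tail \<omega> n" for n m
  proof -
    define j where "j = m div k"
    have m: "m = j * k + m mod k" by (simp add: j_def)
    have "dyadic_tail \<omega> (n + m) \<le> dyadic_tail \<omega> (n + j * k)" using m by (intro anti) simp
    also have "\<dots> \<le> (1 / C) ^ j * dyadic_tail \<omega> n"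
      using iter[of j n] C by (simp add: power_one_over field_simps)
    also have "(1 / C) ^ j \<le> C * d ^ m"
    proof -
      have "d ^ (j * k + k) \<le> d ^ m"
        using d m k0 mod_less_divisor[OF k0, of m] by (intro power_decreasing) linarith+
      moreover have "d ^ (j * k + k) = (1 / C) ^ j * (1 / C)"
        by (simp add: power_add dk power_mult[of d k] mult.commute[of j] )
      ultimately have "C * ((1 / C) ^ j * (1 / C)) \<le> C * d ^ m" using C by (intro mult_left_mono) auto
      then show ?thesis using C by simp
    qed
    finally show ?thesis using nn[of n] by (simp add: mult_right_mono)
  qed
  then show "geometric_tail (dyadic_tail \<omega>)"
    unfolding geometric_tail_def using pos A(1) hA C d by (metis less_imp_le)
qed

section \<open>The Bergman norm as a sum over dyadic radii\<close>

definition bergman_integral :: "real \<Rightarrow> (complex \<Rightarrow> real) \<Rightarrow> (complex \<Rightarrow> complex) \<Rightarrow> ennreal" where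
  "bergman_integral p \<omega> f = (\<integral>\<^sup>+z. ennreal (cmod (f z) powr p) * ennreal (\<omega> z) \<partial>disc_area)"

text \<open>
  The discrete form of the \<open>p\<close>-th power of the Bergman norm. The radius is one step ahead of the tail, so that
  the circle mean dominates those on the annulus between the two radii.
\<close>
definition dyadic_sum :: "real \<Rightarrow> (nat \<Rightarrow> real) \<Rightarrow> (complex \<Rightarrow> complex) \<Rightarrow> ennreal" where
  "dyadic_sum p h f = (\<Sum>n. ennreal (h n * pmean p f (dyadic_radius (Suc n))))"

lemma disc_holo_borel: "f \<in> disc_holo \<Longrightarrow> f \<in> borel_measurable borel"
proof -
  assume f: "f \<in> disc_holo"
  then have "f = (\<lambda>z. indicator unit_disc z *\<^sub>R f z)" by (auto simp: disc_holo_def indicator_def)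
  moreover have "(\<lambda>z. indicator unit_disc z *\<^sub>R f z) \<in> borel_measurable borel"
    using f by (intro borel_measurable_continuous_on_indicator holomorphic_on_imp_continuous_on) (auto simp: disc_holo_def)
  ultimately show ?thesis by simp
qed

lemma dyadic_annuli: "0 \<le> s \<Longrightarrow> s < 1 \<Longrightarrow> \<exists>!n. dyadic_radius n \<le> s \<and> s < dyadic_radius (Suc n)"
proof -
  assume s: "0 \<le> s" "s < 1"
  define n where "n = (LEAST n. s < dyadic_radius (Suc n))"
  obtain m where "1 / (1 - s) < 2 ^ m" using real_arch_pow[of 2 "1 / (1 - s)"] by auto
  then have "1 / 2 ^ m < 1 - s" using s by (simp add: field_simps)
  then have "s < dyadic_radius m" by (simp add: dyadic_radius_def)
  then have "s < dyadic_radius (Suc m)" using dyadic_radius_mono[of m "Suc m"] by simp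
  then have n: "s < dyadic_radius (Suc n)" unfolding n_def by (rule LeastI)
  have "dyadic_radius n \<le> s"
  proof (cases n)
    case (Suc k)
    then have "\<not> s < dyadic_radius (Suc k)" unfolding n_def using not_less_Least by (metis lessI)
    then show ?thesis using Suc by simp
  qed (use s in \<open>simp add: dyadic_radius_def\<close>)
  moreover have "k = n" if "dyadic_radius k \<le> s" "s < dyadic_radius (Suc k)" for k
  proof (rule ccontr)
    assume "k \<noteq> n"
    then consider "Suc k \<le> n" | "Suc n \<le> k" by linarith
    then show False
      using dyadic_radius_mono[of "Suc k" n] dyadic_radius_mono[of "Suc n" k] that n calculation by cases linarith+
  qed
  ultimately show ?thesis using n by blast
qed

text \<open>
  The area element \<open>2 s ds\<close> has density at most \<open>2\<close> everywhere and at least \<open>1\<close> for \<open>s \<ge> 1/2\<close>, whence the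
  restriction \<open>n \<ge> 1\<close> in the lower bound.
\<close>
lemma annulus_mass:
  fixes g :: "real \<Rightarrow> real"
  assumes D: "\<omega> \<in> D_class" and [measurable]: "g \<in> borel_measurable borel" and g0: "\<And>s. 0 \<le> g s"
    and hat: "\<And>r. 0 \<le> r \<Longrightarrow> weight_hat \<omega> r = (\<integral>\<^sup>+s. ennreal (g s) * indicator {r..<1} s \<partial>lborel)"
  shows "\<exists>m. (\<integral>\<^sup>+z. ennreal (g (cmod z) / pi) * indicator {dyadic_radius n..<dyadic_radius (Suc n)} (cmod z) \<partial>lborel) = ennreal m
     \<and> 0 \<le> m \<and> m \<le> 2 * dyadic_tail \<omega> n \<and> (n \<ge> 1 \<longrightarrow> dyadic_tail \<omega> n - dyadic_tail \<omega> (Suc n) \<le> m)"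
proof -
  define a b where "a = dyadic_radius n" and "b = dyadic_radius (Suc n)"
  have ab: "0 \<le> a" "a \<le> b" "b < 1"
    unfolding a_def b_def using dyadic_radius_bounds dyadic_radius_mono[of n "Suc n"] by auto
  define J where "J = (\<integral>\<^sup>+s. ennreal (g s) * indicator {a..<b} s \<partial>lborel)"
  have "weight_hat \<omega> a = (\<integral>\<^sup>+s. ennreal (g s) * indicator {a..<b} s + ennreal (g s) * indicator {b..<1} s \<partial>lborel)"
    using ab by (subst hat) (auto intro!: nn_integral_cong simp: indicator_def)
  also have "\<dots> = J + weight_hat \<omega> b" using ab by (subst nn_integral_add) (auto simp: J_def hat)
  finally have JJ: "ennreal (dyadic_tail \<omega> n) = J + ennreal (dyadic_tail \<omega> (Suc n))"
    by (simp add: a_def b_def D_class_dyadic_tail(1)[OF D])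
  have nn: "0 \<le> dyadic_tail \<omega> k" for k by (simp add: dyadic_tail_def)
  have Jfin: "J \<le> ennreal (dyadic_tail \<omega> n)" unfolding JJ by simp
  then obtain j where j: "J = ennreal j" "0 \<le> j"
    by (cases J) (auto simp: top_unique)
  have jj: "dyadic_tail \<omega> n = j + dyadic_tail \<omega> (Suc n)"
    using JJ j nn by (simp flip: ennreal_plus)
  define I where "I = (\<integral>\<^sup>+z. ennreal (g (cmod (z::complex)) / pi) * indicator {a..<b} (cmod z) \<partial>lborel)"
  have I: "I = (\<integral>\<^sup>+s. ennreal (2 * pi * s) * indicator {0..} s * (ennreal (g s / pi) * indicator {a..<b} s) \<partial>lborel)"
    unfolding I_def by (rule nn_integral_cmod) measurable
  have "I \<le> (\<integral>\<^sup>+s. ennreal 2 * (ennreal (g s) * indicator {a..<b} s) \<partial>lborel)"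
    unfolding I
  proof (intro nn_integral_mono)
    fix s show "ennreal (2 * pi * s) * indicator {0..} s * (ennreal (g s / pi) * indicator {a..<b} s)
        \<le> ennreal 2 * (ennreal (g s) * indicator {a..<b} s)"
      using g0[of s] ab mult_right_mono[of s 1 "g s"]
      by (auto simp: indicator_def ennreal_mult[symmetric] simp del: ennreal_numeral intro!: ennreal_leI)
  qed
  also have "\<dots> = ennreal (2 * j)" using j by (subst nn_integral_cmult) (auto simp: J_def[symmetric] ennreal_mult)
  finally have Iu: "I \<le> ennreal (2 * j)" .
  then obtain m where m: "I = ennreal m" "0 \<le> m" by (cases I) (auto simp: top_unique)
  have "m \<le> 2 * dyadic_tail \<omega> n" using Iu m j jj nn[of "Suc n"] by simp
  moreover have "dyadic_tail \<omega> n - dyadic_tail \<omega> (Suc n) \<le> m" if "n \<ge> 1"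
  proof -
    have a2: "1/2 \<le> a" using dyadic_radius_mono[OF that] by (simp add: a_def dyadic_radius_def)
    have "J \<le> I"
      unfolding I J_def
    proof (intro nn_integral_mono)
      fix s show "ennreal (g s) * indicator {a..<b} s \<le> ennreal (2 * pi * s) * indicator {0..} s * (ennreal (g s / pi) * indicator {a..<b} s)"
        using g0[of s] a2 mult_right_mono[of 1 "2 * s" "g s"]
        by (auto simp: indicator_def ennreal_mult[symmetric] intro!: ennreal_leI)
    qed
    then show ?thesis using j m jj by simp
  qed
  ultimately show ?thesis using m by (auto simp: I_def a_def b_def)
qed

lemma suminf_shift_le_ennreal: "(\<Sum>n. f (n + k)) \<le> (\<Sum>n. f n :: ennreal)"
proof -
  have "(\<Sum>n. f n) = (\<Sum>n. f (n + k)) + (\<Sum>n<k. f n)" by (rule suminf_offset) simp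
  moreover have "(\<Sum>n. f (n + k)) \<le> (\<Sum>n. f (n + k)) + (\<Sum>n<k. f n)" by (rule add_increasing2) auto
  ultimately show ?thesis by simp
qed

text \<open>
  On each dyadic annulus the circle means are between their values at the two boundary radii, and the mass of the annulus
  is at most twice the tail integral. This gives the upper bound. For the lower bound the mass must not be small
  compared to the tail; since the tails decay geometrically, the tail at \<open>n\<close> is at
  most twice the total mass of \<open>k\<close> consecutive annuli, for a fixed \<open>k\<close>, and monotonicity of the means lets
  each of them pay for its share.
\<close>
lemma bergman_integral_dyadic:
  assumes D: "\<omega> \<in> D_class" and p: "p > 1"
  shows "\<exists>C>0. \<forall>f\<in>disc_holo. bergman_integral p \<omega> f \<le> ennreal C * dyadic_sum p (dyadic_tail \<omega>) f \<and>
     dyadic_sum p (dyadic_tail \<omega>) f \<le> ennreal C * bergman_integral p \<omega> f"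
proof -
  have rw: "radial_weight \<omega>" by (rule D_class_radial[OF D])
  obtain g where g: "g \<in> borel_measurable borel" "\<And>s. 0 \<le> g s"
    "AE z in lebesgue_on unit_disc. \<omega> z = g (cmod z)"
    "\<And>r. 0 \<le> r \<Longrightarrow> weight_hat \<omega> r = (\<integral>\<^sup>+s. ennreal (g s) * indicator {r..<1} s \<partial>lborel)"
    using radial_weight_profile[OF rw] by metis
  note [measurable] = g(1)
  define W where "W = (\<lambda>n s. ennreal (g s / pi) * indicator {dyadic_radius n..<dyadic_radius (Suc n)} s)"
  have [measurable]: "W n \<in> borel_measurable borel" for n unfolding W_def by measurable
  obtain m where m: "\<And>n. (\<integral>\<^sup>+z. W n (cmod (z::complex)) \<partial>lborel) = ennreal (m n)" "\<And>n. 0 \<le> m n"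
     "\<And>n. m n \<le> 2 * dyadic_tail \<omega> n" "\<And>n. n \<ge> 1 \<Longrightarrow> dyadic_tail \<omega> n - dyadic_tail \<omega> (Suc n) \<le> m n"
    using annulus_mass[OF D g(1,2,4)] unfolding W_def by metis
  define h where "h = dyadic_tail \<omega>"
  have geo: "geometric_tail h" unfolding h_def by (rule D_class_dyadic_tail(2)[OF D])
  then have hp: "\<And>n. 0 < h n" by (auto simp: geometric_tail_def)
  obtain A where A: "A \<ge> 1" "\<And>n. h n \<le> A * h (Suc n)" using geo by (auto simp: geometric_tail_def)
  obtain B d where B: "B \<ge> 1" "0 < d" "d < 1" "\<And>n k. h (n + k) \<le> B * d ^ k * h n"
    using geo by (auto simp: geometric_tail_def)
  obtain k where k: "B * d ^ k \<le> 1 / 2"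
  proof -
    have "(\<lambda>k. B * d ^ k) \<longlonglongrightarrow> 0" using B by (intro tendsto_mult_right_zero LIMSEQ_realpow_zero) auto
    then have "\<forall>\<^sub>F k in sequentially. B * d ^ k < 1 / 2" by (rule order_tendstoD) simp
    then show thesis using that by (auto simp: eventually_sequentially intro: less_imp_le)
  qed
  have hdiff: "h n \<le> 2 * (\<Sum>i<k. h (n + i) - h (n + Suc i))" for n
  proof -
    have "(\<Sum>i<k. h (n + i) - h (n + Suc i)) = h n - h (n + k)"
      using sum_lessThan_telescope'[of "\<lambda>i. h (n + i)" k] by simp
    moreover have "h (n + k) \<le> 1 / 2 * h n"
      by (rule order_trans[OF B(4) mult_right_mono[OF k]]) (use hp[of n] in simp)
    ultimately show ?thesis by simp
  qed
  define C where "C = max 2 (A * (2 * real k))"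
  have "bergman_integral p \<omega> f \<le> ennreal C * dyadic_sum p h f \<and> dyadic_sum p h f \<le> ennreal C * bergman_integral p \<omega> f"
    if f: "f \<in> disc_holo" for f
  proof -
    define P where "P = (\<lambda>n. pmean p f (dyadic_radius n))"
    have fh: "f holomorphic_on unit_disc" using f by (simp add: disc_holo_def)
    have P0: "0 \<le> P n" for n unfolding P_def by (rule circle_mean_nonneg) simp
    have Pm: "P n \<le> P l" if "n \<le> l" for n l
      unfolding P_def by (intro pmean_mono[OF fh p] dyadic_radius_bounds dyadic_radius_mono that)
    have fb: "f \<in> borel_measurable borel" by (rule disc_holo_borel[OF f])
    note [measurable] = fb
    define X where "X = (\<lambda>n. \<integral>\<^sup>+z. ennreal (cmod (f z) powr p) * W n (cmod z) \<partial>lborel)"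
    have "bergman_integral p \<omega> f =
      (\<integral>\<^sup>+z. ennreal (cmod (f z) powr p) * (ennreal (g (cmod z) / pi) * indicator {0..<1} (cmod z)) \<partial>lborel)"
      unfolding bergman_integral_def
      by (rule nn_integral_disc_area_profile[OF radial_weight_measurable[OF rw]]) (use g in auto)
    also have "\<dots> = (\<integral>\<^sup>+z. (\<Sum>n. ennreal (cmod (f z) powr p) * W n (cmod z)) \<partial>lborel)"
    proof (intro nn_integral_cong)
      fix z :: complex
      have "(\<Sum>n. indicator {dyadic_radius n..<dyadic_radius (Suc n)} (cmod z)) = (indicator {0..<1} (cmod z) :: ennreal)"
      proof (cases "cmod z < 1")
        case True
        obtain N where N: "dyadic_radius N \<le> cmod z" "cmod z < dyadic_radius (Suc N)"
          "\<And>n. dyadic_radius n \<le> cmod z \<Longrightarrow> cmod z < dyadic_radius (Suc n) \<Longrightarrow> n = N"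
          using dyadic_annuli[OF norm_ge_zero True] by metis
        have "(\<Sum>n. indicator {dyadic_radius n..<dyadic_radius (Suc n)} (cmod z)) =
           (\<Sum>n\<in>{N}. indicator {dyadic_radius n..<dyadic_radius (Suc n)} (cmod z) :: ennreal)"
          by (rule suminf_finite) (use N(3) in \<open>auto simp: indicator_def\<close>)
        then show ?thesis using N(1,2) True by simp
      next
        case False
        then have "indicator {dyadic_radius n..<dyadic_radius (Suc n)} (cmod z) = (0::ennreal)" for n
          using dyadic_radius_bounds[of "Suc n"] by (auto simp: indicator_def)
        then show ?thesis using False by simp
      qed
      then show "ennreal (cmod (f z) powr p) * (ennreal (g (cmod z) / pi) * indicator {0..<1} (cmod z)) =
         (\<Sum>n. ennreal (cmod (f z) powr p) * W n (cmod z))"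
        unfolding W_def by (simp add: ennreal_suminf_cmult)
    qed
    also have "\<dots> = (\<Sum>n. X n)" unfolding X_def by (rule nn_integral_suminf) measurable
    finally have bi: "bergman_integral p \<omega> f = (\<Sum>n. X n)" .
    have Xu: "X n \<le> ennreal (P (Suc n) * m n)" and Xl: "ennreal (P n * m n) \<le> X n" for n
      unfolding X_def P_def
      by (intro nn_integral_annulus_bounds[OF fh fb p _ _ _ _ _ m(1,2), where a = "dyadic_radius n" and b = "dyadic_radius (Suc n)"]
            dyadic_radius_bounds dyadic_radius_mono; auto simp: W_def)+
    have "bergman_integral p \<omega> f \<le> (\<Sum>n. ennreal 2 * ennreal (h n * P (Suc n)))"
      unfolding bi
    proof (intro suminf_le summableI)
      fix n
      have "P (Suc n) * m n \<le> 2 * (h n * P (Suc n))"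
        using mult_left_mono[OF m(3)[of n] P0[of "Suc n"]] by (simp add: h_def mult_ac)
      then show "X n \<le> ennreal 2 * ennreal (h n * P (Suc n))"
        using Xu[of n] hp[of n] P0[of "Suc n"]
        by (simp add: ennreal_mult[symmetric] ennreal_leI order_trans[OF Xu] less_imp_le del: ennreal_numeral)
    qed
    also have "\<dots> = ennreal 2 * dyadic_sum p h f"
      by (simp add: ennreal_suminf_cmult dyadic_sum_def P_def)
    also have "\<dots> \<le> ennreal C * dyadic_sum p h f"
      by (intro mult_right_mono ennreal_leI) (auto simp: C_def)
    finally have 1: "bergman_integral p \<omega> f \<le> ennreal C * dyadic_sum p h f" .
    have ds: "dyadic_sum p h f = (\<Sum>n. ennreal (h n * P (Suc n)))"
      by (simp add: dyadic_sum_def P_def)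
    define Z where "Z = (\<lambda>n. ennreal (P (Suc n) * m (Suc n)))"
    have "dyadic_sum p h f \<le> (\<Sum>n. \<Sum>i<k. ennreal (2 * A) * Z (n + i))"
      unfolding ds
    proof (intro suminf_le summableI)
      fix n
      have "h n * P (Suc n) \<le> (A * h (Suc n)) * P (Suc n)" by (intro mult_right_mono A P0)
      also have "\<dots> \<le> (A * (2 * (\<Sum>i<k. h (Suc n + i) - h (Suc n + Suc i)))) * P (Suc n)"
        using A by (intro mult_right_mono mult_left_mono hdiff P0) auto
      also have "\<dots> \<le> (A * (2 * (\<Sum>i<k. m (Suc n + i)))) * P (Suc n)"
        using A m(4) unfolding h_def by (intro mult_right_mono mult_left_mono sum_mono P0) auto
      also have "\<dots> = (\<Sum>i<k. (2 * A) * (P (Suc n) * m (Suc (n + i))))"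
        by (simp add: sum_distrib_left sum_distrib_right mult_ac)
      also have "\<dots> \<le> (\<Sum>i<k. (2 * A) * (P (Suc (n + i)) * m (Suc (n + i))))"
        using A m(2) by (intro sum_mono mult_left_mono mult_right_mono Pm) auto
      finally have "ennreal (h n * P (Suc n)) \<le> ennreal (\<Sum>i<k. (2 * A) * (P (Suc (n + i)) * m (Suc (n + i))))"
        by (rule ennreal_leI)
      also have "\<dots> = (\<Sum>i<k. ennreal (2 * A) * Z (n + i))"
        using A m(2) P0 by (simp add: Z_def ennreal_mult[symmetric] sum_ennreal)
      finally show "ennreal (h n * P (Suc n)) \<le> (\<Sum>i<k. ennreal (2 * A) * Z (n + i))" .
    qed
    also have "\<dots> = (\<Sum>i<k. ennreal (2 * A) * (\<Sum>n. Z (n + i)))"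
      by (subst suminf_sum) (auto simp: ennreal_suminf_cmult)
    also have "\<dots> \<le> (\<Sum>i<k. ennreal (2 * A) * (\<Sum>n. Z n))"
      by (intro sum_mono mult_left_mono suminf_shift_le_ennreal) auto
    also have "\<dots> = ennreal (A * (2 * real k)) * (\<Sum>n. Z n)"
    proof -
      have "of_nat k * ennreal (2 * A) = ennreal (real k * (2 * A))"
        using A by (simp add: ennreal_of_nat_eq_real_of_nat ennreal_mult)
      also have "real k * (2 * A) = A * (2 * real k)" by simp
      finally show ?thesis by (simp only: sum_constant card_lessThan mult.assoc[symmetric])
    qed
    also have "\<dots> \<le> ennreal C * (\<Sum>n. X n)"
    proof (intro mult_mono)
      have "(\<Sum>n. Z n) \<le> (\<Sum>n. X (n + 1))"
        unfolding Z_def using Xl by (intro suminf_le summableI) simp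
      also have "\<dots> \<le> (\<Sum>n. X n)" by (rule suminf_shift_le_ennreal)
      finally show "(\<Sum>n. Z n) \<le> (\<Sum>n. X n)" .
    qed (auto simp: C_def intro!: ennreal_leI)
    finally have 2: "dyadic_sum p h f \<le> ennreal C * bergman_integral p \<omega> f" by (simp add: bi)
    from 1 2 show ?thesis by blast
  qed
  moreover have "C > 0" by (simp add: C_def)
  ultimately show ?thesis unfolding h_def by blast
qed

lemma bergman_integrand_measurable:
  assumes rw: "radial_weight \<omega>" and f: "f \<in> disc_holo"
  shows "(\<lambda>z. cmod (f z) powr p * \<omega> z) \<in> borel_measurable disc_area"
proof -
  have [measurable]: "\<omega> \<in> borel_measurable (lebesgue_on unit_disc)" by (rule radial_weight_measurable[OF rw])
  have [measurable]: "f \<in> borel_measurable (lebesgue_on unit_disc)"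
    using disc_holo_borel[OF f] by (intro measurable_restrict_space1 measurable_completion) simp
  show ?thesis unfolding disc_area_def by measurable
qed

lemma bergman_integral_alt:
  assumes rw: "radial_weight \<omega>"
  shows "bergman_integral p \<omega> f = (\<integral>\<^sup>+z. ennreal (cmod (f z) powr p * \<omega> z) \<partial>disc_area)"
  unfolding bergman_integral_def
  by (intro nn_integral_cong) (simp add: ennreal_mult' space_disc_area radial_weight_nonneg[OF rw])

lemma mem_bergman_iff:
  assumes rw: "radial_weight \<omega>"
  shows "f \<in> bergman p \<omega> \<longleftrightarrow> f \<in> disc_holo \<and> bergman_integral p \<omega> f < \<infinity>"
proof -
  have nn: "AE z in disc_area. 0 \<le> cmod (f z) powr p * \<omega> z"
    using radial_weight_AE_nonneg[OF rw] by eventually_elim simp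
  show ?thesis
  proof -
    have "(\<integral>\<^sup>+z. ennreal (norm (cmod (f z) powr p * \<omega> z)) \<partial>disc_area) = bergman_integral p \<omega> f"
      unfolding bergman_integral_alt[OF rw] using nn by (intro nn_integral_cong_AE) auto
    then show ?thesis
      using bergman_integrand_measurable[OF rw, of f p] by (auto simp: bergman_def integrable_iff_bounded)
  qed
qed

lemma bergman_norm_nonneg: "0 \<le> bergman_norm p \<omega> f"
  by (simp add: bergman_norm_def)

lemma bergman_norm_powr:
  assumes rw: "radial_weight \<omega>" and f: "f \<in> bergman p \<omega>" and p: "p > 0"
  shows "ennreal (bergman_norm p \<omega> f powr p) = bergman_integral p \<omega> f"
proof -
  have nn: "AE z in disc_area. 0 \<le> cmod (f z) powr p * \<omega> z"
    using radial_weight_AE_nonneg[OF rw] by eventually_elim simp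
  have "bergman_norm p \<omega> f powr p = (\<integral>z. cmod (f z) powr p * \<omega> z \<partial>disc_area)"
    using p integral_nonneg_AE[OF nn] by (simp add: bergman_norm_def powr_powr)
  then show ?thesis
    using f nn by (simp add: bergman_integral_alt[OF rw] bergman_def nn_integral_eq_integral)
qed

section \<open>Bergman spaces are Banach spaces of analytic functions\<close>

text \<open>
  Jensen's inequality for the power \<open>p\<close> with unnormalised weights. The proof adds the tangent inequality at the mean,
  in the form of Young's inequality.
\<close>
lemma weighted_power_mean:
  fixes K u :: "'i \<Rightarrow> real"
  assumes p: "p > 1" and K: "\<And>i. i \<in> I \<Longrightarrow> 0 \<le> K i" and u: "\<And>i. i \<in> I \<Longrightarrow> 0 \<le> u i"
  shows "(\<Sum>i\<in>I. K i * u i) powr p \<le> (\<Sum>i\<in>I. K i) powr (p - 1) * (\<Sum>i\<in>I. K i * u i powr p)"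
proof (cases "(\<Sum>i\<in>I. K i) = 0")
  case True
  show ?thesis
  proof (cases "finite I")
    case fin: True
    then have "\<forall>i\<in>I. K i = 0" using True K by (simp add: sum_nonneg_eq_0_iff)
    then show ?thesis by simp
  qed simp
next
  case False
  define k where "k = (\<Sum>i\<in>I. K i)"
  have k: "k > 0" using False sum_nonneg[of I K] K unfolding k_def by force
  define s where "s = (\<Sum>i\<in>I. K i * u i)"
  have s0: "s \<ge> 0" unfolding s_def using K u by (intro sum_nonneg) auto
  define m where "m = s / k"
  have m0: "m \<ge> 0" using s0 k by (simp add: m_def)
  have s: "s = k * m" using k by (simp add: m_def)
  have young: "m powr (p - 1) * x \<le> m powr p * (1 - 1 / p) + x powr p / p" if "x \<ge> 0" for x
  proof -
    have "x * m powr (p - 1) \<le> x powr p / p + (m powr (p - 1)) powr (p / (p - 1)) / (p / (p - 1))"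
      using p that m0 by (intro Youngs_inequality) (auto simp: field_simps)
    also have "(m powr (p - 1)) powr (p / (p - 1)) = m powr p" using p by (simp add: powr_powr)
    also have "m powr p / (p / (p - 1)) = m powr p * (1 - 1 / p)" using p by (simp add: field_simps)
    finally show ?thesis by (simp add: mult.commute)
  qed
  have "m powr p * k = m powr (p - 1) * s"
    using m0 s p by (cases "m = 0") (auto simp: powr_diff)
  also have "\<dots> = (\<Sum>i\<in>I. K i * (m powr (p - 1) * u i))"
    by (simp add: s_def sum_distrib_left mult_ac)
  also have "\<dots> \<le> (\<Sum>i\<in>I. K i * (m powr p * (1 - 1 / p) + u i powr p / p))"
    using K u young by (intro sum_mono mult_left_mono) auto
  also have "\<dots> = k * (m powr p * (1 - 1 / p)) + (\<Sum>i\<in>I. K i * u i powr p) / p"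
    by (simp add: k_def distrib_left sum.distrib sum_distrib_right sum_divide_distrib)
  finally have "m powr p * k / p \<le> (\<Sum>i\<in>I. K i * u i powr p) / p"
    by (simp add: algebra_simps)
  then have le: "m powr p * k \<le> (\<Sum>i\<in>I. K i * u i powr p)" using p by (simp add: divide_le_cancel)
  have "s powr p = k powr (p - 1) * (m powr p * k)"
    using k m0 by (simp add: s powr_mult powr_diff)
  also have "\<dots> \<le> k powr (p - 1) * (\<Sum>i\<in>I. K i * u i powr p)"
    using le by (intro mult_left_mono) auto
  finally show ?thesis by (simp add: s_def k_def)
qed

lemma powr_add_split:
  fixes x y a b p :: real
  assumes "p > 1" "0 \<le> x" "0 \<le> y" "0 < a" "0 < b"
  shows "(x + y) powr p \<le> (a + b) powr (p - 1) * (a powr (1 - p) * x powr p + b powr (1 - p) * y powr p)"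
proof -
  have e: "c * (w / c) powr p = c powr (1 - p) * w powr p" if "c > 0" "w \<ge> 0" for c w
    using that by (simp add: powr_divide powr_diff)
  show ?thesis
    using weighted_power_mean[of p "UNIV :: bool set" "\<lambda>i. if i then a else b" "\<lambda>i. if i then x / a else y / b"] assms
    by (simp add: UNIV_bool e add.commute)
qed

lemma disc_holo_diff: "f \<in> disc_holo \<Longrightarrow> g \<in> disc_holo \<Longrightarrow> (\<lambda>z. f z - g z) \<in> disc_holo"
  by (auto simp: disc_holo_def intro: holomorphic_on_diff)

lemma bergman_normI:
  assumes rw: "radial_weight \<omega>" and p: "p > 0" and f: "f \<in> disc_holo" and c: "0 \<le> c"
    and le: "bergman_integral p \<omega> f \<le> ennreal (c powr p)"
  shows "f \<in> bergman p \<omega>" "bergman_norm p \<omega> f \<le> c"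
proof -
  show m: "f \<in> bergman p \<omega>"
    using f le by (simp add: mem_bergman_iff[OF rw] le_less_trans[OF le])
  have "bergman_norm p \<omega> f powr p \<le> c powr p"
    using le by (simp flip: bergman_norm_powr[OF rw m p])
  then show "bergman_norm p \<omega> f \<le> c"
    using p c by (meson bergman_norm_nonneg not_le powr_less_mono2)
qed

lemma bergman_normD:
  assumes rw: "radial_weight \<omega>" and p: "p > 0" and f: "f \<in> bergman p \<omega>" and c: "bergman_norm p \<omega> f \<le> c"
  shows "bergman_integral p \<omega> f \<le> ennreal (c powr p)"
  unfolding bergman_norm_powr[OF rw f p, symmetric]
  using p c by (intro ennreal_leI powr_mono2) (auto simp: bergman_norm_nonneg)

lemma bergman_integral_comb:
  assumes rw: "radial_weight \<omega>" and f: "f \<in> disc_holo" and g: "g \<in> disc_holo" and c: "0 \<le> c" "0 \<le> d"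
    and le: "\<And>z. cmod (h z) powr p \<le> c * cmod (f z) powr p + d * cmod (g z) powr p"
  shows "bergman_integral p \<omega> h \<le> ennreal c * bergman_integral p \<omega> f + ennreal d * bergman_integral p \<omega> g"
proof -
  have [measurable]: "(\<lambda>z. cmod (f z) powr p * \<omega> z) \<in> borel_measurable disc_area"
    "(\<lambda>z. cmod (g z) powr p * \<omega> z) \<in> borel_measurable disc_area"
    using bergman_integrand_measurable[OF rw] f g by blast+
  have "bergman_integral p \<omega> h \<le> (\<integral>\<^sup>+z. ennreal c * ennreal (cmod (f z) powr p * \<omega> z) + ennreal d * ennreal (cmod (g z) powr p * \<omega> z) \<partial>disc_area)"
    unfolding bergman_integral_alt[OF rw]
  proof (intro nn_integral_mono)
    fix z assume "z \<in> space disc_area"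
    then have w: "0 \<le> \<omega> z" using radial_weight_nonneg[OF rw] by (simp add: space_disc_area)
    have "cmod (h z) powr p * \<omega> z \<le> c * (cmod (f z) powr p * \<omega> z) + d * (cmod (g z) powr p * \<omega> z)"
      using mult_right_mono[OF le[of z] w] by (simp add: distrib_right mult.assoc)
    then show "ennreal (cmod (h z) powr p * \<omega> z) \<le> ennreal c * ennreal (cmod (f z) powr p * \<omega> z) + ennreal d * ennreal (cmod (g z) powr p * \<omega> z)"
      using w c by (simp add: ennreal_mult[symmetric] ennreal_plus[symmetric] ennreal_leI del: ennreal_plus)
  qed
  also have "\<dots> = ennreal c * bergman_integral p \<omega> f + ennreal d * bergman_integral p \<omega> g"
    unfolding bergman_integral_alt[OF rw] by (simp add: nn_integral_add nn_integral_cmult)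
  finally show ?thesis .
qed

lemma bergman_sub_disc_holo: "f \<in> bergman p \<omega> \<Longrightarrow> f \<in> disc_holo"
  by (simp add: bergman_def)

text \<open>
  Minkowski's inequality, from convexity of the \<open>p\<close>-th power with weights proportional to upper bounds
  \<open>a, b\<close> of the two norms. Strict positivity of \<open>a\<close> and \<open>b\<close> is obtained by enlarging the norms slightly.
\<close>
lemma bergman_norm_diff:
  assumes rw: "radial_weight \<omega>" and p: "p > 1" and f: "f \<in> bergman p \<omega>" and g: "g \<in> bergman p \<omega>"
  shows "(\<lambda>z. f z - g z) \<in> bergman p \<omega>"
    and "bergman_norm p \<omega> (\<lambda>z. f z - g z) \<le> bergman_norm p \<omega> f + bergman_norm p \<omega> g"
proof -
  have p0: "p > 0" using p by simp
  have main: "(\<lambda>z. f z - g z) \<in> bergman p \<omega> \<and> bergman_norm p \<omega> (\<lambda>z. f z - g z) \<le> a + b"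
    if a: "bergman_norm p \<omega> f \<le> a" "0 < a" and b: "bergman_norm p \<omega> g \<le> b" "0 < b" for a b
  proof -
    let ?K = "(a + b) powr (p - 1)"
    have "bergman_integral p \<omega> (\<lambda>z. f z - g z)
      \<le> ennreal (?K * a powr (1 - p)) * bergman_integral p \<omega> f + ennreal (?K * b powr (1 - p)) * bergman_integral p \<omega> g"
    proof (rule bergman_integral_comb[OF rw])
      fix z
      have "cmod (f z - g z) powr p \<le> (cmod (f z) + cmod (g z)) powr p"
        using p by (intro powr_mono2 norm_triangle_ineq4) auto
      also have "\<dots> \<le> ?K * (a powr (1 - p) * cmod (f z) powr p + b powr (1 - p) * cmod (g z) powr p)"
        using p a b by (intro powr_add_split) auto
      finally show "cmod (f z - g z) powr p \<le> ?K * a powr (1 - p) * cmod (f z) powr p + ?K * b powr (1 - p) * cmod (g z) powr p"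
        by (simp add: distrib_left mult.assoc)
    qed (use f g bergman_sub_disc_holo in auto)
    also have "\<dots> \<le> ennreal (?K * a powr (1 - p)) * ennreal (a powr p) + ennreal (?K * b powr (1 - p)) * ennreal (b powr p)"
      by (intro add_mono mult_left_mono bergman_normD[OF rw p0] f g a b) auto
    also have "\<dots> = ennreal ((a + b) powr p)"
    proof -
      have e: "c powr (1 - p) * c powr p = c" if "c > 0" for c using that by (simp flip: powr_add)
      have "?K * a powr (1 - p) * a powr p + ?K * b powr (1 - p) * b powr p = ?K * (a + b)"
        using a b by (simp only: mult.assoc e) (simp add: distrib_left)
      also have "\<dots> = (a + b) powr p" using a b by (simp add: powr_diff)
      finally show ?thesis by (simp add: ennreal_mult[symmetric] ennreal_plus[symmetric] del: ennreal_plus)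
    qed
    finally show ?thesis
      using bergman_normI[OF rw p0 disc_holo_diff[OF bergman_sub_disc_holo[OF f] bergman_sub_disc_holo[OF g]], of "a + b"] a b by auto
  qed
  have nn: "0 \<le> bergman_norm p \<omega> f" "0 \<le> bergman_norm p \<omega> g" by (simp_all add: bergman_norm_nonneg)
  show "(\<lambda>z. f z - g z) \<in> bergman p \<omega>"
    using main[of "bergman_norm p \<omega> f + 1" "bergman_norm p \<omega> g + 1"] nn by auto
  show "bergman_norm p \<omega> (\<lambda>z. f z - g z) \<le> bergman_norm p \<omega> f + bergman_norm p \<omega> g"
  proof (rule field_le_epsilon)
    fix e :: real assume "e > 0"
    then show "bergman_norm p \<omega> (\<lambda>z. f z - g z) \<le> bergman_norm p \<omega> f + bergman_norm p \<omega> g + e"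
      using main[of "bergman_norm p \<omega> f + e / 2" "bergman_norm p \<omega> g + e / 2"] nn by auto
  qed
qed

lemma bergman_scale:
  assumes rw: "radial_weight \<omega>" and p: "p > 1" and f: "f \<in> bergman p \<omega>"
  shows "(\<lambda>z. c * f z) \<in> bergman p \<omega> \<and> bergman_norm p \<omega> (\<lambda>z. c * f z) \<le> cmod c * bergman_norm p \<omega> f"
proof -
  have p0: "p > 0" using p by simp
  have d: "f \<in> disc_holo" by (rule bergman_sub_disc_holo[OF f])
  have "bergman_integral p \<omega> (\<lambda>z. c * f z) \<le> ennreal (cmod c powr p) * bergman_integral p \<omega> f + ennreal 0 * bergman_integral p \<omega> f"
    by (rule bergman_integral_comb[OF rw d d]) (auto simp: norm_mult powr_mult)
  also have "\<dots> \<le> ennreal (cmod c powr p) * ennreal (bergman_norm p \<omega> f powr p)"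
    by (simp add: mult_left_mono bergman_normD[OF rw p0 f])
  also have "\<dots> = ennreal ((cmod c * bergman_norm p \<omega> f) powr p)"
    by (simp add: ennreal_mult[symmetric] powr_mult bergman_norm_nonneg)
  finally have le: "bergman_integral p \<omega> (\<lambda>z. c * f z) \<le> ennreal ((cmod c * bergman_norm p \<omega> f) powr p)" .
  have "(\<lambda>z. c * f z) \<in> disc_holo" using d by (auto simp: disc_holo_def intro: holomorphic_intros)
  then show ?thesis using bergman_normI[OF rw p0 _ _ le] by (simp add: bergman_norm_nonneg)
qed

lemma bergman_seminorm:
  assumes rw: "radial_weight \<omega>" and p: "p > 1"
  shows "function_seminorm (bergman p \<omega>) (bergman_norm p \<omega>)"
proof
  show "(\<lambda>_. 0) \<in> bergman p \<omega>" by (auto simp: bergman_def disc_holo_def)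
  show "bergman_norm p \<omega> (\<lambda>_. 0) = 0" by (simp add: bergman_norm_def)
qed (use bergman_norm_diff[OF rw p] bergman_norm_nonneg in auto)

lemma bergman_point_bound:
  assumes D: "\<omega> \<in> D_class" and p: "p > 1" and r: "r < 1"
  shows "\<exists>K>0. \<forall>f\<in>bergman p \<omega>. \<forall>z. cmod z \<le> r \<longrightarrow> cmod (f z) \<le> K * bergman_norm p \<omega> f"
proof (cases "0 \<le> r")
  case True
  have rw: "radial_weight \<omega>" by (rule D_class_radial[OF D])
  obtain C where C: "C > 0" "\<And>f. f \<in> disc_holo \<Longrightarrow> dyadic_sum p (dyadic_tail \<omega>) f \<le> ennreal C * bergman_integral p \<omega> f"
    using bergman_integral_dyadic[OF D p] by blast
  obtain n where n: "r < dyadic_radius (Suc n)" using dyadic_annuli[OF True r] by blast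
  define R where "R = dyadic_radius (Suc n)"
  have hp: "dyadic_tail \<omega> n > 0" using D_class_dyadic_tail(2)[OF D] by (auto simp: geometric_tail_def)
  define K0 where "K0 = (C / dyadic_tail \<omega> n) powr (1 / p)"
  have K0: "K0 > 0" using C hp by (simp add: K0_def)
  have main: "cmod (f z) \<le> 2 * K0 / (R - r) * bergman_norm p \<omega> f" if f: "f \<in> bergman p \<omega>" and z: "cmod z \<le> r" for f z
  proof -
    have fd: "f \<in> disc_holo" by (rule bergman_sub_disc_holo[OF f])
    have fh: "f holomorphic_on unit_disc" using fd by (simp add: disc_holo_def)
    have "cmod (f z) \<le> 2 * (K0 * B) / (R - r)" if B: "bergman_norm p \<omega> f \<le> B" "B > 0" for B
    proof (rule pmean_point_bound[OF fh p True _ _ _ _ z])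
      have "ennreal (dyadic_tail \<omega> n * pmean p f R) = (\<Sum>k\<in>{n}. ennreal (dyadic_tail \<omega> k * pmean p f (dyadic_radius (Suc k))))"
        by (simp add: R_def)
      also have "\<dots> \<le> dyadic_sum p (dyadic_tail \<omega>) f"
        unfolding dyadic_sum_def by (intro sum_le_suminf) auto
      also have "\<dots> \<le> ennreal C * bergman_integral p \<omega> f" by (rule C(2)[OF fd])
      also have "\<dots> \<le> ennreal C * ennreal (B powr p)"
        using p B by (intro mult_left_mono bergman_normD[OF rw _ f]) auto
      finally have "dyadic_tail \<omega> n * pmean p f R \<le> C * B powr p"
        using C(1) by (simp add: ennreal_mult[symmetric] ennreal_le_iff)
      then have "pmean p f R \<le> (C / dyadic_tail \<omega> n) * B powr p" using hp by (simp add: field_simps)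
      also have "\<dots> = (K0 * B) powr p"
        using p B C hp by (simp add: K0_def powr_mult powr_powr)
      finally show "pmean p f R \<le> (K0 * B) powr p" .
      show "r < R" using n by (simp add: R_def)
      show "R < 1" by (simp add: R_def dyadic_radius_bounds)
      show "K0 * B > 0" using K0 B by simp
    qed
    then have "cmod (f z) \<le> 2 * K0 / (R - r) * B" if "bergman_norm p \<omega> f \<le> B" "B > 0" for B
      using that by (simp add: mult.assoc)
    then have le: "cmod (f z) \<le> 2 * K0 / (R - r) * (bergman_norm p \<omega> f + e)" if "e > 0" for e
      using that bergman_norm_nonneg[of p \<omega> f] by simp
    have l: "(\<lambda>n. 1 / real (Suc n)) \<longlonglongrightarrow> 0"
      using LIMSEQ_inverse_real_of_nat by (simp add: inverse_eq_divide)
    have "cmod (f z) \<le> 2 * K0 / (R - r) * (bergman_norm p \<omega> f + 0)"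
      by (rule LIMSEQ_le_const[OF tendsto_mult_left[OF tendsto_add[OF tendsto_const l]]])
         (use le in \<open>auto intro!: exI[of _ 0]\<close>)
    then show ?thesis by simp
  qed
  moreover have "2 * K0 / (R - r) > 0" using K0 n by (simp add: R_def)
  ultimately show ?thesis by blast
next
  case False
  then have "\<not> cmod z \<le> r" for z using norm_ge_zero[of z] by linarith
  then show ?thesis by (intro exI[of _ 1]) auto
qed

text \<open>
  By \<open>bergman_point_bound\<close> a Cauchy sequence converges locally uniformly; Fatou's lemma shows that the limit is also
  the limit in norm.
\<close>
lemma bergman_complete:
  assumes D: "\<omega> \<in> D_class" and p: "p > 1" and F: "F \<in> cauchy_seqs (bergman p \<omega>) (bergman_norm p \<omega>)"
  shows "\<exists>f\<in>bergman p \<omega>. (\<lambda>n. bergman_norm p \<omega> (\<lambda>z. F n z - f z)) \<longlonglongrightarrow> 0"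
proof -
  have p0: "p > 0" using p by simp
  have rw: "radial_weight \<omega>" by (rule D_class_radial[OF D])
  interpret function_seminorm "bergman p \<omega>" "bergman_norm p \<omega>" by (rule bergman_seminorm[OF rw p])
  have FB: "F n \<in> bergman p \<omega>" for n using F by (auto simp: cauchy_seqs_def)
  have Fd: "F n \<in> disc_holo" for n by (rule bergman_sub_disc_holo[OF FB])
  have cau: "\<exists>M. \<forall>m\<ge>M. \<forall>n\<ge>M. bergman_norm p \<omega> (\<lambda>z. F m z - F n z) < e" if "e > 0" for e
    using F that by (auto simp: cauchy_seqs_def)
  have unif: "\<exists>M. \<forall>m\<ge>M. \<forall>n\<ge>M. \<forall>z. cmod z \<le> r \<longrightarrow> cmod (F m z - F n z) < e" if r: "r < 1" and e: "e > 0" for r e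
  proof -
    obtain K where K: "K > 0" "\<And>f z. f \<in> bergman p \<omega> \<Longrightarrow> cmod z \<le> r \<Longrightarrow> cmod (f z) \<le> K * bergman_norm p \<omega> f"
      using bergman_point_bound[OF D p r] by blast
    obtain M where M: "\<forall>m\<ge>M. \<forall>n\<ge>M. bergman_norm p \<omega> (\<lambda>z. F m z - F n z) < e / K"
      using cau[of "e / K"] e K by auto
    have "cmod (F m z - F n z) < e" if "m \<ge> M" "n \<ge> M" "cmod z \<le> r" for m n z
    proof -
      have "cmod (F m z - F n z) \<le> K * bergman_norm p \<omega> (\<lambda>z. F m z - F n z)"
        using K(2)[OF diff_mem[OF FB FB] that(3)] by simp
      also have "\<dots> < K * (e / K)" using M that K by (intro mult_strict_left_mono) auto
      finally show ?thesis using K by simp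
    qed
    then show ?thesis by blast
  qed
  have conv: "convergent (\<lambda>n. F n z)" for z
  proof (cases "cmod z < 1")
    case True
    have "Cauchy (\<lambda>n. F n z)"
    proof (rule CauchyI)
      fix e :: real assume "e > 0"
      then show "\<exists>M. \<forall>m\<ge>M. \<forall>n\<ge>M. cmod (F m z - F n z) < e" using unif[OF True, of e] by blast
    qed
    then show ?thesis by (simp add: Cauchy_convergent_iff)
  next
    case False
    then have "F n z = 0" for n using Fd[of n] by (auto simp: disc_holo_def)
    then show ?thesis by (simp add: convergent_const)
  qed
  define f where "f = (\<lambda>z. lim (\<lambda>n. F n z))"
  have lim: "(\<lambda>n. F n z) \<longlonglongrightarrow> f z" for z
    using conv[of z] unfolding f_def by (simp add: convergent_LIMSEQ_iff)
  have ul: "uniform_limit (cball 0 r) F f sequentially" if r: "r < 1" for r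
  proof (rule uniform_limitI)
    fix e :: real assume e: "e > 0"
    obtain M where M: "\<forall>m\<ge>M. \<forall>n\<ge>M. \<forall>z. cmod z \<le> r \<longrightarrow> cmod (F m z - F n z) < e / 2"
      using unif[OF r, of "e / 2"] e by auto
    have "dist (F n z) (f z) < e" if "n \<ge> M" "z \<in> cball 0 r" for n z
    proof -
      have "(\<lambda>m. cmod (F n z - F m z)) \<longlonglongrightarrow> cmod (F n z - f z)" by (intro tendsto_intros lim)
      then have "cmod (F n z - f z) \<le> e / 2"
        by (rule LIMSEQ_le_const2) (use M that in \<open>auto intro!: exI[of _ M] less_imp_le\<close>)
      then show ?thesis using e by (simp add: dist_norm)
    qed
    then show "\<forall>\<^sub>F n in sequentially. \<forall>z\<in>cball 0 r. dist (F n z) (f z) < e"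
      by (intro eventually_sequentiallyI[of M]) blast
  qed
  have "f holomorphic_on unit_disc"
  proof (rule holomorphic_uniform_sequence[of _ F])
    show "F n holomorphic_on unit_disc" for n using Fd by (auto simp: disc_holo_def)
    fix x :: complex assume x: "x \<in> unit_disc"
    define d where "d = (1 - cmod x) / 2"
    have d: "d > 0" using x by (simp add: d_def)
    have sub: "cball x d \<subseteq> cball 0 ((1 + cmod x) / 2)"
    proof
      fix y assume "y \<in> cball x d"
      then have "cmod (y - x) \<le> d" by (simp add: dist_norm norm_minus_commute)
      then show "y \<in> cball 0 ((1 + cmod x) / 2)" using norm_triangle_sub[of y x] by (simp add: d_def field_simps)
    qed
    show "\<exists>d. 0 < d \<and> cball x d \<subseteq> unit_disc \<and> uniform_limit (cball x d) F f sequentially"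
      using d sub uniform_limit_on_subset[OF ul sub] x by (intro exI[of _ d]) auto
  qed auto
  moreover have "f z = 0" if "z \<notin> unit_disc" for z
    using LIMSEQ_unique[OF lim[of z], of 0] Fd that by (auto simp: disc_holo_def)
  ultimately have fd: "f \<in> disc_holo" by (simp add: disc_holo_def)
  have near: "(\<lambda>z. F n z - f z) \<in> bergman p \<omega> \<and> bergman_norm p \<omega> (\<lambda>z. F n z - f z) \<le> e"
    if M: "\<forall>m\<ge>M. \<forall>n\<ge>M. bergman_norm p \<omega> (\<lambda>z. F m z - F n z) < e" and n: "n \<ge> M" and e: "e > 0" for M n e
  proof -
    define g where "g = (\<lambda>m z. ennreal (cmod (F n z - F m z) powr p * \<omega> z))"
    have [measurable]: "g m \<in> borel_measurable disc_area" for m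
      unfolding g_def using bergman_integrand_measurable[OF rw disc_holo_diff[OF Fd Fd]] by simp
    have "bergman_integral p \<omega> (\<lambda>z. F n z - f z) = (\<integral>\<^sup>+z. liminf (\<lambda>m. g m z) \<partial>disc_area)"
      unfolding bergman_integral_alt[OF rw]
    proof (intro nn_integral_cong)
      fix z
      have "(\<lambda>m. g m z) \<longlonglongrightarrow> ennreal (cmod (F n z - f z) powr p * \<omega> z)"
        unfolding g_def using p by (intro tendsto_ennrealI tendsto_intros lim tendsto_powr') auto
      then show "ennreal (cmod (F n z - f z) powr p * \<omega> z) = liminf (\<lambda>m. g m z)"
        by (simp add: lim_imp_Liminf)
    qed
    also have "\<dots> \<le> liminf (\<lambda>m. \<integral>\<^sup>+z. g m z \<partial>disc_area)" by (rule nn_integral_liminf) measurable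
    also have "\<dots> \<le> ennreal (e powr p)"
    proof (rule Liminf_le)
      show "\<forall>\<^sub>F m in sequentially. (\<integral>\<^sup>+z. g m z \<partial>disc_area) \<le> ennreal (e powr p)"
      proof (rule eventually_sequentiallyI[of M])
        fix m assume "m \<ge> M"
        then show "(\<integral>\<^sup>+z. g m z \<partial>disc_area) \<le> ennreal (e powr p)"
          using bergman_normD[OF rw p0 diff_mem[OF FB[of n] FB[of m]], of e] M n
          by (simp add: g_def bergman_integral_alt[OF rw] less_imp_le)
      qed
    qed simp
    finally show ?thesis using bergman_normI[OF rw p0 disc_holo_diff[OF Fd fd], of e n] e by auto
  qed
  have fB: "f \<in> bergman p \<omega>"
  proof -
    obtain M where "\<forall>m\<ge>M. \<forall>n\<ge>M. bergman_norm p \<omega> (\<lambda>z. F m z - F n z) < 1" using cau[of 1] by auto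
    then have "(\<lambda>z. F M z - f z) \<in> bergman p \<omega>" using near[of M 1 M] by auto
    from diff_mem[OF FB[of M] this] show ?thesis by simp
  qed
  have "(\<lambda>n. bergman_norm p \<omega> (\<lambda>z. F n z - f z)) \<longlonglongrightarrow> 0"
  proof (rule LIMSEQ_I)
    fix e :: real assume e: "e > 0"
    obtain M where M: "\<forall>m\<ge>M. \<forall>n\<ge>M. bergman_norm p \<omega> (\<lambda>z. F m z - F n z) < e / 2" using cau[of "e / 2"] e by auto
    have "norm (bergman_norm p \<omega> (\<lambda>z. F n z - f z) - 0) < e" if "n \<ge> M" for n
      using near[OF M that] e bergman_norm_nonneg[of p \<omega> "\<lambda>z. F n z - f z"] by auto
    then show "\<exists>M. \<forall>n\<ge>M. norm (bergman_norm p \<omega> (\<lambda>z. F n z - f z) - 0) < e" by blast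
  qed
  with fB show ?thesis by blast
qed

section \<open>Density of the polynomials\<close>

lemma circle_mean_comb:
  assumes "continuous_on (cball 0 R) u" "continuous_on (cball 0 R) v" "cmod z \<le> R"
  shows "circle_mean (\<lambda>w. a * u w + b * v w) z = a * circle_mean u z + b * circle_mean v z"
  unfolding circle_mean_def
  by (subst integral_add)
     (auto intro!: integrable_on_mult_right circle_mean_integrable[OF assms(1,3)] circle_mean_integrable[OF assms(2,3)])

lemma circle_mean_const [simp]: "circle_mean (\<lambda>_. c) z = c"
  by (simp add: circle_mean_def)

definition disc_poly :: "(nat \<Rightarrow> complex) \<Rightarrow> nat \<Rightarrow> complex \<Rightarrow> complex" where
  "disc_poly c N z = (if z \<in> unit_disc then \<Sum>k<N. c k * z ^ k else 0)"

definition disc_one :: "complex \<Rightarrow> complex" where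
  "disc_one z = (if z \<in> unit_disc then 1 else 0)"

lemma disc_holo_restrict:
  assumes "f holomorphic_on unit_disc"
  shows "(\<lambda>z. if z \<in> unit_disc then f z else 0) \<in> disc_holo"
  unfolding disc_holo_def by (auto intro: holomorphic_transform[OF assms])

lemma disc_poly_disc_holo: "disc_poly c N \<in> disc_holo"
  unfolding disc_poly_def[abs_def] by (intro disc_holo_restrict holomorphic_intros)

lemma disc_one_bergman:
  assumes rw: "radial_weight \<omega>"
  shows "disc_one \<in> bergman p \<omega>"
proof -
  have "disc_one \<in> disc_holo"
    unfolding disc_one_def[abs_def] by (intro disc_holo_restrict holomorphic_intros)
  moreover have "integrable disc_area (\<lambda>z. cmod (disc_one z) powr p * \<omega> z)"
  proof (rule Bochner_Integration.integrable_cong[THEN iffD2])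
    show "integrable disc_area \<omega>" using rw unfolding radial_weight_def by blast
  qed (simp_all add: disc_one_def space_disc_area)
  ultimately show ?thesis by (simp add: bergman_def)
qed

lemma bergman_bounded:
  assumes rw: "radial_weight \<omega>" and p: "p > 1" and f: "f \<in> disc_holo" and s: "0 \<le> s"
    and le: "\<And>z. z \<in> unit_disc \<Longrightarrow> cmod (f z) \<le> s"
  shows "f \<in> bergman p \<omega>" "bergman_norm p \<omega> f \<le> s * bergman_norm p \<omega> disc_one"
proof -
  have p0: "p > 0" using p by simp
  note one = disc_one_bergman[OF rw, of p]
  have "bergman_integral p \<omega> f \<le> ennreal (s powr p) * bergman_integral p \<omega> disc_one + ennreal 0 * bergman_integral p \<omega> disc_one"
  proof (rule bergman_integral_comb[OF rw])
    fix z
    show "cmod (f z) powr p \<le> s powr p * cmod (disc_one z) powr p + 0 * cmod (disc_one z) powr p"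
      using le[of z] f p by (cases "z \<in> unit_disc") (auto simp: disc_one_def disc_holo_def intro!: powr_mono2)
  qed (use bergman_sub_disc_holo[OF one] s in auto)
  also have "\<dots> \<le> ennreal (s powr p) * ennreal (bergman_norm p \<omega> disc_one powr p)"
    by (simp add: mult_left_mono bergman_normD[OF rw p0 one])
  also have "\<dots> = ennreal ((s * bergman_norm p \<omega> disc_one) powr p)"
    using s by (simp add: ennreal_mult[symmetric] powr_mult bergman_norm_nonneg)
  finally have "bergman_integral p \<omega> f \<le> ennreal ((s * bergman_norm p \<omega> disc_one) powr p)" .
  from bergman_normI[OF rw p0 f _ this] s
  show "f \<in> bergman p \<omega>" "bergman_norm p \<omega> f \<le> s * bergman_norm p \<omega> disc_one"
    by (simp_all add: bergman_norm_nonneg)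
qed

lemma disc_poly_bergman:
  assumes rw: "radial_weight \<omega>" and p: "p > 1"
  shows "disc_poly c N \<in> bergman p \<omega>"
proof (rule bergman_bounded(1)[OF rw p disc_poly_disc_holo, of "\<Sum>k<N. cmod (c k)"])
  fix z :: complex assume z: "z \<in> unit_disc"
  have "cmod (c k * z ^ k) \<le> cmod (c k)" for k
    using z mult_left_le[of "cmod z ^ k" "cmod (c k)"] by (simp add: norm_mult norm_power power_le_one)
  then show "cmod (disc_poly c N z) \<le> (\<Sum>k<N. cmod (c k))"
    using z by (auto simp: disc_poly_def intro!: order_trans[OF norm_sum sum_mono])
qed (simp add: sum_nonneg)

definition dilate :: "real \<Rightarrow> (complex \<Rightarrow> complex) \<Rightarrow> complex \<Rightarrow> complex" where
  "dilate r f z = (if z \<in> unit_disc then f (of_real r * z) else 0)"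

lemma dilate_disc_holo:
  assumes f: "f \<in> disc_holo" and r: "0 \<le> r" "r \<le> 1"
  shows "dilate r f \<in> disc_holo"
proof -
  have "(\<lambda>z. f (of_real r * z)) holomorphic_on unit_disc"
  proof (rule holomorphic_on_compose_gen[of "\<lambda>z. of_real r * z" _ f unit_disc, unfolded o_def])
    show "(\<lambda>z. of_real r * z) ` unit_disc \<subseteq> unit_disc"
    proof (rule image_subsetI)
      fix z :: complex assume "z \<in> unit_disc"
      then show "of_real r * z \<in> unit_disc"
        using r mult_left_le_one_le[of "cmod z" r] by (simp add: norm_mult)
    qed
  qed (use f in \<open>auto simp: disc_holo_def intro!: holomorphic_intros\<close>)
  then show ?thesis unfolding dilate_def[abs_def] by (rule disc_holo_restrict)
qed

lemma pmean_dilate_le: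
  assumes f: "f \<in> disc_holo" and p: "p > 1" and r: "0 \<le> r" "r \<le> 1" and R: "0 \<le> R" "R < 1"
  shows "pmean p (dilate r f) R \<le> pmean p f R"
proof -
  have "pmean p (dilate r f) R = pmean p f (r * R)"
    unfolding circle_mean_def
    using R by (intro integral_cong) (simp add: dilate_def norm_mult mult.assoc)
  also have "\<dots> \<le> pmean p f R"
    using f r R by (intro pmean_mono[OF _ p]) (auto simp: disc_holo_def mult_left_le_one_le)
  finally show ?thesis .
qed

lemma pmean_diff_le:
  assumes f: "f \<in> disc_holo" and g: "g \<in> disc_holo" and p: "p > 1" and R: "0 \<le> R" "R < 1"
  shows "pmean p (\<lambda>z. f z - g z) R \<le> 2 powr (p - 1) * (pmean p f R + pmean p g R)"
proof -
  have c: "continuous_on (cball 0 R) (\<lambda>z. cmod (f z) powr p)" "continuous_on (cball 0 R) (\<lambda>z. cmod (g z) powr p)"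
    "continuous_on (cball 0 R) (\<lambda>z. cmod (f z - g z) powr p)"
    using f g disc_holo_diff[OF f g] p R by (auto intro!: continuous_powr_holo simp: disc_holo_def)
  have "pmean p (\<lambda>z. f z - g z) R \<le> circle_mean (\<lambda>z. 2 powr (p - 1) * cmod (f z) powr p + 2 powr (p - 1) * cmod (g z) powr p) (of_real R)"
  proof (rule circle_mean_mono_fun[OF c(3)])
    fix w
    have "cmod (f w - g w) powr p \<le> (cmod (f w) + cmod (g w)) powr p"
      using p by (intro powr_mono2 norm_triangle_ineq4) auto
    then show "cmod (f w - g w) powr p \<le> 2 powr (p - 1) * cmod (f w) powr p + 2 powr (p - 1) * cmod (g w) powr p"
      using powr_add_split[OF p, of "cmod (f w)" "cmod (g w)" 1 1] by (simp add: distrib_left)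
  qed (use c R in \<open>auto intro!: continuous_intros\<close>)
  also have "\<dots> = 2 powr (p - 1) * (pmean p f R + pmean p g R)"
    using R by (subst circle_mean_comb[OF c(1,2)]) (auto simp: distrib_left)
  finally show ?thesis .
qed

lemma pmean_dilate_tendsto:
  assumes f: "f \<in> disc_holo" and p: "p > 1" and R: "0 \<le> R" "R < 1"
    and r: "\<And>k. 0 \<le> r k" "\<And>k. r k \<le> 1" "r \<longlonglongrightarrow> 1"
  shows "(\<lambda>k. pmean p (\<lambda>z. f z - dilate (r k) f z) R) \<longlonglongrightarrow> 0"
proof (rule LIMSEQ_I)
  fix e :: real assume e: "e > 0"
  define d where "d = (e / 2) powr (1 / p)"
  have d: "d > 0" "d powr p = e / 2" using e p by (auto simp: d_def powr_powr)
  have "continuous_on (cball 0 R) f"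
    using f R by (auto simp: disc_holo_def intro!: continuous_on_subset[OF holomorphic_on_imp_continuous_on])
  then obtain \<delta> where \<delta>: "\<delta> > 0" "\<And>x y. x \<in> cball 0 R \<Longrightarrow> y \<in> cball 0 R \<Longrightarrow> dist x y < \<delta> \<Longrightarrow> dist (f x) (f y) < d"
    using compact_uniformly_continuous[OF _ compact_cball] d(1) unfolding uniformly_continuous_on_def by metis
  obtain M where M: "\<And>k. k \<ge> M \<Longrightarrow> \<bar>r k - 1\<bar> < \<delta>" using LIMSEQ_D[OF r(3) \<delta>(1)] by auto
  have "norm (pmean p (\<lambda>z. f z - dilate (r k) f z) R - 0) < e" if k: "k \<ge> M" for k
  proof -
    have "pmean p (\<lambda>z. f z - dilate (r k) f z) R \<le> circle_mean (\<lambda>_. e / 2) (of_real R)"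
    proof (rule circle_mean_mono_fun)
      show "continuous_on (cball 0 R) (\<lambda>z. cmod (f z - dilate (r k) f z) powr p)"
        using disc_holo_diff[OF f dilate_disc_holo[OF f r(1,2)]] p R
        by (intro continuous_powr_holo) (auto simp: disc_holo_def)
      fix w assume "cmod w = cmod (complex_of_real R)"
      then have w: "cmod w = R" using R by simp
      have rw: "cmod (of_real (r k) * w) \<le> R"
        using w r(1,2)[of k] R by (simp add: norm_mult mult_left_le_one_le)
      have "dist w (of_real (r k) * w) = \<bar>r k - 1\<bar> * R"
      proof -
        have "w - of_real (r k) * w = of_real (1 - r k) * w" by (simp add: algebra_simps)
        then show ?thesis by (simp only: dist_norm norm_mult norm_of_real w abs_minus_commute)
      qed
      also have "\<dots> \<le> \<bar>r k - 1\<bar>" using R by (intro mult_left_le) auto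
      also have "\<dots> < \<delta>" by (rule M[OF k])
      finally have "dist (f w) (f (of_real (r k) * w)) < d" using w rw by (intro \<delta>(2)) auto
      then have "cmod (f w - dilate (r k) f w) < d" using w R by (simp add: dilate_def dist_norm)
      then show "cmod (f w - dilate (r k) f w) powr p \<le> e / 2"
        using p by (subst d(2)[symmetric]) (intro powr_mono2, auto)
    qed (use R in auto)
    moreover have "0 \<le> pmean p (\<lambda>z. f z - dilate (r k) f z) R" by (rule circle_mean_nonneg) simp
    ultimately show ?thesis using e by simp
  qed
  then show "\<exists>M. \<forall>k\<ge>M. norm (pmean p (\<lambda>z. f z - dilate (r k) f z) R - 0) < e" by blast
qed

text \<open>
  Each term of the dyadic sum of \<open>f\<close> minus its dilation tends to zero, and all of them are dominated by a multiple of the terms for \<open>f\<close>,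
  because dilation decreases circle means. Tannery's theorem applies.
\<close>
lemma bergman_dilate_approx:
  assumes D: "\<omega> \<in> D_class" and p: "p > 1" and f: "f \<in> bergman p \<omega>" and e: "e > 0"
  shows "\<exists>r. 0 < r \<and> r < 1 \<and> bergman_norm p \<omega> (\<lambda>z. f z - dilate r f z) < e"
proof -
  have p0: "p > 0" using p by simp
  have rw: "radial_weight \<omega>" by (rule D_class_radial[OF D])
  have fd: "f \<in> disc_holo" by (rule bergman_sub_disc_holo[OF f])
  obtain C where C: "C > 0" "\<And>f. f \<in> disc_holo \<Longrightarrow> bergman_integral p \<omega> f \<le> ennreal C * dyadic_sum p (dyadic_tail \<omega>) f"
      "\<And>f. f \<in> disc_holo \<Longrightarrow> dyadic_sum p (dyadic_tail \<omega>) f \<le> ennreal C * bergman_integral p \<omega> f"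
    using bergman_integral_dyadic[OF D p] by blast
  define h where "h = dyadic_tail \<omega>"
  have hp: "h n > 0" for n using D_class_dyadic_tail(2)[OF D] by (auto simp: geometric_tail_def h_def)
  define r where "r = (\<lambda>k::nat. 1 - 1 / real (Suc (Suc k)))"
  have l: "(\<lambda>n. 1 / real (Suc n)) \<longlonglongrightarrow> 0"
    using LIMSEQ_inverse_real_of_nat by (simp add: inverse_eq_divide)
  have r: "0 \<le> r k" "r k \<le> 1" "0 < r k" "r k < 1" for k by (auto simp: r_def)
  have r1: "r \<longlonglongrightarrow> 1"
    unfolding r_def using tendsto_diff[OF tendsto_const LIMSEQ_Suc[OF l], of 1] by simp
  define P where "P = (\<lambda>n. pmean p f (dyadic_radius (Suc n)))"
  define b where "b = (\<lambda>n k. h n * pmean p (\<lambda>z. f z - dilate (r k) f z) (dyadic_radius (Suc n)))"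
  have P0: "0 \<le> P n" for n unfolding P_def by (rule circle_mean_nonneg) simp
  have b0: "0 \<le> b n k" for n k unfolding b_def using hp[of n] by (intro mult_nonneg_nonneg circle_mean_nonneg) auto
  have "dyadic_sum p h f < \<infinity>"
    using C(3)[OF fd] f unfolding h_def mem_bergman_iff[OF rw]
    by (auto simp: ennreal_mult_less_top intro: le_less_trans)
  then have sumP: "summable (\<lambda>n. h n * P n)"
    using hp P0 by (intro summable_suminf_not_top) (auto simp: dyadic_sum_def P_def less_imp_le)
  have bb: "b n k \<le> 2 powr p * (h n * P n)" for n k
  proof -
    have "pmean p (\<lambda>z. f z - dilate (r k) f z) (dyadic_radius (Suc n))
       \<le> 2 powr (p - 1) * (P n + pmean p (dilate (r k) f) (dyadic_radius (Suc n)))"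
      unfolding P_def by (intro pmean_diff_le fd dilate_disc_holo r p dyadic_radius_bounds)
    also have "\<dots> \<le> 2 powr (p - 1) * (P n + P n)"
      unfolding P_def by (intro mult_left_mono add_left_mono pmean_dilate_le fd r p dyadic_radius_bounds) auto
    also have "\<dots> = 2 powr p * P n" by (simp add: powr_diff)
    finally show ?thesis using hp[of n] by (simp add: b_def mult.left_commute)
  qed
  have lim: "(\<lambda>k. \<Sum>n. b n k) \<longlonglongrightarrow> (\<Sum>n. 0)"
  proof -
    have "eventually (\<lambda>k. summable (\<lambda>n. norm (b n k))) sequentially \<and> summable (\<lambda>n::nat. norm (0::real)) \<and>
       (\<lambda>k. \<Sum>n. b n k) \<longlonglongrightarrow> (\<Sum>n. 0)"
    proof (rule tannerys_theorem[where M = "\<lambda>n. 2 powr p * (h n * P n)"])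
      show "(\<lambda>k. b n k) \<longlonglongrightarrow> 0" for n
        unfolding b_def by (intro tendsto_mult_right_zero pmean_dilate_tendsto fd p dyadic_radius_bounds r r1)
      show "\<forall>\<^sub>F (n, k) in sequentially \<times>\<^sub>F sequentially. norm (b n k) \<le> 2 powr p * (h n * P n)"
        using bb b0 by (intro always_eventually) auto
      show "summable (\<lambda>n. 2 powr p * (h n * P n))" by (intro summable_mult sumP)
    qed simp
    then show ?thesis by blast
  qed
  have sumb: "summable (\<lambda>n. b n k)" for k
    by (rule summable_comparison_test'[OF summable_mult[OF sumP, of "2 powr p"], of 0]) (use bb b0 in auto)
  define c where "c = (e / 2) powr p / C"
  have c: "c > 0" using e C by (simp add: c_def)
  have "eventually (\<lambda>k. (\<Sum>n. b n k) < c) sequentially" using order_tendstoD(2)[OF lim] c by simp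
  then obtain k where k: "(\<Sum>n. b n k) < c" by (auto simp: eventually_sequentially)
  have dd: "(\<lambda>z. f z - dilate (r k) f z) \<in> disc_holo" by (intro disc_holo_diff fd dilate_disc_holo r)
  have "bergman_integral p \<omega> (\<lambda>z. f z - dilate (r k) f z) \<le> ennreal C * dyadic_sum p h (\<lambda>z. f z - dilate (r k) f z)"
    unfolding h_def by (rule C(2)[OF dd])
  also have "dyadic_sum p h (\<lambda>z. f z - dilate (r k) f z) = ennreal (\<Sum>n. b n k)"
  proof -
    have "dyadic_sum p h (\<lambda>z. f z - dilate (r k) f z) = (\<Sum>n. ennreal (b n k))"
      by (simp add: dyadic_sum_def b_def)
    then show ?thesis using suminf_ennreal2[OF b0 sumb] by simp
  qed
  also have "ennreal C * \<dots> \<le> ennreal C * ennreal c" using k by (intro mult_left_mono ennreal_leI) auto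
  also have "\<dots> = ennreal ((e / 2) powr p)" using C(1) c by (simp add: ennreal_mult[symmetric] c_def)
  finally have "bergman_norm p \<omega> (\<lambda>z. f z - dilate (r k) f z) \<le> e / 2"
    using bergman_normI(2)[OF rw p0 dd, of "e / 2"] e by simp
  then show ?thesis using r[of k] e by (intro exI[of _ "r k"]) auto
qed

lemma dilate_poly_approx:
  assumes f: "f \<in> disc_holo" and r: "0 < r" "r < 1" and e: "e > 0"
  shows "\<exists>c N. \<forall>z\<in>unit_disc. cmod (dilate r f z - disc_poly c N z) \<le> e"
proof -
  define a where "a = (\<lambda>n. (deriv ^^ n) f 0 / fact n)"
  have ser: "(\<lambda>n. a n * z ^ n) sums f z" if "cmod z < 1" for z
    using holomorphic_power_series[of f 0 1 z] f that by (simp add: a_def disc_holo_def)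
  obtain s where s: "r < s" "s < 1" using dense[OF r(2)] by blast
  have "summable (\<lambda>n. a n * of_real s ^ n)" using ser[of "of_real s"] s r by (auto simp: summable_def)
  then have sn: "summable (\<lambda>n. cmod (a n * of_real r ^ n))"
    by (rule powser_insidea) (use s r in auto)
  obtain N where N: "(\<Sum>n. cmod (a (n + N) * of_real r ^ (n + N))) < e"
  proof -
    have "(\<lambda>N. \<Sum>n. cmod (a (n + N) * of_real r ^ (n + N))) \<longlonglongrightarrow> 0" by (rule suminf_exist_split2[OF sn])
    then have "\<forall>\<^sub>F N in sequentially. (\<Sum>n. cmod (a (n + N) * of_real r ^ (n + N))) < e"
      using e by (rule order_tendstoD)
    then show thesis using that by (auto simp: eventually_sequentially)
  qed
  have "cmod (dilate r f z - disc_poly (\<lambda>n. a n * of_real r ^ n) N z) \<le> e" if z: "z \<in> unit_disc" for z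
  proof -
    have rz: "cmod (of_real r * z) < 1"
      using z r mult_strict_mono[of r 1 "cmod z" 1] by (simp add: norm_mult)
    have s1: "(\<lambda>n. (a n * of_real r ^ n) * z ^ n) sums f (of_real r * z)"
      using ser[OF rz] by (simp add: power_mult_distrib mult_ac)
    have le: "cmod (a n * of_real r ^ n * z ^ n) \<le> cmod (a n * of_real r ^ n)" for n
      using z mult_left_le[of "cmod z ^ n" "cmod (a n * of_real r ^ n)"] by (simp add: norm_mult norm_power power_le_one)
    have sn': "summable (\<lambda>n. cmod (a (n + N) * of_real r ^ (n + N)))"
      using sn by (rule summable_ignore_initial_segment)
    have "dilate r f z - disc_poly (\<lambda>n. a n * of_real r ^ n) N z
       = (\<Sum>n. (a (n + N) * of_real r ^ (n + N)) * z ^ (n + N))"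
      using z suminf_minus_initial_segment[OF sums_summable[OF s1], of N] sums_unique[OF s1]
      by (simp add: dilate_def disc_poly_def)
    also have "cmod \<dots> \<le> (\<Sum>n. cmod (a (n + N) * of_real r ^ (n + N)))"
      by (rule norm_suminf_le[OF _ sn']) (rule le)
    finally show ?thesis using N by simp
  qed
  then show ?thesis by blast
qed

lemma disc_poly_dense:
  assumes D: "\<omega> \<in> D_class" and p: "p > 1" and f: "f \<in> bergman p \<omega>" and e: "e > 0"
  shows "\<exists>c N. bergman_norm p \<omega> (\<lambda>z. f z - disc_poly c N z) < e"
proof -
  have rw: "radial_weight \<omega>" by (rule D_class_radial[OF D])
  interpret function_seminorm "bergman p \<omega>" "bergman_norm p \<omega>" by (rule bergman_seminorm[OF rw p])
  have fd: "f \<in> disc_holo" by (rule bergman_sub_disc_holo[OF f])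
  obtain r where r: "0 < r" "r < 1" "bergman_norm p \<omega> (\<lambda>z. f z - dilate r f z) < e / 2"
    using bergman_dilate_approx[OF D p f, of "e / 2"] e by auto
  define t where "t = e / (2 * (bergman_norm p \<omega> disc_one + 1))"
  have n1: "0 \<le> bergman_norm p \<omega> disc_one" by (rule bergman_norm_nonneg)
  have t: "t > 0" using e n1 by (simp add: t_def)
  obtain c N where cN: "\<And>z. z \<in> unit_disc \<Longrightarrow> cmod (dilate r f z - disc_poly c N z) \<le> t"
    using dilate_poly_approx[OF fd r(1,2) t] by blast
  have rd: "dilate r f \<in> disc_holo" by (rule dilate_disc_holo[OF fd]) (use r in auto)
  note b = bergman_bounded[OF rw p disc_holo_diff[OF rd disc_poly_disc_holo] less_imp_le[OF t] cN]
  have pB: "disc_poly c N \<in> bergman p \<omega>" by (rule disc_poly_bergman[OF rw p])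
  have rB: "dilate r f \<in> bergman p \<omega>" using add_mem[OF b(1) pB] by simp
  have "t * bergman_norm p \<omega> disc_one \<le> e / 2"
  proof -
    have "t * bergman_norm p \<omega> disc_one \<le> t * (bergman_norm p \<omega> disc_one + 1)" using t by simp
    also have "\<dots> = e / 2"
    proof -
      have "bergman_norm p \<omega> disc_one + 1 \<noteq> 0" using n1 by linarith
      then show ?thesis by (simp only: t_def) (simp add: divide_simps)
    qed
    finally show ?thesis .
  qed
  then have "bergman_norm p \<omega> (\<lambda>z. f z - disc_poly c N z) < e"
    using norm_triangle[OF f rB pB] r(3) b(2) by linarith
  then show ?thesis by blast
qed

section \<open>Products of Bergman functions\<close>

text \<open>
  The factors \<open>1 - r\<close> in the averaged weights cancel since \<open>1/q = 1/p1 + 1/p2\<close>.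
\<close>
lemma comparable_dyadic_tails:
  fixes p1 p2 q :: real
  assumes D: "\<omega> \<in> D_class" "\<nu> \<in> D_class" "\<eta> \<in> D_class"
    and pq: "1 / q = 1 / p1 + 1 / p2"
    and comp: "comparable_on {0..<1} (\<lambda>r. weight_tilde \<eta> r powr (1 / q))
           (\<lambda>r. weight_tilde \<omega> r powr (1 / p1) * weight_tilde \<nu> r powr (1 / p2))"
  shows "\<exists>C>0. \<forall>n. dyadic_tail \<eta> n powr (1 / q) \<le> C * (dyadic_tail \<omega> n powr (1 / p1) * dyadic_tail \<nu> n powr (1 / p2))
     \<and> dyadic_tail \<omega> n powr (1 / p1) * dyadic_tail \<nu> n powr (1 / p2) \<le> C * dyadic_tail \<eta> n powr (1 / q)"
proof -
  obtain C where C: "C > 0" "\<And>r. r \<in> {0..<1} \<Longrightarrow> weight_tilde \<eta> r powr (1 / q) / C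
       \<le> weight_tilde \<omega> r powr (1 / p1) * weight_tilde \<nu> r powr (1 / p2)
     \<and> weight_tilde \<omega> r powr (1 / p1) * weight_tilde \<nu> r powr (1 / p2) \<le> C * weight_tilde \<eta> r powr (1 / q)"
    using comp unfolding comparable_on_def by blast
  have tl: "weight_tilde \<mu> (dyadic_radius n) powr a = dyadic_tail \<mu> n powr a * (2 ^ n) powr a" for \<mu> n and a :: real
  proof -
    have "weight_tilde \<mu> (dyadic_radius n) = dyadic_tail \<mu> n * 2 ^ n"
      by (simp add: weight_tilde_def dyadic_tail_def dyadic_radius_def)
    then show ?thesis by (simp add: powr_mult dyadic_tail_def)
  qed
  have "dyadic_tail \<eta> n powr (1 / q) \<le> C * (dyadic_tail \<omega> n powr (1 / p1) * dyadic_tail \<nu> n powr (1 / p2))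
     \<and> dyadic_tail \<omega> n powr (1 / p1) * dyadic_tail \<nu> n powr (1 / p2) \<le> C * dyadic_tail \<eta> n powr (1 / q)" for n
  proof -
    let ?h = "dyadic_tail \<eta> n powr (1 / q)"
    let ?g = "dyadic_tail \<omega> n powr (1 / p1) * dyadic_tail \<nu> n powr (1 / p2)"
    define t :: real where "t = (2 ^ n) powr (1 / q)"
    have t: "t > 0" by (simp add: t_def)
    have e: "(2 ^ n) powr (1 / p1) * (2 ^ n) powr (1 / p2) = t" by (simp add: t_def pq powr_add)
    have "weight_tilde \<omega> (dyadic_radius n) powr (1 / p1) * weight_tilde \<nu> (dyadic_radius n) powr (1 / p2) = ?g * t"
      unfolding tl e[symmetric] by (simp add: mult_ac)
    moreover have "weight_tilde \<eta> (dyadic_radius n) powr (1 / q) = ?h * t" by (simp add: tl t_def)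
    ultimately have "?h * t \<le> (C * ?g) * t" "?g * t \<le> (C * ?h) * t"
      using C(2)[of "dyadic_radius n"] C(1) dyadic_radius_bounds[of n] by (auto simp: field_simps)
    then show ?thesis using t by (simp add: mult_le_cancel_right_pos del: mult_le_cancel_right)
  qed
  then show ?thesis using C(1) by blast
qed

text \<open>
  A pointwise form of Hoelder's inequality: after normalisation by \<open>a\<close> and \<open>b\<close>, Young's inequality with exponents \<open>p1/q\<close> and \<open>p2/q\<close>
  distributes the weight \<open>k\<close> over the two factors.
\<close>
lemma weighted_product_le:
  fixes p1 p2 q :: real
  assumes p: "1 < p1" "1 < p2" "1 < q" and pq: "1 / q = 1 / p1 + 1 / p2"
    and h: "0 < h" "0 < g" "0 < k" and C: "C > 0"
    and le: "k powr (1 / q) \<le> C * (h powr (1 / p1) * g powr (1 / p2))"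
    and xy: "0 \<le> x" "0 \<le> y" and ab: "0 < a" "0 < b"
  shows "k * (x * y) powr q \<le> (C * a * b) powr q * (h * x powr p1 / a powr p1 + g * y powr p2 / b powr p2)"
proof (cases "x = 0 \<or> y = 0")
  case True
  then show ?thesis using h xy ab p by auto
next
  case False
  then have pos: "x > 0" "y > 0" using xy by auto
  define X where "X = h * x powr p1 / a powr p1"
  define Y where "Y = g * y powr p2 / b powr p2"
  have XY: "X > 0" "Y > 0" using pos h ab by (auto simp: X_def Y_def)
  have q1: "q / p1 + q / p2 = 1"
  proof -
    have "q / p1 + q / p2 = q * (1 / p1 + 1 / p2)" by (simp add: distrib_left)
    then show ?thesis using p by (simp add: pq[symmetric])
  qed
  have ql: "0 \<le> q / p1" "0 \<le> q / p2" "q / p1 \<le> 1" "q / p2 \<le> 1" 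
  proof -
    show "0 \<le> q / p1" "0 \<le> q / p2" using p by auto
    then show "q / p1 \<le> 1" "q / p2 \<le> 1" using q1 by linarith+
  qed
  have "k = (k powr (1 / q)) powr q" using h p by (simp add: powr_powr)
  also have "\<dots> \<le> (C * (h powr (1 / p1) * g powr (1 / p2))) powr q"
    using le p by (intro powr_mono2) auto
  also have "\<dots> = C powr q * (h powr (q / p1) * g powr (q / p2))"
    using C by (simp add: powr_mult powr_powr)
  finally have kk: "k \<le> C powr q * (h powr (q / p1) * g powr (q / p2))" .
  have "k * (x * y) powr q \<le> C powr q * (h powr (q / p1) * g powr (q / p2)) * (x * y) powr q"
    using kk by (intro mult_right_mono) auto
  also have "\<dots> = (C * a * b) powr q * (X powr (q / p1) * Y powr (q / p2))"
    using p pos h ab C by (simp add: X_def Y_def powr_mult powr_divide powr_powr)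
  also have "X powr (q / p1) * Y powr (q / p2) \<le> q / p1 * X + q / p2 * Y"
    using ql q1 XY by (intro Youngs_inequality_0) auto
  also have "\<dots> \<le> X + Y" using ql XY by (intro add_mono mult_left_le_one_le) auto
  finally show ?thesis by (simp add: X_def Y_def mult_left_mono)
qed

lemma bergman_mult:
  fixes p1 p2 q :: real
  assumes p: "1 < p1" "1 < p2" "1 < q" and D: "\<omega> \<in> D_class" "\<nu> \<in> D_class" "\<eta> \<in> D_class"
    and pq: "1 / q = 1 / p1 + 1 / p2"
    and comp: "comparable_on {0..<1} (\<lambda>r. weight_tilde \<eta> r powr (1 / q))
           (\<lambda>r. weight_tilde \<omega> r powr (1 / p1) * weight_tilde \<nu> r powr (1 / p2))"
  shows "\<exists>C>0. \<forall>\<phi>\<in>bergman p1 \<omega>. \<forall>\<psi>\<in>bergman p2 \<nu>. (\<lambda>z. \<phi> z * \<psi> z) \<in> bergman q \<eta> \<and>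
     bergman_norm q \<eta> (\<lambda>z. \<phi> z * \<psi> z) \<le> C * (bergman_norm p1 \<omega> \<phi> * bergman_norm p2 \<nu> \<psi>)"
proof -
  have rw: "radial_weight \<omega>" "radial_weight \<nu>" "radial_weight \<eta>" using D unfolding D_class_def D_hat_def by blast+
  have p0: "p1 > 0" "p2 > 0" "q > 0" using p by auto
  define h g k where "h = dyadic_tail \<omega>" and "g = dyadic_tail \<nu>" and "k = dyadic_tail \<eta>"
  have pos: "0 < h n" "0 < g n" "0 < k n" for n
    using D_class_dyadic_tail(2)[OF D(1)] D_class_dyadic_tail(2)[OF D(2)] D_class_dyadic_tail(2)[OF D(3)]
    by (auto simp: h_def g_def k_def geometric_tail_def)
  obtain C0 where C0: "C0 > 0" "\<And>n. k n powr (1 / q) \<le> C0 * (h n powr (1 / p1) * g n powr (1 / p2))"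
    using comparable_dyadic_tails[OF D pq comp] unfolding h_def g_def k_def by blast
  obtain C1 where C1: "C1 > 0" "\<And>f. f \<in> disc_holo \<Longrightarrow> dyadic_sum p1 h f \<le> ennreal C1 * bergman_integral p1 \<omega> f"
    using bergman_integral_dyadic[OF D(1) p(1)] unfolding h_def by blast
  obtain C2 where C2: "C2 > 0" "\<And>f. f \<in> disc_holo \<Longrightarrow> dyadic_sum p2 g f \<le> ennreal C2 * bergman_integral p2 \<nu> f"
    using bergman_integral_dyadic[OF D(2) p(2)] unfolding g_def by blast
  obtain C3 where C3: "C3 > 0" "\<And>f. f \<in> disc_holo \<Longrightarrow> bergman_integral q \<eta> f \<le> ennreal C3 * dyadic_sum q k f"
    using bergman_integral_dyadic[OF D(3) p(3)] unfolding k_def by blast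
  define C where "C = C0 * (C3 * (C1 + C2)) powr (1 / q)"
  have C: "C > 0" using C0 C1 C2 C3 by (simp add: C_def)
  have main: "(\<lambda>z. \<phi> z * \<psi> z) \<in> bergman q \<eta> \<and> bergman_norm q \<eta> (\<lambda>z. \<phi> z * \<psi> z) \<le> C * (a * b)"
    if ph: "\<phi> \<in> bergman p1 \<omega>" "bergman_norm p1 \<omega> \<phi> \<le> a" "0 < a"
      and ps: "\<psi> \<in> bergman p2 \<nu>" "bergman_norm p2 \<nu> \<psi> \<le> b" "0 < b" for \<phi> \<psi> a b
  proof -
    have phd: "\<phi> \<in> disc_holo" and psd: "\<psi> \<in> disc_holo" using ph ps bergman_sub_disc_holo by blast+
    have d: "(\<lambda>z. \<phi> z * \<psi> z) \<in> disc_holo"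
      using phd psd by (auto simp: disc_holo_def intro: holomorphic_on_mult)
    let ?K = "(C0 * a * b) powr q"
    define u where "u = (\<lambda>n. h n * pmean p1 \<phi> (dyadic_radius (Suc n)))"
    define v where "v = (\<lambda>n. g n * pmean p2 \<psi> (dyadic_radius (Suc n)))"
    have uv: "0 \<le> u n" "0 \<le> v n" for n
      unfolding u_def v_def
      by (intro mult_nonneg_nonneg circle_mean_nonneg less_imp_le[OF pos(1)] less_imp_le[OF pos(2)]; simp)+
    have step: "k n * pmean q (\<lambda>z. \<phi> z * \<psi> z) (dyadic_radius (Suc n)) \<le> ?K / a powr p1 * u n + ?K / b powr p2 * v n" for n
    proof -
      define R where "R = dyadic_radius (Suc n)"
      have R: "0 \<le> R" "R < 1" by (auto simp: R_def dyadic_radius_bounds)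
      have c: "continuous_on (cball 0 R) (\<lambda>z. cmod (\<phi> z) powr p1)" "continuous_on (cball 0 R) (\<lambda>z. cmod (\<psi> z) powr p2)"
        "continuous_on (cball 0 R) (\<lambda>z. cmod (\<phi> z * \<psi> z) powr q)"
        using phd psd d R p by (auto intro!: continuous_powr_holo simp: disc_holo_def simp del: norm_mult)
      have "k n * pmean q (\<lambda>z. \<phi> z * \<psi> z) R = circle_mean (\<lambda>z. k n * cmod (\<phi> z * \<psi> z) powr q + 0 * cmod (\<phi> z) powr p1) (of_real R)"
        using R by (subst circle_mean_comb[OF c(3,1)]) auto
      also have "\<dots> \<le> circle_mean (\<lambda>z. ?K / a powr p1 * h n * cmod (\<phi> z) powr p1 + ?K / b powr p2 * g n * cmod (\<psi> z) powr p2) (of_real R)"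
      proof (rule circle_mean_mono_fun)
        fix w
        show "k n * cmod (\<phi> w * \<psi> w) powr q + 0 * cmod (\<phi> w) powr p1
          \<le> ?K / a powr p1 * h n * cmod (\<phi> w) powr p1 + ?K / b powr p2 * g n * cmod (\<psi> w) powr p2"
          using weighted_product_le[OF p pq pos[of n] C0(1) C0(2)[of n] norm_ge_zero[of "\<phi> w"] norm_ge_zero[of "\<psi> w"] ph(3) ps(3)]
          by (simp add: norm_mult distrib_left mult.assoc)
        show "continuous_on (cball 0 R) (\<lambda>z. k n * cmod (\<phi> z * \<psi> z) powr q + 0 * cmod (\<phi> z) powr p1)"
          by (intro continuous_on_add continuous_on_mult_left c)
        show "continuous_on (cball 0 R) (\<lambda>z. ?K / a powr p1 * h n * cmod (\<phi> z) powr p1 + ?K / b powr p2 * g n * cmod (\<psi> z) powr p2)"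
          by (intro continuous_on_add continuous_on_mult_left c)
        show "cmod (complex_of_real R) \<le> R" using R by simp
      qed
      also have "\<dots> = ?K / a powr p1 * u n + ?K / b powr p2 * v n"
        using R by (subst circle_mean_comb[OF c(1,2)]) (auto simp: u_def v_def R_def)
      finally show ?thesis by (simp add: R_def)
    qed
    have "dyadic_sum q k (\<lambda>z. \<phi> z * \<psi> z) \<le> (\<Sum>n. ennreal (?K / a powr p1) * ennreal (u n) + ennreal (?K / b powr p2) * ennreal (v n))"
      unfolding dyadic_sum_def
    proof (intro suminf_le summableI)
      fix n
      show "ennreal (k n * pmean q (\<lambda>z. \<phi> z * \<psi> z) (dyadic_radius (Suc n)))
         \<le> ennreal (?K / a powr p1) * ennreal (u n) + ennreal (?K / b powr p2) * ennreal (v n)"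
        using step[of n] uv[of n]
        by (simp add: ennreal_mult[symmetric] ennreal_plus[symmetric] ennreal_leI del: ennreal_plus)
    qed
    also have "\<dots> = ennreal (?K / a powr p1) * dyadic_sum p1 h \<phi> + ennreal (?K / b powr p2) * dyadic_sum p2 g \<psi>"
      unfolding dyadic_sum_def u_def v_def by (simp add: suminf_add[symmetric] ennreal_suminf_cmult)
    also have "\<dots> \<le> ennreal (?K / a powr p1) * (ennreal C1 * ennreal (a powr p1)) + ennreal (?K / b powr p2) * (ennreal C2 * ennreal (b powr p2))"
    proof (intro add_mono mult_left_mono)
      show "dyadic_sum p1 h \<phi> \<le> ennreal C1 * ennreal (a powr p1)"
        by (rule order_trans[OF C1(2)[OF phd] mult_left_mono[OF bergman_normD[OF rw(1) p0(1) ph(1,2)]]]) simp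
      show "dyadic_sum p2 g \<psi> \<le> ennreal C2 * ennreal (b powr p2)"
        by (rule order_trans[OF C2(2)[OF psd] mult_left_mono[OF bergman_normD[OF rw(2) p0(2) ps(1,2)]]]) simp
    qed auto
    also have "\<dots> = ennreal (?K * (C1 + C2))"
      using C1(1) C2(1) ph(3) ps(3)
      by (simp add: ennreal_mult[symmetric] ennreal_plus[symmetric] distrib_left del: ennreal_plus)
    finally have ds: "dyadic_sum q k (\<lambda>z. \<phi> z * \<psi> z) \<le> ennreal (?K * (C1 + C2))" .
    have "bergman_integral q \<eta> (\<lambda>z. \<phi> z * \<psi> z) \<le> ennreal C3 * ennreal (?K * (C1 + C2))"
      by (rule order_trans[OF C3(2)[OF d] mult_left_mono[OF ds]]) simp
    also have "\<dots> = ennreal ((C * (a * b)) powr q)"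
    proof -
      have "(C * (a * b)) powr q = C3 * (?K * (C1 + C2))"
        using C0(1) C1(1) C2(1) C3(1) ph(3) ps(3) p0 by (simp add: C_def powr_mult powr_powr)
      then show ?thesis using C3(1) C1(1) C2(1) by (simp add: ennreal_mult[symmetric])
    qed
    finally have bi: "bergman_integral q \<eta> (\<lambda>z. \<phi> z * \<psi> z) \<le> ennreal ((C * (a * b)) powr q)" .
    have "0 \<le> C * (a * b)" using C ph(3) ps(3) by simp
    from bergman_normI[OF rw(3) p0(3) d this bi] show ?thesis by blast
  qed
  have "(\<lambda>z. \<phi> z * \<psi> z) \<in> bergman q \<eta> \<and>
     bergman_norm q \<eta> (\<lambda>z. \<phi> z * \<psi> z) \<le> C * (bergman_norm p1 \<omega> \<phi> * bergman_norm p2 \<nu> \<psi>)"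
    if ph: "\<phi> \<in> bergman p1 \<omega>" and ps: "\<psi> \<in> bergman p2 \<nu>" for \<phi> \<psi>
  proof -
    let ?a = "bergman_norm p1 \<omega> \<phi>" and ?b = "bergman_norm p2 \<nu> \<psi>"
    have n: "0 \<le> ?a" "0 \<le> ?b" by (simp_all add: bergman_norm_nonneg)
    have m: "(\<lambda>z. \<phi> z * \<psi> z) \<in> bergman q \<eta> \<and> bergman_norm q \<eta> (\<lambda>z. \<phi> z * \<psi> z) \<le> C * ((?a + e) * (?b + e))" if "e > 0" for e
      using that n by (intro main ph ps) auto
    have l: "(\<lambda>n. 1 / real (Suc n)) \<longlonglongrightarrow> 0"
      using LIMSEQ_inverse_real_of_nat by (simp add: inverse_eq_divide)
    have "bergman_norm q \<eta> (\<lambda>z. \<phi> z * \<psi> z) \<le> C * ((?a + 0) * (?b + 0))"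
      by (rule LIMSEQ_le_const[OF tendsto_mult_left[OF tendsto_mult[OF tendsto_add[OF tendsto_const l] tendsto_add[OF tendsto_const l]]]])
         (use m in \<open>auto intro!: exI[of _ 0]\<close>)
    then show ?thesis using m[of 1] by simp
  qed
  then show ?thesis using C by blast
qed

section \<open>Sums of reproducing kernels over dyadic boxes\<close>

lemma sum_power_distance_le:
  fixes x :: real
  assumes x: "0 \<le> x" "x < 1"
  shows "(\<Sum>n<L. x ^ ((m - n) + (n - m))) \<le> 2 / (1 - x)"
proof -
  have geo: "(\<Sum>k<K. x ^ k) \<le> 1 / (1 - x)" for K
    using x sum_gp_strict[of x K] by (simp add: divide_right_mono)
  have "(\<Sum>n<L. x ^ ((m - n) + (n - m))) \<le> (\<Sum>k<m. x ^ Suc k) + 1 / (1 - x)"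
  proof (induction m arbitrary: L)
    case 0
    show ?case using geo by simp
  next
    case (Suc m)
    show ?case
    proof (cases L)
      case 0
      then show ?thesis using x by (simp add: add_nonneg_nonneg sum_nonneg)
    next
      case (Suc L')
      have "(\<Sum>n<Suc L'. x ^ ((Suc m - n) + (n - Suc m))) = x ^ Suc m + (\<Sum>n<L'. x ^ ((m - n) + (n - m)))"
        by (subst sum.lessThan_Suc_shift) simp
      then show ?thesis using Suc.IH[of L'] Suc by simp
    qed
  qed
  also have "(\<Sum>k<m. x ^ Suc k) \<le> (\<Sum>k<m. x ^ k)"
    using x by (intro sum_mono power_decreasing) auto
  also have "\<dots> \<le> 1 / (1 - x)" by (rule geo)
  finally show ?thesis by (simp add: add_divide_distrib[symmetric])
qed

text \<open>
  With \<open>y = x \<zeta>\<^sub>j\<close> the geometric sum gives \<open>1 / (1 - y) = (\<Sum>\<^sub>k\<^sub><\<^sub>N y\<^sup>k) / (1 - x\<^sup>N)\<close>, and the squares of the numerators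
  are summed by orthogonality of the roots of unity.
\<close>
lemma sum_inverse_square_roots:
  fixes x :: complex
  assumes x: "cmod x < 1" and N: "N > 0"
  shows "(\<Sum>j<N. 1 / (cmod (1 - x * root_of_one N j))\<^sup>2) \<le> real N / ((1 - cmod x) * (1 - cmod x ^ N)\<^sup>2)"
proof -
  let ?z = "root_of_one N"
  have xN: "cmod x ^ N < 1" using x N by (simp add: power_less_one_iff)
  have zN: "?z j ^ N = 1" for j
    using root_of_one_pow[OF N, of j N] by (simp add: root_of_one_def)
  have "(\<Sum>j<N. 1 / (cmod (1 - x * ?z j))\<^sup>2) \<le> (\<Sum>j<N. (cmod (\<Sum>k<N. (x * ?z j) ^ k))\<^sup>2 / (1 - cmod x ^ N)\<^sup>2)"
  proof (rule sum_mono)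
    fix j
    have yn: "cmod (x * ?z j) < 1" using x by (simp add: norm_mult)
    then have y1: "x * ?z j \<noteq> 1" by auto
    have "(1 - x * ?z j) * (\<Sum>k<N. (x * ?z j) ^ k) = 1 - x ^ N"
      using one_diff_power_eq[of "x * ?z j" N] by (simp add: power_mult_distrib zN)
    then have "cmod (1 - x * ?z j) * cmod (\<Sum>k<N. (x * ?z j) ^ k) = cmod (1 - x ^ N)"
      by (metis norm_mult)
    moreover have "cmod (1 - x ^ N) > 0" using xN by (auto simp flip: norm_power)
    moreover have "cmod (1 - x * ?z j) > 0" using y1 by simp
    ultimately have "1 / cmod (1 - x * ?z j) = cmod (\<Sum>k<N. (x * ?z j) ^ k) / cmod (1 - x ^ N)"
      by (simp add: field_simps)
    then have "1 / (cmod (1 - x * ?z j))\<^sup>2 = (cmod (\<Sum>k<N. (x * ?z j) ^ k))\<^sup>2 / (cmod (1 - x ^ N))\<^sup>2"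
      by (metis power_one_over power_divide)
    also have "\<dots> \<le> (cmod (\<Sum>k<N. (x * ?z j) ^ k))\<^sup>2 / (1 - cmod x ^ N)\<^sup>2"
    proof (intro divide_left_mono)
      show "(1 - cmod x ^ N)\<^sup>2 \<le> (cmod (1 - x ^ N))\<^sup>2"
        using norm_triangle_ineq2[of 1 "x ^ N"] xN by (intro power_mono) (auto simp: norm_power)
      have "1 - cmod x ^ N \<le> cmod (1 - x ^ N)" using norm_triangle_ineq2[of 1 "x ^ N"] by (simp add: norm_power)
      then show "0 < (cmod (1 - x ^ N))\<^sup>2 * (1 - cmod x ^ N)\<^sup>2"
        using xN by (intro mult_pos_pos zero_less_power) linarith+
    qed simp
    finally show "1 / (cmod (1 - x * ?z j))\<^sup>2 \<le> (cmod (\<Sum>k<N. (x * ?z j) ^ k))\<^sup>2 / (1 - cmod x ^ N)\<^sup>2" .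
  qed
  also have "\<dots> = (\<Sum>j<N. (cmod (\<Sum>k<N. (x * ?z j) ^ k))\<^sup>2) / (1 - cmod x ^ N)\<^sup>2"
    by (simp add: sum_divide_distrib)
  also have "(\<Sum>j<N. (cmod (\<Sum>k<N. (x * ?z j) ^ k))\<^sup>2) = real N * (\<Sum>k<N. (cmod x)\<^sup>2 ^ k)"
  proof -
    have "complex_of_real (\<Sum>j<N. (cmod (\<Sum>k<N. (x * ?z j) ^ k))\<^sup>2)
        = (\<Sum>j<N. \<Sum>k<N. \<Sum>l<N. (x ^ k * cnj x ^ l) * (?z j ^ k * cnj (?z j) ^ l))"
      by (simp add: complex_norm_square cnj_sum sum_product power_mult_distrib mult_ac del: of_real_power)
    also have "\<dots> = (\<Sum>k<N. \<Sum>j<N. \<Sum>l<N. (x ^ k * cnj x ^ l) * (?z j ^ k * cnj (?z j) ^ l))"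
      by (rule sum.swap)
    also have "\<dots> = (\<Sum>k<N. \<Sum>l<N. \<Sum>j<N. (x ^ k * cnj x ^ l) * (?z j ^ k * cnj (?z j) ^ l))"
      by (intro sum.cong refl sum.swap)
    also have "\<dots> = (\<Sum>k<N. \<Sum>l<N. if k = l then x ^ k * cnj x ^ k * of_nat N else 0)"
      unfolding sum_distrib_left[symmetric] root_of_one_orthogonal[OF N]
      by (intro sum.cong refl) auto
    also have "\<dots> = (\<Sum>k<N. x ^ k * cnj x ^ k * of_nat N)" by simp
    also have "\<dots> = of_real (real N * (\<Sum>k<N. (cmod x)\<^sup>2 ^ k))"
    proof -
      have "x ^ k * cnj x ^ k = of_real ((cmod x)\<^sup>2 ^ k)" for k
        by (simp only: power_mult_distrib[symmetric] complex_norm_square[symmetric] of_real_power)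
      then show ?thesis by (simp add: sum_distrib_left mult.commute)
    qed
    finally show ?thesis by (simp only: of_real_eq_iff)
  qed
  also have "(\<Sum>k<N. (cmod x)\<^sup>2 ^ k) \<le> 1 / (1 - cmod x)"
  proof -
    have x2: "(cmod x)\<^sup>2 \<le> cmod x" using x by (simp add: power2_eq_square mult_left_le)
    have "(\<Sum>k<N. (cmod x)\<^sup>2 ^ k) \<le> (\<Sum>k<N. cmod x ^ k)"
      by (intro sum_mono power_mono x2) simp
    also have "\<dots> \<le> 1 / (1 - cmod x)"
      using x sum_gp_strict[of "cmod x" N] by (simp add: divide_right_mono)
    finally show ?thesis .
  qed
  finally show ?thesis
    using xN N by (simp add: divide_right_mono mult_left_mono)
qed

text \<open>
  The exact mean is \<open>1 / (1 - |x r|\<^sup>2)\<close>. The constant \<open>5\<close> is what remains after approximating the mean by sums over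
  roots of unity, which makes \<open>sum_inverse_square_roots\<close> serve for both estimates.
\<close>
lemma circle_mean_inverse_square:
  fixes x :: complex
  assumes x: "cmod x * r < 1" and r: "0 \<le> r"
  shows "circle_mean (\<lambda>z. 1 / (cmod (1 - x * z))\<^sup>2) (of_real r) \<le> 5 / (1 - cmod x * r)"
proof -
  define u where "u = (\<lambda>z. 1 / (cmod (1 - x * z))\<^sup>2)"
  have cu: "continuous_on (cball 0 r) u"
    unfolding u_def
  proof (intro continuous_intros)
    show "\<forall>z\<in>cball 0 r. (cmod (1 - x * z))\<^sup>2 \<noteq> 0"
    proof
      fix z :: complex assume "z \<in> cball 0 r"
      then have "cmod (x * z) < 1" using x mult_left_mono[of "cmod z" r "cmod x"] by (simp add: norm_mult)
      then show "(cmod (1 - x * z))\<^sup>2 \<noteq> 0" by auto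
    qed
  qed
  obtain N0 where N0: "N0 > 0" "\<And>N z. N \<ge> N0 \<Longrightarrow> cmod z \<le> r \<Longrightarrow>
     \<bar>circle_mean u z - (\<Sum>j<N. u (z * root_of_one N j)) / real N\<bar> \<le> 1"
    using circle_mean_riemann[OF cu, of 1] by auto
  define X where "X = x * of_real r"
  have X: "cmod X < 1" "cmod X = cmod x * r" using x r by (auto simp: X_def norm_mult)
  have "(\<lambda>N. cmod X ^ N) \<longlonglongrightarrow> 0" using X(1) by (intro LIMSEQ_realpow_zero) simp_all
  then have "eventually (\<lambda>N. cmod X ^ N < 1 / 2) sequentially" by (rule order_tendstoD) simp
  then obtain N1 where N1: "\<And>N. N \<ge> N1 \<Longrightarrow> cmod X ^ N < 1 / 2" by (auto simp: eventually_sequentially)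
  define N where "N = max N0 N1"
  have N: "N \<ge> N0" "N > 0" "cmod X ^ N < 1 / 2" using N0(1) N1 by (auto simp: N_def)
  define S where "S = (\<Sum>j<N. u (of_real r * root_of_one N j))"
  have "circle_mean u (of_real r) \<le> S / real N + 1"
    using N0(2)[OF N(1), of "of_real r"] r by (simp add: abs_le_iff S_def)
  also have "S = (\<Sum>j<N. 1 / (cmod (1 - X * root_of_one N j))\<^sup>2)"
    by (simp add: u_def X_def mult.assoc S_def)
  also have "\<dots> / real N \<le> (real N / ((1 - cmod X) * (1 - cmod X ^ N)\<^sup>2)) / real N"
    by (intro divide_right_mono sum_inverse_square_roots[OF X(1) N(2)]) simp
  also have "\<dots> = 1 / ((1 - cmod X) * (1 - cmod X ^ N)\<^sup>2)" using N by simp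
  also have "\<dots> \<le> 1 / ((1 - cmod X) * (1 / 2)\<^sup>2)"
    using X(1) N by (intro divide_left_mono mult_left_mono power_mono mult_pos_pos) auto
  also have "\<dots> = 4 / (1 - cmod X)" by (simp add: power2_eq_square)
  also have "4 / (1 - cmod X) + 1 \<le> 4 / (1 - cmod X) + 1 / (1 - cmod X)"
    by (rule add_left_mono) (use X(1) in simp)
  also have "\<dots> = 5 / (1 - cmod X)" by (simp add: add_divide_distrib[symmetric])
  finally show ?thesis by (simp add: u_def X)
qed

lemma kernel_denominator:
  assumes w: "cmod w \<le> dyadic_radius (n + 2)" and z: "cmod z \<le> dyadic_radius (Suc m)"
  shows "1 / 2 ^ (min n m + 2) \<le> 1 - cmod w * cmod z"
proof -
  have w1: "cmod w \<le> 1" "cmod z \<le> 1" using w z dyadic_radius_bounds less_imp_le order_trans by blast+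
  have "cmod w * cmod z \<le> min (cmod w) (cmod z)"
    using w1 by (simp add: mult_left_le mult_left_le_one_le)
  also have "\<dots> \<le> dyadic_radius (min n m + 2)"
  proof (cases "n \<le> m")
    case True
    then show ?thesis using w by (simp add: min_def)
  next
    case False
    then show ?thesis using z dyadic_radius_mono[of "Suc m" "m + 2"] by (simp add: min_def)
  qed
  finally show ?thesis by (simp add: dyadic_radius_def)
qed

lemma kernel_le_square:
  assumes "cmod w \<le> dyadic_radius (n + 2)" "cmod z \<le> dyadic_radius (Suc m)"
  shows "1 / cmod (1 - cnj w * z) ^ (t + 2) \<le> (2 ^ (min n m + 2)) ^ t * (1 / (cmod (1 - cnj w * z))\<^sup>2)"
proof -
  have "1 - cmod w * cmod z \<le> cmod (1 - cnj w * z)"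
    using norm_triangle_ineq2[of 1 "cnj w * z"] by (simp add: norm_mult)
  with kernel_denominator[OF assms] have le: "1 / 2 ^ (min n m + 2) \<le> cmod (1 - cnj w * z)" by simp
  moreover have p: "(0::real) < 1 / 2 ^ (min n m + 2)" by simp
  ultimately have pos: "0 < cmod (1 - cnj w * z)" by linarith
  have "1 / cmod (1 - cnj w * z) \<le> 1 / (1 / 2 ^ (min n m + 2))" by (rule divide_left_mono[OF le]) (use pos in simp_all)
  then have "(1 / cmod (1 - cnj w * z)) ^ t \<le> (2 ^ (min n m + 2)) ^ t" by (intro power_mono) auto
  then have "(1 / cmod (1 - cnj w * z)) ^ t * (1 / (cmod (1 - cnj w * z))\<^sup>2) \<le> (2 ^ (min n m + 2)) ^ t * (1 / (cmod (1 - cnj w * z))\<^sup>2)"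
    by (intro mult_right_mono) auto
  moreover have "1 / cmod (1 - cnj w * z) ^ (t + 2) = (1 / cmod (1 - cnj w * z)) ^ t * (1 / (cmod (1 - cnj w * z))\<^sup>2)"
    by (simp only: power_add power_one_over times_divide_times_eq mult_1)
  ultimately show ?thesis by simp
qed

text \<open>
  All but two of the factors of the kernel are bounded by the reciprocal distance to the boundary; the remaining
  square is summed by \<open>sum_inverse_square_roots\<close>. The constant \<open>25\<close> comes from \<open>|v|\<^sup>N \<le> 4/5\<close> for
  \<open>N = 2\<^sup>n\<close> and \<open>|v| \<le> 1 - 2\<^sup>-\<^sup>n\<^sup>-\<^sup>2\<close>.
\<close>
lemma kernel_sum_le:
  assumes v: "cmod v \<le> dyadic_radius (n + 2)" and z: "cmod z \<le> dyadic_radius (Suc m)"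
  shows "(\<Sum>j<2^n. 1 / cmod (1 - cnj (v * root_of_one (2^n) j) * z) ^ (t + 2))
     \<le> 25 * 2 ^ n * (2 ^ (min n m + 2)) ^ Suc t"
proof -
  define D :: real where "D = 2 ^ (min n m + 2)"
  define x where "x = v * cnj z"
  have x: "cmod x = cmod v * cmod z" by (simp add: x_def norm_mult)
  have den: "1 / D \<le> 1 - cmod x" using kernel_denominator[OF v z] by (simp add: x D_def)
  have D: "D > 0" by (simp add: D_def)
  then have x1: "cmod x < 1" using den by (smt (verit) divide_pos_pos)
  have "cmod x \<le> cmod v" using z dyadic_radius_bounds(2)[of "Suc m"] unfolding x by (intro mult_left_le) auto
  then have xr: "cmod x \<le> dyadic_radius (n + 2)" using v by simp
  have pw: "cmod x ^ 2 ^ n \<le> 4 / 5"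
  proof -
    define y :: real where "y = 1 / 2 ^ (n + 2)"
    have y: "0 < y" "y \<le> 1" using one_le_power[of "2::real" "n + 2"] by (auto simp: y_def simp del: power_add)
    have b: "1 + real (2 ^ n) * y \<le> (1 + y) ^ 2 ^ n" by (rule Bernoulli_inequality) (use y in simp)
    have ny: "real (2 ^ n) * y = 1 / 4" by (simp add: y_def power_add)
    have "(1 - y) ^ 2 ^ n * (5 / 4) \<le> (1 - y) ^ 2 ^ n * (1 + y) ^ 2 ^ n"
      using b y unfolding ny by (intro mult_left_mono) auto
    also have "\<dots> = ((1 - y) * (1 + y)) ^ 2 ^ n" by (simp add: power_mult_distrib)
    also have "\<dots> \<le> 1" using y by (intro power_le_one) (auto simp: algebra_simps mult_le_one)
    finally have "(1 - y) ^ 2 ^ n \<le> 4 / 5" by simp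
    moreover have "cmod x ^ 2 ^ n \<le> (1 - y) ^ 2 ^ n"
      using xr by (intro power_mono) (auto simp: dyadic_radius_def y_def)
    ultimately show ?thesis by simp
  qed
  have "(\<Sum>j<2^n. 1 / cmod (1 - cnj (v * root_of_one (2^n) j) * z) ^ (t + 2))
     \<le> (\<Sum>j<2^n. D ^ t * (1 / (cmod (1 - x * root_of_one (2^n) j))\<^sup>2))"
  proof (rule sum_mono)
    fix j
    have "cmod (1 - cnj (v * root_of_one (2^n) j) * z) = cmod (cnj (1 - x * root_of_one (2^n) j))"
      by (simp add: x_def mult_ac)
    then have "cmod (1 - cnj (v * root_of_one (2^n) j) * z) = cmod (1 - x * root_of_one (2^n) j)"
      by (simp only: complex_mod_cnj)
    then show "1 / cmod (1 - cnj (v * root_of_one (2^n) j) * z) ^ (t + 2) \<le> D ^ t * (1 / (cmod (1 - x * root_of_one (2^n) j))\<^sup>2)"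
      using kernel_le_square[of "v * root_of_one (2^n) j" n z m t] v z by (simp add: D_def norm_mult)
  qed
  also have "\<dots> = D ^ t * (\<Sum>j<2^n. 1 / (cmod (1 - x * root_of_one (2^n) j))\<^sup>2)"
    by (simp add: sum_distrib_left)
  also have "\<dots> \<le> D ^ t * (real (2 ^ n) / ((1 - cmod x) * (1 - cmod x ^ 2 ^ n)\<^sup>2))"
    using D by (intro mult_left_mono sum_inverse_square_roots x1) auto
  also have "\<dots> \<le> D ^ t * (real (2 ^ n) / ((1 / D) * (1 / 5)\<^sup>2))"
    using den pw D x1 by (intro mult_left_mono divide_left_mono mult_mono power_mono mult_pos_pos) auto
  also have "\<dots> = 25 * 2 ^ n * D ^ Suc t" by (simp add: power2_eq_square)
  finally show ?thesis by (simp add: D_def)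
qed

lemma continuous_on_kernel:
  assumes "cmod w * R < 1"
  shows "continuous_on (cball 0 R) (\<lambda>z. 1 / cmod (1 - cnj w * z) ^ k)"
proof (intro continuous_intros)
  show "\<forall>z\<in>cball 0 R. cmod (1 - cnj w * z) ^ k \<noteq> 0"
  proof
    fix z :: complex assume "z \<in> cball 0 R"
    then have "cmod (cnj w * z) < 1" using assms mult_left_mono[of "cmod z" R "cmod w"] by (simp add: norm_mult)
    then show "cmod (1 - cnj w * z) ^ k \<noteq> 0" by auto
  qed
qed

lemma kernel_circle_mean_le:
  assumes w: "cmod w \<le> dyadic_radius (n + 2)"
  shows "circle_mean (\<lambda>z. 1 / cmod (1 - cnj w * z) ^ (t + 2)) (of_real (dyadic_radius (Suc m)))
     \<le> 5 * (2 ^ (min n m + 2)) ^ Suc t"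
proof -
  define D :: real where "D = 2 ^ (min n m + 2)"
  define R where "R = dyadic_radius (Suc m)"
  have R: "0 \<le> R" "R < 1" by (auto simp: R_def dyadic_radius_bounds)
  have D: "D > 0" by (simp add: D_def)
  have den: "1 / D \<le> 1 - cmod w * R"
    using kernel_denominator[OF w, of "of_real R" m] R by (simp add: D_def R_def)
  then have w1: "cmod w * R < 1" using D by (smt (verit) divide_pos_pos)
  have "circle_mean (\<lambda>z. 1 / cmod (1 - cnj w * z) ^ (t + 2)) (of_real R)
      \<le> circle_mean (\<lambda>z. D ^ t * (1 / (cmod (1 - cnj w * z))\<^sup>2) + 0 * (1 / (cmod (1 - cnj w * z))\<^sup>2)) (of_real R)"
  proof (rule circle_mean_mono_fun[where R = R])
    show "continuous_on (cball 0 R) (\<lambda>z. D ^ t * (1 / (cmod (1 - cnj w * z))\<^sup>2) + 0 * (1 / (cmod (1 - cnj w * z))\<^sup>2))"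
      by (intro continuous_on_add continuous_on_mult_left continuous_on_kernel w1)
    fix z assume "cmod z = cmod (complex_of_real R)"
    then have "cmod z \<le> dyadic_radius (Suc m)" using R by (simp add: R_def)
    then show "1 / cmod (1 - cnj w * z) ^ (t + 2) \<le> D ^ t * (1 / (cmod (1 - cnj w * z))\<^sup>2) + 0 * (1 / (cmod (1 - cnj w * z))\<^sup>2)"
      using kernel_le_square[OF w] by (simp add: D_def)
  next
    show "continuous_on (cball 0 R) (\<lambda>z. 1 / cmod (1 - cnj w * z) ^ (t + 2))"
      by (rule continuous_on_kernel[OF w1])
    show "cmod (complex_of_real R) \<le> R" using R by simp
  qed
  also have "\<dots> = D ^ t * circle_mean (\<lambda>z. 1 / (cmod (1 - cnj w * z))\<^sup>2) (of_real R)"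
    using R by (subst circle_mean_comb[where R = R]) (auto intro: continuous_on_kernel w1)
  also have "\<dots> \<le> D ^ t * (5 / (1 - cmod (cnj w) * R))"
    using D R w1 by (intro mult_left_mono circle_mean_inverse_square) auto
  also have "\<dots> \<le> D ^ t * (5 / (1 / D))"
    using den D w1 by (intro mult_left_mono divide_left_mono) auto
  also have "\<dots> = 5 * D ^ Suc t" by simp
  finally show ?thesis by (simp add: D_def R_def)
qed

text \<open>
  First half of the Schur test: the kernels, weighted by the test sequence \<open>(b / 2\<^sup>s)\<^sup>n\<close> with \<open>s = Suc t\<close>, sum up to at most
  a multiple of \<open>b\<^sup>m\<close> on the circle of index \<open>m\<close>. The terms decay geometrically in \<open>|n - m|\<close>, towards small \<open>n\<close> because
  \<open>b > 1\<close> and towards large \<open>n\<close> because the exponent \<open>t\<close> is large.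
\<close>
lemma level_sum_le:
  fixes b :: real
  assumes b: "b > 1" "b\<^sup>2 \<le> 2 ^ t"
  shows "(\<Sum>n<L. 2 ^ n * (b ^ n / 2 ^ (n * Suc t)) * (2 ^ min n m) ^ t) \<le> b ^ m * (2 / (1 - 1 / b))"
proof -
  have "2 ^ n * (b ^ n / 2 ^ (n * Suc t)) * (2 ^ min n m) ^ t \<le> b ^ m * (1 / b) ^ ((m - n) + (n - m))" for n
  proof (cases "n \<le> m")
    case True
    then obtain k where k: "m = n + k" using le_Suc_ex by blast
    have "2 ^ n * (b ^ n / 2 ^ (n * Suc t)) * (2 ^ min n m) ^ t = b ^ n"
      by (simp add: k power_add flip: power_mult)
    also have "\<dots> = b ^ m * (1 / b) ^ ((m - n) + (n - m))"
      using b by (simp add: k power_add power_one_over)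
    finally show ?thesis by simp
  next
    case False
    then obtain k where k: "n = m + k" using le_Suc_ex[of m n] by auto
    have "2 ^ n * (b ^ n / 2 ^ (n * Suc t)) * (2 ^ min n m) ^ t = b ^ m * (b / 2 ^ t) ^ k"
    proof -
      have "(2::real) ^ (n * Suc t) = 2 ^ n * (2 ^ m) ^ t * (2 ^ t) ^ k"
        by (simp add: k power_add add_mult_distrib add_mult_distrib2 mult.commute flip: power_mult)
      moreover have "min n m = m" by (simp add: k)
      ultimately show ?thesis by (simp add: k power_add power_divide)
    qed
    also have "\<dots> \<le> b ^ m * (1 / b) ^ k"
      using b by (intro mult_left_mono power_mono) (auto simp: field_simps power2_eq_square)
    finally show ?thesis by (simp add: k)
  qed
  then have "(\<Sum>n<L. 2 ^ n * (b ^ n / 2 ^ (n * Suc t)) * (2 ^ min n m) ^ t)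
     \<le> (\<Sum>n<L. b ^ m * (1 / b) ^ ((m - n) + (n - m)))" by (intro sum_mono)
  also have "\<dots> = b ^ m * (\<Sum>n<L. (1 / b) ^ ((m - n) + (n - m)))" by (simp add: sum_distrib_left)
  also have "\<dots> \<le> b ^ m * (2 / (1 - 1 / b))"
    using b by (intro mult_left_mono sum_power_distance_le) auto
  finally show ?thesis .
qed

text \<open>
  Second half of the Schur test, in the variable \<open>m\<close>. For \<open>m \<ge> n\<close> the geometric decay of the tails beats the growth of
  \<open>c\<^sup>m\<close>; for \<open>m < n\<close> the exponent \<open>t\<close> beats the growth of the tails towards the origin.
\<close>
lemma tail_sum_le:
  fixes h :: "nat \<Rightarrow> real"
  assumes h: "\<And>n. 0 < h n" "\<And>n. h n \<le> A * h (Suc n)" "\<And>n k. h (n + k) \<le> B * d ^ k * h n"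
    and AB: "A \<ge> 1" "B \<ge> 1" "0 < d" and c: "c \<ge> 1" "d * c \<le> \<gamma>" and \<gamma>: "0 < \<gamma>" "\<gamma> < 1" and A: "A \<le> 2 ^ t * \<gamma>"
  shows "(\<Sum>m<M. h m * c ^ m * (2 ^ min n m) ^ t) \<le> (B * (2 / (1 - \<gamma>))) * (h n * c ^ n * (2 ^ n) ^ t)"
proof -
  let ?E = "B * (h n * c ^ n * (2 ^ n) ^ t)"
  have hA: "h m \<le> A ^ k * h (m + k)" for m k
  proof (induction k)
    case (Suc k)
    have "A ^ k * h (m + k) \<le> A ^ k * (A * h (Suc (m + k)))" using AB by (intro mult_left_mono h) auto
    then show ?case using Suc by (simp add: mult_ac)
  qed simp
  have "h m * c ^ m * (2 ^ min n m) ^ t \<le> ?E * \<gamma> ^ ((n - m) + (m - n))" for m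
  proof (cases "n \<le> m")
    case True
    then obtain k where k: "m = n + k" using le_Suc_ex by blast
    have "h m * c ^ m * (2 ^ min n m) ^ t \<le> (B * d ^ k * h n) * c ^ m * (2 ^ min n m) ^ t"
      using c h(3)[of n k] by (intro mult_right_mono) (auto simp: k)
    also have "\<dots> = ?E * (d * c) ^ k" by (simp add: k power_add power_mult_distrib mult_ac)
    also have "\<dots> \<le> ?E * \<gamma> ^ k"
      using AB c h(1)[of n] by (intro mult_left_mono power_mono) (auto intro!: mult_nonneg_nonneg)
    finally show ?thesis by (simp add: k)
  next
    case False
    then obtain k where k: "n = m + k" using le_Suc_ex[of m n] by auto
    have "h m * c ^ m * (2 ^ min n m) ^ t \<le> (A ^ k * h n) * c ^ m * (2 ^ m) ^ t"
      using c hA[of m k] by (auto simp: k intro!: mult_right_mono)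
    also have "\<dots> \<le> ((2 ^ t * \<gamma>) ^ k * h n) * c ^ m * (2 ^ m) ^ t"
      using c A AB h(1)[of n] by (intro mult_right_mono power_mono) auto
    also have "\<dots> = (h n * c ^ m * (2 ^ n) ^ t) * \<gamma> ^ k"
      by (simp add: k power_add power_mult_distrib mult_ac flip: power_mult)
    also have "\<dots> \<le> (h n * c ^ n * (2 ^ n) ^ t) * \<gamma> ^ k"
      using c \<gamma> h(1)[of n] by (intro mult_right_mono mult_left_mono power_increasing) (auto simp: k)
    also have "\<dots> \<le> ?E * \<gamma> ^ k"
      using AB c \<gamma> h(1)[of n] mult_right_mono[of 1 B "h n * c ^ n * (2 ^ n) ^ t"] by (intro mult_right_mono) auto
    finally show ?thesis by (simp add: k)
  qed
  then have "(\<Sum>m<M. h m * c ^ m * (2 ^ min n m) ^ t) \<le> (\<Sum>m<M. ?E * \<gamma> ^ ((n - m) + (m - n)))" by (intro sum_mono)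
  also have "\<dots> = ?E * (\<Sum>m<M. \<gamma> ^ ((n - m) + (m - n)))" by (simp add: sum_distrib_left)
  also have "\<dots> \<le> ?E * (2 / (1 - \<gamma>))"
    using \<gamma> AB c h(1)[of n] by (intro mult_left_mono sum_power_distance_le) (auto intro!: mult_nonneg_nonneg)
  finally show ?thesis by (simp add: mult_ac)
qed

text \<open>
  A sum of kernels with one node in each dyadic box: level \<open>n\<close> has \<open>2\<^sup>n\<close> nodes, equally spaced on the circle through \<open>v n\<close>.
\<close>
definition atom_sum :: "nat \<Rightarrow> nat \<Rightarrow> (nat \<Rightarrow> complex) \<Rightarrow> (nat \<Rightarrow> nat \<Rightarrow> complex) \<Rightarrow> complex \<Rightarrow> complex" where
  "atom_sum s L v a z = (if z \<in> unit_disc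
     then \<Sum>n<L. \<Sum>j<2^n. a n j / (1 - cnj (v n * root_of_one (2^n) j) * z) ^ s else 0)"

lemma kernel_nonzero: "cmod w \<le> 1 \<Longrightarrow> cmod z < 1 \<Longrightarrow> 1 - cnj w * z \<noteq> 0"
proof
  assume "cmod w \<le> 1" "cmod z < 1" "1 - cnj w * z = 0"
  then have "cmod (cnj w * z) = 1" by (metis norm_one right_minus_eq)
  then show False using \<open>cmod w \<le> 1\<close> \<open>cmod z < 1\<close>
    by (metis complex_mod_cnj mult_left_le_one_le norm_ge_zero norm_mult not_le)
qed

lemma atom_sum_disc_holo:
  assumes "\<And>n. cmod (v n) \<le> 1"
  shows "atom_sum s L v a \<in> disc_holo"
proof -
  have "(1 - cnj (v n * root_of_one (2^n) j) * z) ^ s \<noteq> 0" if "z \<in> unit_disc" for n j z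
    using kernel_nonzero[of "v n * root_of_one (2^n) j" z] assms[of n] that by (simp add: norm_mult)
  then show ?thesis
    unfolding atom_sum_def[abs_def] by (intro disc_holo_restrict holomorphic_intros) auto
qed

lemma circle_mean_sum:
  assumes "finite I" "\<And>i. i \<in> I \<Longrightarrow> continuous_on (cball 0 R) (u i)" "cmod z \<le> R"
  shows "circle_mean (\<lambda>w. \<Sum>i\<in>I. c i * u i w) z = (\<Sum>i\<in>I. c i * circle_mean (u i) z)"
  unfolding circle_mean_def
  by (subst integral_sum) (auto intro!: assms integrable_on_mult_right circle_mean_integrable)

text \<open>
  A Schur test. Jensen's inequality with weights \<open>g\<^sub>n = (b / 2\<^sup>t\<^sup>+\<^sup>2)\<^sup>n\<close> separates the coefficients from the kernels. The kernels
  enter through their sums over nodes (\<open>kernel_sum_le\<close>, \<open>level_sum_le\<close>) and their circle means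
  (\<open>kernel_circle_mean_le\<close>, \<open>tail_sum_le\<close>). The weight of the coefficient \<open>a n j\<close> in the bound is the order of magnitude of the
  \<open>p\<close>-th power of the norm of the kernel at its node.
\<close>
lemma atom_sum_bound:
  assumes h: "geometric_tail h" and p: "p > 1"
  shows "\<exists>t0. \<forall>t\<ge>t0. \<exists>C>0. \<forall>L v a. (\<forall>n. cmod (v n) \<le> dyadic_radius (n + 2)) \<longrightarrow>
     dyadic_sum p h (atom_sum (t + 2) L v a) \<le>
       ennreal (C * (\<Sum>n<L. \<Sum>j<2^n. cmod (a n j) powr p * ((2 ^ (n * (t + 2))) powr p / 2 ^ n * h n)))"
proof -
  have hp: "\<And>n. 0 < h n" using h by (auto simp: geometric_tail_def)
  obtain A where A: "A \<ge> 1" "\<And>n. h n \<le> A * h (Suc n)" using h by (auto simp: geometric_tail_def)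
  obtain B d where B: "B \<ge> 1" "0 < d" "d < 1" "\<And>n k. h (n + k) \<le> B * d ^ k * h n"
    using h by (auto simp: geometric_tail_def)
  \<comment> \<open>The growth rate of the test sequence: \<open>c\<close> has to be greater than \<open>1\<close>, and \<open>d c < 1\<close> has to hold.\<close>
  define c where "c = 1 / sqrt d"
  have c: "c > 1" "d * c = sqrt d"
    using B by (auto simp: c_def real_div_sqrt)
  define b where "b = c powr (1 / (p - 1))"
  have b: "b > 1" using c p by (simp add: b_def)
  have bc: "(b ^ m) powr (p - 1) = c ^ m" for m
    using b c p by (simp add: b_def powr_powr mult.commute flip: powr_realpow)
  define \<gamma> where "\<gamma> = max (sqrt d) (1 / 2)"
  have \<gamma>: "0 < \<gamma>" "\<gamma> < 1" "d * c \<le> \<gamma>" "1 / 2 \<le> \<gamma>" using B c by (auto simp: \<gamma>_def)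
  \<comment> \<open>The exponent of the kernel has to beat the test sequence and the growth of the tails towards the origin.\<close>
  obtain t0 where t0: "max (b\<^sup>2) (2 * A) < 2 ^ t0" using real_arch_pow[of 2 "max (b\<^sup>2) (2 * A)"] by auto
  have "\<exists>C>0. \<forall>L v a. (\<forall>n. cmod (v n) \<le> dyadic_radius (n + 2)) \<longrightarrow>
     dyadic_sum p h (atom_sum (t + 2) L v a) \<le>
       ennreal (C * (\<Sum>n<L. \<Sum>j<2^n. cmod (a n j) powr p * ((2 ^ (n * (t + 2))) powr p / 2 ^ n * h n)))"
    if t: "t \<ge> t0" for t
  proof -
    define s where "s = Suc t"
    have t0s: "(2::real) ^ t0 \<le> 2 ^ s" using t by (intro power_increasing) (auto simp: s_def)
    have bA: "b\<^sup>2 < 2 ^ t0" "2 * A < 2 ^ t0" using t0 by auto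
    have bs: "b\<^sup>2 \<le> 2 ^ s" using bA t0s by linarith
    have "A \<le> 2 ^ s * (1 / 2)" using bA t0s by linarith
    also have "\<dots> \<le> 2 ^ s * \<gamma>" using \<gamma> by (intro mult_left_mono) auto
    finally have As: "A \<le> 2 ^ s * \<gamma>" .
    define G where "G = 25 * 4 ^ s * (2 / (1 - 1 / b))"
    have G: "G > 0" using b by (simp add: G_def)
    define H where "H = B * (2 / (1 - \<gamma>))"
    have H: "H > 0" using B \<gamma> by (simp add: H_def)
    define C where "C = G powr (p - 1) * (5 * 4 ^ s) * H"
    have C: "C > 0" using G H by (simp add: C_def)
    have four: "(2 ^ (min n m + 2)) ^ s = (4::real) ^ s * (2 ^ min n m) ^ s" for n m
      by (simp add: power_add power_mult_distrib)
    have main: "dyadic_sum p h (atom_sum (t + 2) L v a) \<le>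
       ennreal (C * (\<Sum>n<L. \<Sum>j<2^n. cmod (a n j) powr p * ((2 ^ (n * (t + 2))) powr p / 2 ^ n * h n)))"
      if v: "\<And>n. cmod (v n) \<le> dyadic_radius (n + 2)" for L v a
    proof -
      define g where "g = (\<lambda>n. b ^ n / 2 ^ (n * Suc s))"
      have g: "g n > 0" for n using b by (simp add: g_def)
      define I where "I = Sigma {..<L} (\<lambda>n. {..<2^n} :: nat set)"
      have I: "finite I" by (simp add: I_def)
      define k where "k = (\<lambda>i z. 1 / cmod (1 - cnj (v (fst i) * root_of_one (2^fst i) (snd i)) * z) ^ (t + 2))"
      define E where "E = (\<lambda>i. g (fst i) * (cmod (a (fst i) (snd i)) / g (fst i)) powr p)"
      have E: "E i \<ge> 0" for i using g[of "fst i"] by (simp add: E_def less_imp_le)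
      have vv: "cmod (v n * root_of_one (2^n) j) \<le> dyadic_radius (n + 2)" for n j
        using v[of n] by (simp add: norm_mult)
      have v1: "cmod (v n) \<le> 1" for n using v[of n] dyadic_radius_bounds(2)[of "n + 2"] by simp
      define f where "f = atom_sum (t + 2) L v a"
      have fd: "f \<in> disc_holo" unfolding f_def by (rule atom_sum_disc_holo[OF v1])
      have level: "h m * pmean p f (dyadic_radius (Suc m)) \<le>
          G powr (p - 1) * (5 * 4 ^ s) * (\<Sum>i\<in>I. E i * (h m * c ^ m * (2 ^ min (fst i) m) ^ s))" for m
      proof -
        define R where "R = dyadic_radius (Suc m)"
        have R: "0 \<le> R" "R < 1" by (auto simp: R_def dyadic_radius_bounds)
        have kc: "continuous_on (cball 0 R) (k i)" for i
          unfolding k_def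
        proof (rule continuous_on_kernel)
          show "cmod (v (fst i) * root_of_one (2 ^ fst i) (snd i)) * R < 1"
            using R v1[of "fst i"] mult_left_le_one_le[of R "cmod (v (fst i))"] by (simp add: norm_mult)
        qed
        define V where "V = G * b ^ m"
        have V: "V > 0" using G b by (simp add: V_def)
        have pt: "cmod (f z) powr p \<le> (\<Sum>i\<in>I. (V powr (p - 1) * E i) * k i z)" if z: "cmod z = R" for z
        proof -
          have zd: "z \<in> unit_disc" using z R by simp
          have zm: "cmod z \<le> dyadic_radius (Suc m)" using z by (simp add: R_def)
          have k0: "k i z \<ge> 0" for i by (simp add: k_def)
          have "cmod (f z) = cmod (\<Sum>i\<in>I. a (fst i) (snd i) / (1 - cnj (v (fst i) * root_of_one (2^fst i) (snd i)) * z) ^ (t + 2))"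
            unfolding f_def atom_sum_def I_def using zd by (simp add: sum.Sigma case_prod_unfold)
          also have "\<dots> \<le> (\<Sum>i\<in>I. cmod (a (fst i) (snd i)) * k i z)"
            by (rule order_trans[OF norm_sum sum_mono])
               (simp only: norm_divide norm_power k_def times_divide_eq_right mult_1_right order_refl)
          also have "\<dots> = (\<Sum>i\<in>I. (k i z * g (fst i)) * (cmod (a (fst i) (snd i)) / g (fst i)))"
            using g by (intro sum.cong refl) (simp add: less_imp_neq[symmetric])
          finally have "cmod (f z) powr p \<le> (\<Sum>i\<in>I. (k i z * g (fst i)) * (cmod (a (fst i) (snd i)) / g (fst i))) powr p"
            using p by (intro powr_mono2) auto
          also have "\<dots> \<le> (\<Sum>i\<in>I. k i z * g (fst i)) powr (p - 1) * (\<Sum>i\<in>I. (k i z * g (fst i)) * (cmod (a (fst i) (snd i)) / g (fst i)) powr p)"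
            by (intro weighted_power_mean p mult_nonneg_nonneg divide_nonneg_nonneg k0 norm_ge_zero less_imp_le[OF g])
          also have "\<dots> \<le> V powr (p - 1) * (\<Sum>i\<in>I. (k i z * g (fst i)) * (cmod (a (fst i) (snd i)) / g (fst i)) powr p)"
          proof (intro mult_right_mono powr_mono2)
            have "(\<Sum>i\<in>I. k i z * g (fst i)) = (\<Sum>n<L. \<Sum>j<2^n. k (n, j) z * g n)"
              unfolding I_def by (simp add: sum.Sigma case_prod_unfold)
            also have "\<dots> = (\<Sum>n<L. g n * (\<Sum>j<2^n. 1 / cmod (1 - cnj (v n * root_of_one (2^n) j) * z) ^ (t + 2)))"
              by (simp add: sum_distrib_left k_def mult.commute)
            also have "\<dots> \<le> (\<Sum>n<L. g n * (25 * 2 ^ n * (2 ^ (min n m + 2)) ^ Suc t))"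
              using g v zm by (intro sum_mono mult_left_mono kernel_sum_le) (auto intro: less_imp_le)
            also have "\<dots> = 25 * 4 ^ s * (\<Sum>n<L. 2 ^ n * (b ^ n / 2 ^ (n * Suc s)) * (2 ^ min n m) ^ s)"
              unfolding s_def[symmetric] four g_def by (simp add: sum_distrib_left mult_ac)
            also have "\<dots> \<le> 25 * 4 ^ s * (b ^ m * (2 / (1 - 1 / b)))"
              by (intro mult_left_mono level_sum_le b bs) auto
            finally show "(\<Sum>i\<in>I. k i z * g (fst i)) \<le> V" by (simp add: V_def G_def mult_ac)
            show "0 \<le> (\<Sum>i\<in>I. k i z * g (fst i))" using g k0 by (intro sum_nonneg mult_nonneg_nonneg) (auto intro: less_imp_le)
            show "0 \<le> (\<Sum>i\<in>I. (k i z * g (fst i)) * (cmod (a (fst i) (snd i)) / g (fst i)) powr p)"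
              using g k0 by (intro sum_nonneg mult_nonneg_nonneg) (auto intro: less_imp_le)
          qed (use p in auto)
          also have "\<dots> = (\<Sum>i\<in>I. (V powr (p - 1) * E i) * k i z)"
            by (simp add: sum_distrib_left E_def mult_ac)
          finally show ?thesis .
        qed
        have "pmean p f R \<le> circle_mean (\<lambda>z. \<Sum>i\<in>I. (V powr (p - 1) * E i) * k i z) (of_real R)"
        proof (rule circle_mean_mono_fun[where R = R])
          show "continuous_on (cball 0 R) (\<lambda>z. cmod (f z) powr p)"
            using fd R p by (intro continuous_powr_holo) (auto simp: disc_holo_def)
          show "continuous_on (cball 0 R) (\<lambda>z. \<Sum>i\<in>I. (V powr (p - 1) * E i) * k i z)"
            by (intro continuous_on_sum continuous_on_mult_left kc)
          show "cmod (complex_of_real R) \<le> R" using R by simp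
          fix z assume "cmod z = cmod (complex_of_real R)"
          then have "cmod z = R" using R by simp
          then show "cmod (f z) powr p \<le> (\<Sum>i\<in>I. (V powr (p - 1) * E i) * k i z)" by (rule pt)
        qed
        also have "\<dots> = (\<Sum>i\<in>I. (V powr (p - 1) * E i) * circle_mean (k i) (of_real R))"
          using R by (intro circle_mean_sum[where R = R] I kc) simp
        also have "\<dots> \<le> (\<Sum>i\<in>I. (V powr (p - 1) * E i) * (5 * (2 ^ (min (fst i) m + 2)) ^ Suc t))"
          unfolding k_def R_def using E by (intro sum_mono mult_left_mono kernel_circle_mean_le vv) simp
        also have "\<dots> = V powr (p - 1) * (5 * 4 ^ s) * (\<Sum>i\<in>I. E i * (2 ^ min (fst i) m) ^ s)"
          unfolding s_def[symmetric] four by (simp add: sum_distrib_left mult_ac)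
        also have "V powr (p - 1) = G powr (p - 1) * c ^ m"
          using G b by (simp add: V_def powr_mult bc)
        finally have "h m * pmean p f R \<le> h m * (G powr (p - 1) * c ^ m * (5 * 4 ^ s) * (\<Sum>i\<in>I. E i * (2 ^ min (fst i) m) ^ s))"
          using hp[of m] by (intro mult_left_mono) auto
        also have "\<dots> = G powr (p - 1) * (5 * 4 ^ s) * (\<Sum>i\<in>I. E i * (h m * c ^ m * (2 ^ min (fst i) m) ^ s))"
          by (simp add: sum_distrib_left mult_ac)
        finally show ?thesis by (simp add: R_def)
      qed
      have "dyadic_sum p h f \<le> ennreal (G powr (p - 1) * (5 * 4 ^ s) * (\<Sum>i\<in>I. E i * (H * (h (fst i) * c ^ fst i * (2 ^ fst i) ^ s))))"
        unfolding dyadic_sum_def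
      proof (rule suminf_le_const[OF summableI])
        fix M
        have nn: "0 \<le> h m * pmean p f (dyadic_radius (Suc m))" for m
          using hp[of m] by (intro mult_nonneg_nonneg circle_mean_nonneg) auto
        have "(\<Sum>m<M. h m * pmean p f (dyadic_radius (Suc m)))
           \<le> (\<Sum>m<M. G powr (p - 1) * (5 * 4 ^ s) * (\<Sum>i\<in>I. E i * (h m * c ^ m * (2 ^ min (fst i) m) ^ s)))"
          by (intro sum_mono level)
        also have "\<dots> = G powr (p - 1) * (5 * 4 ^ s) * (\<Sum>i\<in>I. E i * (\<Sum>m<M. h m * c ^ m * (2 ^ min (fst i) m) ^ s))"
          unfolding sum_distrib_left[symmetric] by (subst sum.swap) (simp add: sum_distrib_left)
        also have "\<dots> \<le> G powr (p - 1) * (5 * 4 ^ s) * (\<Sum>i\<in>I. E i * (H * (h (fst i) * c ^ fst i * (2 ^ fst i) ^ s)))"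
          unfolding H_def using E c \<gamma> A B hp
          by (intro mult_left_mono sum_mono tail_sum_le[where A = A and d = d] As) auto
        finally have "(\<Sum>m<M. h m * pmean p f (dyadic_radius (Suc m))) \<le> G powr (p - 1) * (5 * 4 ^ s) * (\<Sum>i\<in>I. E i * (H * (h (fst i) * c ^ fst i * (2 ^ fst i) ^ s)))" .
        then show "(\<Sum>m<M. ennreal (h m * pmean p f (dyadic_radius (Suc m)))) \<le> ennreal (G powr (p - 1) * (5 * 4 ^ s) * (\<Sum>i\<in>I. E i * (H * (h (fst i) * c ^ fst i * (2 ^ fst i) ^ s))))"
          using nn by (simp add: sum_ennreal ennreal_leI)
      qed
      also have "G powr (p - 1) * (5 * 4 ^ s) * (\<Sum>i\<in>I. E i * (H * (h (fst i) * c ^ fst i * (2 ^ fst i) ^ s)))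
         = C * (\<Sum>i\<in>I. E i * (h (fst i) * c ^ fst i * (2 ^ fst i) ^ s))"
        by (simp add: C_def sum_distrib_left mult_ac)
      also have "(\<Sum>i\<in>I. E i * (h (fst i) * c ^ fst i * (2 ^ fst i) ^ s))
         = (\<Sum>n<L. \<Sum>j<2^n. E (n, j) * (h n * c ^ n * (2 ^ n) ^ s))"
        unfolding I_def by (simp add: sum.Sigma case_prod_unfold)
      also have "\<dots> = (\<Sum>n<L. \<Sum>j<2^n. cmod (a n j) powr p * ((2 ^ (n * (t + 2))) powr p / 2 ^ n * h n))"
      proof (intro sum.cong refl)
        fix n j
        define y :: real where "y = 2 ^ (n * Suc s)"
        have y: "y > 0" by (simp add: y_def)
        have bn: "b ^ n > 0" using b by simp
        have "g n * (cmod (a n j) / g n) powr p = cmod (a n j) powr p * g n powr (1 - p)"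
          using g[of n] by (simp add: powr_divide powr_diff)
        also have "g n powr (1 - p) = y powr (p - 1) / c ^ n"
        proof -
          have "g n powr (1 - p) = (b ^ n) powr (1 - p) / y powr (1 - p)"
            unfolding g_def y_def[symmetric] by (rule powr_divide)
          also have "(b ^ n) powr (1 - p) = 1 / c ^ n"
            using powr_minus[of "b ^ n" "p - 1"] by (simp add: bc inverse_eq_divide)
          also have "y powr (1 - p) = 1 / y powr (p - 1)"
            using powr_minus[of y "p - 1"] by (simp add: inverse_eq_divide)
          finally show ?thesis by simp
        qed
        finally have "E (n, j) * (h n * c ^ n * (2 ^ n) ^ s) = cmod (a n j) powr p * (y powr (p - 1) * (2 ^ n) ^ s * h n)"
          using c by (simp add: E_def)
        also have "y powr (p - 1) * (2 ^ n) ^ s = y powr p / 2 ^ n"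
        proof -
          have "y = 2 ^ n * (2 ^ n) ^ s" by (simp add: y_def power_add power_mult)
          then show ?thesis using y by (simp add: powr_diff)
        qed
        finally show "E (n, j) * (h n * c ^ n * (2 ^ n) ^ s) = cmod (a n j) powr p * ((2 ^ (n * (t + 2))) powr p / 2 ^ n * h n)"
          by (simp add: y_def s_def)
      qed
      finally show ?thesis by (simp add: f_def)
    qed
    then show ?thesis using C by blast
  qed
  then show ?thesis by blast
qed

section \<open>Quadrature for the reproducing formula\<close>

lemma negative_binomial_sums:
  fixes u :: complex
  assumes "cmod u < 1"
  shows "(\<lambda>l. of_nat ((K + l) choose l) * u ^ l) sums (1 / (1 - u) ^ Suc K)"
  using assms
proof (induction K arbitrary: u)
  case 0
  then show ?case using geometric_sums[of u] by simp
next
  case (Suc K)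
  obtain x where x: "cmod u < x" "x < 1" using dense[OF Suc.prems] by blast
  have "0 < x" using x norm_ge_zero[of u] by linarith
  then have xc: "cmod (of_real x) = x" by simp
  have s1: "summable (\<lambda>l. cmod (of_nat ((K + l) choose l) * u ^ l))"
    by (rule powser_insidea[OF sums_summable[OF Suc.IH[of "of_real x"]]]) (use x xc in auto)
  have s2: "summable (\<lambda>l. cmod (u ^ l))" using Suc.prems by (simp add: norm_power summable_geometric)
  have "(\<lambda>k. \<Sum>i\<le>k. (of_nat ((K + i) choose i) * u ^ i) * u ^ (k - i)) sums
       ((\<Sum>l. of_nat ((K + l) choose l) * u ^ l) * (\<Sum>l. u ^ l))"
    by (rule Cauchy_product_sums[OF s1 s2])
  moreover have "(\<Sum>i\<le>k. (of_nat ((K + i) choose i) * u ^ i) * u ^ (k - i)) = of_nat ((Suc K + k) choose k) * u ^ k" for k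
  proof -
    have "(\<Sum>i\<le>k. (of_nat ((K + i) choose i) * u ^ i) * u ^ (k - i)) = (\<Sum>i\<le>k. of_nat ((K + i) choose i) * u ^ k)"
      by (intro sum.cong refl) (simp add: mult.assoc flip: power_add)
    also have "\<dots> = of_nat (\<Sum>i\<le>k. (K + i) choose i) * u ^ k" by (simp add: sum_distrib_right)
    also have "(\<Sum>i\<le>k. (K + i) choose i) = Suc (K + k) choose k" by (rule sum_choose_lower)
    finally show ?thesis by simp
  qed
  moreover have "(\<Sum>l. of_nat ((K + l) choose l) * u ^ l) * (\<Sum>l. u ^ l) = 1 / (1 - u) ^ Suc (Suc K)"
    unfolding sums_unique[OF Suc.IH[OF Suc.prems], symmetric] sums_unique[OF geometric_sums[OF Suc.prems], symmetric]
    by simp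
  ultimately show ?case by simp
qed

lemma beta_integral_nat:
  "((\<lambda>x::real. x ^ k * (1 - x) ^ M) has_integral (fact k * fact M / fact (k + M + 1))) {0..1}"
proof (induction M arbitrary: k)
  case 0
  have e: "(x ^ k + real k * x ^ (k - Suc 0) * x) / real (Suc k) = x ^ k" for x :: real
    by (cases k) (simp_all add: field_simps)
  have "((\<lambda>x::real. x ^ k) has_integral (1 ^ Suc k / Suc k - 0 ^ Suc k / Suc k)) {0..1}"
    by (intro fundamental_theorem_of_calculus)
       (auto intro!: derivative_eq_intros e simp flip: has_real_derivative_iff_has_vector_derivative simp del: of_nat_Suc)
  then show ?case by (simp add: fact_reduce[of "Suc k"] divide_simps)
next
  case (Suc M)
  have "((\<lambda>x::real. x ^ k * (1 - x) ^ M - x ^ Suc k * (1 - x) ^ M) has_integral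
     (fact k * fact M / fact (k + M + 1) - fact (Suc k) * fact M / fact (Suc k + M + 1))) {0..1}"
    by (intro has_integral_diff Suc.IH)
  moreover have "x ^ k * (1 - x) ^ M - x ^ Suc k * (1 - x) ^ M = x ^ k * (1 - x) ^ Suc M" for x :: real
    by (simp add: algebra_simps)
  moreover have "fact k * fact M / fact (k + M + 1) - fact (Suc k) * fact M / fact (Suc k + M + 1)
      = (fact k * fact (Suc M) / fact (k + Suc M + 1) :: real)"
  proof -
    have h: "fact (k + M + 1) * (real k + real M + 2) = (fact (Suc k + M + 1) :: real)"
      by (simp add: algebra_simps)
    then have "fact k * fact M / fact (k + M + 1) = (fact k * fact M * (real k + real M + 2) / fact (Suc k + M + 1) :: real)"
    proof -
      have "real k + real M + 2 \<noteq> 0" by linarith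
      then have "fact k * fact M / fact (k + M + 1) = (fact k * fact M * (real k + real M + 2)) / (fact (k + M + 1) * (real k + real M + 2))"
        by simp
      with h show ?thesis by (simp only:)
    qed
    then show ?thesis by (simp add: diff_divide_distrib[symmetric] algebra_simps)
  qed
  ultimately show ?case by (simp only:)
qed

text \<open>
  The radial integral of a monomial against \<open>(M + 1) (1 - x)\<^sup>M\<close> is the reciprocal of the corresponding Taylor coefficient of the kernel
  of exponent \<open>M + 2\<close>: this is the reproducing property.
\<close>
lemma reproducing_constant:
  "(real M + 1) * real ((M + 1 + k) choose k) * (fact k * fact M / fact (k + M + 1)) = 1"
proof -
  have "real ((M + 1 + k) choose k) = fact (M + 1 + k) / (fact k * fact (M + 1))"
    by (simp add: binomial_fact)
  then show ?thesis by (simp add: add_ac)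
qed

lemma riemann_sum_tendsto:
  fixes g :: "real \<Rightarrow> real"
  assumes g: "continuous_on {0..1} g"
  shows "(\<lambda>N. (\<Sum>j<N. g (real j / real N)) / real N) \<longlonglongrightarrow> integral {0..1} g"
proof (rule LIMSEQ_I)
  fix e :: real assume e: "e > 0"
  obtain d where d: "d > 0" "\<And>x y. x \<in> {0..1} \<Longrightarrow> y \<in> {0..1} \<Longrightarrow> dist x y < d \<Longrightarrow> dist (g x) (g y) < e / 2"
    using compact_uniformly_continuous[OF g compact_Icc] e unfolding uniformly_continuous_on_def
    by (metis half_gt_zero)
  obtain N0 :: nat where N0: "real N0 > 1 / d" using reals_Archimedean2 by blast
  have "norm ((\<Sum>j<N. g (real j / real N)) / real N - integral {0..1} g) < e" if N: "N \<ge> Suc N0" for N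
  proof -
    have Np: "real N > 0" "1 / d < real N" using N N0 by auto
    then have sm: "1 / real N < d" using d by (simp add: field_simps)
    have "\<bar>integral {0..1} g - (\<Sum>j<N. g (real j / real N)) / real N\<bar> \<le> e / 2"
    proof (rule riemann_sum_close[OF integrable_continuous_real[OF g]])
      show "N > 0" using N by simp
      fix j t assume j: "j < N" and t: "real j / N \<le> t" "t \<le> (real j + 1) / N"
      have "(real j + 1) / N \<le> 1" using j Np by (simp add: field_simps)
      moreover have "0 \<le> real j / N" by simp
      moreover from this have "0 \<le> t" using t(1) by (rule order_trans)
      moreover have "dist t (real j / N) < d" using t sm by (simp add: dist_real_def add_divide_distrib)
      ultimately have "dist (g t) (g (real j / N)) < e / 2" using t by (intro d(2)) auto
      then show "\<bar>g t - g (real j / real N)\<bar> \<le> e / 2" by (simp add: dist_real_def)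
    qed
    then show ?thesis using e by (simp add: abs_minus_commute)
  qed
  then show "\<exists>M. \<forall>N\<ge>M. norm ((\<Sum>j<N. g (real j / real N)) / real N - integral {0..1} g) < e" by blast
qed

text \<open>
  The nodes are equally spaced in the square of the modulus: on \<open>[r\<^sub>n, r\<^sub>n\<^sub>+\<^sub>1)\<close> there are \<open>R\<close> of them, and \<open>radial_coeff\<close> is the
  step length times the density \<open>(M + 1) (1 - x)\<^sup>M\<close>.
\<close>
definition radial_node :: "nat \<Rightarrow> nat \<Rightarrow> nat \<Rightarrow> real" where
  "radial_node R n i = dyadic_radius n + (real i / real R) / 2 ^ Suc n"

definition radial_coeff :: "nat \<Rightarrow> nat \<Rightarrow> nat \<Rightarrow> nat \<Rightarrow> real" where
  "radial_coeff M R n i = (real M + 1) * (1 - radial_node R n i) ^ M / (2 ^ Suc n * real R)"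

lemma dyadic_radius_Suc: "dyadic_radius (Suc n) = dyadic_radius n + 1 / 2 ^ Suc n"
  by (simp add: dyadic_radius_def field_simps)

lemma radial_node_bounds:
  assumes "i < R"
  shows "dyadic_radius n \<le> radial_node R n i" "radial_node R n i \<le> dyadic_radius (Suc n)"
proof -
  have "(real i / real R) / 2 ^ Suc n \<le> 1 / 2 ^ Suc n" using assms by (intro divide_right_mono) auto
  then show "radial_node R n i \<le> dyadic_radius (Suc n)" by (simp add: radial_node_def dyadic_radius_Suc del: power_Suc)
qed (simp add: radial_node_def)

lemma radial_quadrature:
  fixes G :: "real \<Rightarrow> real"
  assumes G: "continuous_on UNIV G"
  shows "(\<lambda>R. \<Sum>n<L. \<Sum>i<R. G (radial_node R n i) / (2 ^ Suc n * real R)) \<longlonglongrightarrow> integral {0..dyadic_radius L} G"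
proof -
  \<comment> \<open>Starting at \<open>-1\<close> makes \<open>P\<close> an antiderivative on a neighbourhood of \<open>[0, 1]\<close>.\<close>
  define P where "P = (\<lambda>x. integral {-1..x} G)"
  have Gc: "continuous_on S G" for S by (rule continuous_on_subset[OF G]) simp
  have P: "(P has_real_derivative G x) (at x)" if "-1 < x" "x < 2" for x
    using integral_has_real_derivative[OF Gc, of x "-1" 2] that
    unfolding P_def by (simp add: at_within_Icc_at)
  have one: "(\<lambda>R. \<Sum>i<R. G (radial_node R n i) / (2 ^ Suc n * real R)) \<longlonglongrightarrow> P (dyadic_radius (Suc n)) - P (dyadic_radius n)" for n
  proof -
    define g where "g = (\<lambda>x. G (dyadic_radius n + x / 2 ^ Suc n) / 2 ^ Suc n)"
    have gc: "continuous_on {0..1} g" unfolding g_def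
      by (intro continuous_intros continuous_on_compose2[OF G]) auto
    have "(g has_integral (P (dyadic_radius n + 1 / 2 ^ Suc n) - P (dyadic_radius n + 0 / 2 ^ Suc n))) {0..1}"
    proof (rule fundamental_theorem_of_calculus)
      fix x :: real assume x: "x \<in> {0..1}"
      have "0 \<le> x / 2 ^ Suc n" "x / 2 ^ Suc n \<le> 1 / 2 ^ Suc n" using x by (auto intro: divide_right_mono)
      then have b: "-1 < dyadic_radius n + x / 2 ^ Suc n" "dyadic_radius n + x / 2 ^ Suc n < 2"
        using dyadic_radius_bounds[of n] dyadic_radius_bounds[of "Suc n"] unfolding dyadic_radius_Suc by linarith+
      have "((\<lambda>x. P (dyadic_radius n + x / 2 ^ Suc n)) has_real_derivative (G (dyadic_radius n + x / 2 ^ Suc n) * (1 / 2 ^ Suc n))) (at x)"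
        by (rule DERIV_chain2[where f = P and g = "\<lambda>x. dyadic_radius n + x / 2 ^ Suc n", OF P[OF b]]) (auto intro!: derivative_eq_intros)
      then show "((\<lambda>x. P (dyadic_radius n + x / 2 ^ Suc n)) has_vector_derivative g x) (at x within {0..1})"
        by (auto simp: g_def simp flip: has_real_derivative_iff_has_vector_derivative intro: has_field_derivative_at_within)
    qed simp
    then have ig: "integral {0..1} g = P (dyadic_radius (Suc n)) - P (dyadic_radius n)"
      by (simp add: integral_unique dyadic_radius_Suc del: power_Suc)
    show ?thesis
      using riemann_sum_tendsto[OF gc] unfolding ig
      by (simp add: g_def radial_node_def sum_divide_distrib divide_divide_eq_left del: power_Suc)
  qed
  have "(\<lambda>R. \<Sum>n<L. \<Sum>i<R. G (radial_node R n i) / (2 ^ Suc n * real R)) \<longlonglongrightarrow> (\<Sum>n<L. P (dyadic_radius (Suc n)) - P (dyadic_radius n))"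
    by (intro tendsto_sum one)
  also have "(\<Sum>n<L. P (dyadic_radius (Suc n)) - P (dyadic_radius n)) = P (dyadic_radius L) - P (dyadic_radius 0)"
    by (rule sum_lessThan_telescope)
  also have "\<dots> = integral {0..dyadic_radius L} G"
  proof -
    have "P 0 + integral {0..dyadic_radius L} G = P (dyadic_radius L)"
      unfolding P_def using dyadic_radius_bounds[of L]
      by (intro Henstock_Kurzweil_Integration.integral_combine integrable_continuous_real Gc) auto
    then show ?thesis by (simp add: dyadic_radius_def)
  qed
  finally show ?thesis .
qed

lemma radial_reproducing:
  assumes e: "e > 0"
  shows "\<exists>L>0. \<exists>R0. \<forall>R\<ge>R0. \<forall>k<N. \<bar>(\<Sum>n<L. \<Sum>i<R. radial_coeff M R n i *
     (real ((M + 1 + k) choose k) * radial_node R n i ^ k)) - 1\<bar> < e"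
proof -
  define G where "G = (\<lambda>k x. (real M + 1) * real ((M + 1 + k) choose k) * (x ^ k * (1 - x) ^ M))"
  have Gc: "continuous_on S (G k)" for S k unfolding G_def by (intro continuous_intros)
  have I1: "integral {0..1} (G k) = 1" for k
    unfolding G_def using integral_unique[OF has_integral_mult_right[OF beta_integral_nat[of k M]]] reproducing_constant[of M k]
    by simp
  have Y: "(\<lambda>L. integral {0..dyadic_radius L} (G k)) \<longlonglongrightarrow> 1" for k
  proof -
    have c: "continuous_on {0..1} (\<lambda>x. integral {0..x} (G k))"
      by (rule indefinite_integral_continuous_1) (intro integrable_continuous_real Gc)
    have "(\<lambda>L. (1/2 :: real) ^ L) \<longlonglongrightarrow> 0" by (rule LIMSEQ_realpow_zero) simp_all
    then have "(\<lambda>L. 1 - (1/2 :: real) ^ L) \<longlonglongrightarrow> 1 - 0" by (intro tendsto_diff tendsto_const)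
    then have "dyadic_radius \<longlonglongrightarrow> 1" by (simp add: dyadic_radius_def[abs_def] power_one_over)
    from continuous_on_tendsto_compose[OF c this] show ?thesis
      using dyadic_radius_bounds by (simp add: I1 less_imp_le)
  qed
  have "\<forall>\<^sub>F L in sequentially. \<forall>k\<in>{..<N}. \<bar>integral {0..dyadic_radius L} (G k) - 1\<bar> < e / 2"
  proof (intro eventually_ball_finite ballI)
    show "\<forall>\<^sub>F L in sequentially. \<bar>integral {0..dyadic_radius L} (G k) - 1\<bar> < e / 2" for k
      using tendstoD[OF Y[of k], of "e / 2"] e by (simp add: dist_real_def)
  qed simp
  then have "\<forall>\<^sub>F L in sequentially. L > 0 \<and> (\<forall>k\<in>{..<N}. \<bar>integral {0..dyadic_radius L} (G k) - 1\<bar> < e / 2)"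
    using eventually_gt_at_top[of "0::nat"] by eventually_elim auto
  then obtain L where L: "L > 0" "\<And>k. k < N \<Longrightarrow> \<bar>integral {0..dyadic_radius L} (G k) - 1\<bar> < e / 2"
    unfolding eventually_sequentially by (metis lessThan_iff order_refl)
  have X: "(\<lambda>R. \<Sum>n<L. \<Sum>i<R. radial_coeff M R n i *
     (real ((M + 1 + k) choose k) * radial_node R n i ^ k)) \<longlonglongrightarrow> integral {0..dyadic_radius L} (G k)" for k
  proof -
    have "radial_coeff M R n i * (real ((M + 1 + k) choose k) * radial_node R n i ^ k)
        = G k (radial_node R n i) / (2 ^ Suc n * real R)" for R n i
      unfolding radial_coeff_def G_def by (simp only: times_divide_eq_left times_divide_eq_right mult_ac)
    then show ?thesis using radial_quadrature[OF Gc[of UNIV k], of L] by (simp only:)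
  qed
  have "\<forall>\<^sub>F R in sequentially. \<forall>k\<in>{..<N}. \<bar>(\<Sum>n<L. \<Sum>i<R. radial_coeff M R n i *
     (real ((M + 1 + k) choose k) * radial_node R n i ^ k)) - integral {0..dyadic_radius L} (G k)\<bar> < e / 2"
  proof (intro eventually_ball_finite ballI)
    show "\<forall>\<^sub>F R in sequentially. \<bar>(\<Sum>n<L. \<Sum>i<R. radial_coeff M R n i *
       (real ((M + 1 + k) choose k) * radial_node R n i ^ k)) - integral {0..dyadic_radius L} (G k)\<bar> < e / 2" for k
      using tendstoD[OF X[of k], of "e / 2"] e unfolding dist_real_def by simp
  qed simp
  then obtain R0 where R0: "\<forall>R\<ge>R0. \<forall>k\<in>{..<N}. \<bar>(\<Sum>n<L. \<Sum>i<R. radial_coeff M R n i *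
     (real ((M + 1 + k) choose k) * radial_node R n i ^ k)) - integral {0..dyadic_radius L} (G k)\<bar> < e / 2"
    unfolding eventually_sequentially by blast
  have "\<bar>(\<Sum>n<L. \<Sum>i<R. radial_coeff M R n i *
     (real ((M + 1 + k) choose k) * radial_node R n i ^ k)) - 1\<bar> < e" if "R \<ge> R0" "k < N" for R k
  proof -
    have "\<bar>(\<Sum>n<L. \<Sum>i<R. radial_coeff M R n i *
      (real ((M + 1 + k) choose k) * radial_node R n i ^ k)) - integral {0..dyadic_radius L} (G k)\<bar> < e / 2"
      using R0 that by blast
    then show ?thesis using L(2)[OF that(2)] by linarith
  qed
  then show ?thesis using L(1) by blast
qed

text \<open>
  Split the Taylor series of the kernel after \<open>N\<close> terms. By orthogonality of the roots of unity the first part is integrated without error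
  once \<open>N\<close> exceeds the number of coefficients; the tail is small uniformly in \<open>z\<close>, as \<open>r < 1\<close>.
\<close>
lemma angular_quadrature:
  fixes c :: "nat \<Rightarrow> complex"
  assumes r: "0 \<le> r" "r < 1" and e: "e > 0"
  shows "\<exists>N1>0. \<forall>N\<ge>N1. \<forall>z\<in>unit_disc.
    cmod ((\<Sum>m<N. disc_poly c d (of_real r * root_of_one N m) / (1 - cnj (of_real r * root_of_one N m) * z) ^ Suc K) / of_nat N
      - (\<Sum>k<d. c k * (of_nat ((K + k) choose k) * of_real r ^ (2 * k) * z ^ k))) \<le> e"
proof -
  define a where "a = (\<lambda>l. of_nat ((K + l) choose l) :: complex)"
  obtain x where x: "r < x" "x < 1" using dense[OF r(2)] by blast
  have sn: "summable (\<lambda>l. cmod (a l * of_real r ^ l))"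
    unfolding a_def by (rule powser_insidea[OF sums_summable[OF negative_binomial_sums[of "of_real x"]]]) (use x r in auto)
  define B where "B = (\<Sum>k<d. cmod (c k))"
  have B: "B \<ge> 0" by (auto simp: B_def intro: sum_nonneg)
  have "(\<lambda>N. \<Sum>l. cmod (a (l + N) * of_real r ^ (l + N))) \<longlonglongrightarrow> 0" by (rule suminf_exist_split2[OF sn])
  then have "\<forall>\<^sub>F N in sequentially. (\<Sum>l. cmod (a (l + N) * of_real r ^ (l + N))) < e / (B + 1)"
    by (rule order_tendstoD) (use e B in simp)
  then obtain N2 where N2: "\<And>N. N \<ge> N2 \<Longrightarrow> (\<Sum>l. cmod (a (l + N) * of_real r ^ (l + N))) < e / (B + 1)"
    by (auto simp: eventually_sequentially)
  have "cmod ((\<Sum>m<N. disc_poly c d (of_real r * root_of_one N m) / (1 - cnj (of_real r * root_of_one N m) * z) ^ Suc K) / of_nat N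
      - (\<Sum>k<d. c k * (of_nat ((K + k) choose k) * of_real r ^ (2 * k) * z ^ k))) \<le> e"
    if N: "N \<ge> max (Suc d) N2" and z: "z \<in> unit_disc" for N z
  proof -
    have Np: "N > 0" and dN: "d < N" using N by auto
    let ?\<zeta> = "root_of_one N"
    define tl where "tl = (\<lambda>m. \<Sum>l. a (l + N) * (of_real r * cnj (?\<zeta> m) * z) ^ (l + N))"
    define \<tau> where "\<tau> = (\<Sum>l. cmod (a (l + N) * of_real r ^ (l + N)))"
    have ker: "1 / (1 - cnj (of_real r * ?\<zeta> m) * z) ^ Suc K = (\<Sum>l<N. a l * (of_real r * cnj (?\<zeta> m) * z) ^ l) + tl m"
      and tail: "cmod (tl m) \<le> \<tau>" for m
    proof -
      have u: "cmod (of_real r * cnj (?\<zeta> m) * z) \<le> r" using z r by (simp add: norm_mult mult_left_le)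
      then have s: "(\<lambda>l. a l * (of_real r * cnj (?\<zeta> m) * z) ^ l) sums (1 / (1 - of_real r * cnj (?\<zeta> m) * z) ^ Suc K)"
        unfolding a_def by (intro negative_binomial_sums) (use r in simp)
      then show "1 / (1 - cnj (of_real r * ?\<zeta> m) * z) ^ Suc K = (\<Sum>l<N. a l * (of_real r * cnj (?\<zeta> m) * z) ^ l) + tl m"
        using suminf_split_initial_segment[OF sums_summable[OF s], of N] sums_unique[OF s]
        by (simp add: tl_def del: power_Suc)
      show "cmod (tl m) \<le> \<tau>"
        unfolding tl_def \<tau>_def
      proof (rule norm_suminf_le)
        fix l
        have "cmod (of_real r * cnj (?\<zeta> m) * z) ^ (l + N) \<le> r ^ (l + N)" using u by (intro power_mono) auto
        then show "cmod (a (l + N) * (of_real r * cnj (?\<zeta> m) * z) ^ (l + N)) \<le> cmod (a (l + N) * of_real r ^ (l + N))"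
          using r by (simp only: norm_mult norm_power norm_of_real abs_of_nonneg) (auto intro: mult_left_mono)
        show "summable (\<lambda>l. cmod (a (l + N) * of_real r ^ (l + N)))"
          using sn by (rule summable_ignore_initial_segment)
      qed
    qed
    have fv: "disc_poly c d (of_real r * ?\<zeta> m) = (\<Sum>k<d. c k * (of_real r * ?\<zeta> m) ^ k)" for m
      using r by (simp add: disc_poly_def norm_mult)
    have fb: "cmod (disc_poly c d (of_real r * ?\<zeta> m)) \<le> B" for m
    proof -
      have "cmod (c k * (of_real r * ?\<zeta> m) ^ k) \<le> cmod (c k)" for k
        using r by (simp add: norm_mult norm_power mult_left_le power_le_one)
      then show ?thesis unfolding fv B_def by (intro order_trans[OF norm_sum sum_mono])
    qed
    have main: "(\<Sum>m<N. disc_poly c d (of_real r * ?\<zeta> m) * (\<Sum>l<N. a l * (of_real r * cnj (?\<zeta> m) * z) ^ l))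
        = of_nat N * (\<Sum>k<d. c k * (a k * of_real r ^ (2 * k) * z ^ k))"
    proof -
      have "(\<Sum>m<N. disc_poly c d (of_real r * ?\<zeta> m) * (\<Sum>l<N. a l * (of_real r * cnj (?\<zeta> m) * z) ^ l))
         = (\<Sum>m<N. \<Sum>k<d. \<Sum>l<N. (c k * of_real r ^ k * (a l * of_real r ^ l * z ^ l)) * (?\<zeta> m ^ k * cnj (?\<zeta> m) ^ l))"
        unfolding fv by (subst sum_product) (simp add: power_mult_distrib mult_ac)
      also have "\<dots> = (\<Sum>k<d. \<Sum>m<N. \<Sum>l<N. (c k * of_real r ^ k * (a l * of_real r ^ l * z ^ l)) * (?\<zeta> m ^ k * cnj (?\<zeta> m) ^ l))"
        by (rule sum.swap)
      also have "\<dots> = (\<Sum>k<d. \<Sum>l<N. \<Sum>m<N. (c k * of_real r ^ k * (a l * of_real r ^ l * z ^ l)) * (?\<zeta> m ^ k * cnj (?\<zeta> m) ^ l))"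
        by (intro sum.cong refl sum.swap)
      also have "\<dots> = (\<Sum>k<d. \<Sum>l<N. if k = l then (c k * of_real r ^ k * (a k * of_real r ^ k * z ^ k)) * of_nat N else 0)"
        unfolding sum_distrib_left[symmetric] root_of_one_orthogonal[OF Np]
        using dN by (intro sum.cong refl) auto
      also have "\<dots> = (\<Sum>k<d. (c k * of_real r ^ k * (a k * of_real r ^ k * z ^ k)) * of_nat N)"
        using dN by (intro sum.cong refl) simp
      also have "\<dots> = of_nat N * (\<Sum>k<d. c k * (a k * of_real r ^ (2 * k) * z ^ k))"
      proof -
        have p2: "complex_of_real r ^ (2 * k) = of_real r ^ k * of_real r ^ k" for k
          by (simp add: mult_2 power_add)
        show ?thesis unfolding p2 sum_distrib_left by (intro sum.cong refl) (simp add: mult_ac)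
      qed
      finally show ?thesis .
    qed
    have "(\<Sum>m<N. disc_poly c d (of_real r * ?\<zeta> m) / (1 - cnj (of_real r * ?\<zeta> m) * z) ^ Suc K)
       = (\<Sum>m<N. disc_poly c d (of_real r * ?\<zeta> m) * (1 / (1 - cnj (of_real r * ?\<zeta> m) * z) ^ Suc K))" by simp
    also have "\<dots> = of_nat N * (\<Sum>k<d. c k * (a k * of_real r ^ (2 * k) * z ^ k)) + (\<Sum>m<N. disc_poly c d (of_real r * ?\<zeta> m) * tl m)"
      unfolding ker distrib_left sum.distrib main ..
    finally have eq: "(\<Sum>m<N. disc_poly c d (of_real r * ?\<zeta> m) / (1 - cnj (of_real r * ?\<zeta> m) * z) ^ Suc K) / of_nat N
      - (\<Sum>k<d. c k * (a k * of_real r ^ (2 * k) * z ^ k)) = (\<Sum>m<N. disc_poly c d (of_real r * ?\<zeta> m) * tl m) / of_nat N"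
      using Np by (simp add: add_divide_distrib del: power_Suc)
    have "cmod (\<Sum>m<N. disc_poly c d (of_real r * ?\<zeta> m) * tl m) \<le> (\<Sum>m<N. B * \<tau>)"
    proof (rule order_trans[OF norm_sum sum_mono])
      fix m
      show "cmod (disc_poly c d (of_real r * ?\<zeta> m) * tl m) \<le> B * \<tau>"
        unfolding norm_mult by (intro mult_mono fb tail B) auto
    qed
    then have "cmod ((\<Sum>m<N. disc_poly c d (of_real r * ?\<zeta> m) * tl m) / of_nat N) \<le> B * \<tau>"
      using Np by (simp add: norm_divide field_simps)
    also have "B * \<tau> \<le> B * (e / (B + 1))" using N2[of N] N B by (intro mult_left_mono) (auto simp: \<tau>_def)
    also have "\<dots> \<le> e" using B e by (simp add: field_simps)
    finally show ?thesis unfolding eq[symmetric] a_def .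
  qed
  then show ?thesis by (intro exI[of _ "max (Suc d) N2"]) auto
qed

lemma root_of_one_mult: "N > 0 \<Longrightarrow> Q > 0 \<Longrightarrow> root_of_one (N * Q) l * root_of_one N j = root_of_one (N * Q) (j * Q + l)"
  unfolding root_of_one_def cis_mult by (rule arg_cong[of _ _ cis]) (simp add: field_simps)

text \<open>
  A fine circle of nodes consists of \<open>Q\<close> rotated copies of a coarse one.
\<close>
lemma sum_root_of_one_split:
  assumes "N > 0" "Q > 0"
  shows "(\<Sum>l<Q. \<Sum>j<N. F (root_of_one (N * Q) l * root_of_one N j)) = (\<Sum>m<N * Q. F (root_of_one (N * Q) m))"
proof -
  have "(\<Sum>m<N * Q. F (root_of_one (N * Q) m)) = (\<Sum>j<N. \<Sum>m\<in>{j * Q..<j * Q + Q}. F (root_of_one (N * Q) m))"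
    by (rule sum.nat_group[symmetric])
  also have "\<dots> = (\<Sum>j<N. \<Sum>l<Q. F (root_of_one (N * Q) (j * Q + l)))"
  proof (rule sum.cong[OF refl])
    fix j
    show "(\<Sum>m\<in>{j * Q..<j * Q + Q}. F (root_of_one (N * Q) m)) = (\<Sum>l<Q. F (root_of_one (N * Q) (j * Q + l)))"
      using sum.shift_bounds_nat_ivl[of "\<lambda>m. F (root_of_one (N * Q) m)" 0 "j * Q" Q]
      by (simp add: atLeast0LessThan add.commute)
  qed
  also have "\<dots> = (\<Sum>l<Q. \<Sum>j<N. F (root_of_one (N * Q) (j * Q + l)))" by (rule sum.swap)
  finally show ?thesis by (simp add: root_of_one_mult assms)
qed

definition node :: "nat \<Rightarrow> nat \<Rightarrow> nat \<Rightarrow> nat \<Rightarrow> nat \<Rightarrow> complex" where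
  "node R Q i l n = of_real (sqrt (radial_node R n i)) * root_of_one (2 ^ n * Q) l"

definition node_coeff :: "nat \<Rightarrow> (complex \<Rightarrow> complex) \<Rightarrow> nat \<Rightarrow> nat \<Rightarrow> nat \<Rightarrow> nat \<Rightarrow> nat \<Rightarrow> nat \<Rightarrow> complex" where
  "node_coeff M f R Q i l n j =
     of_real (radial_coeff M R n i / (2 ^ n * real Q)) * f (node R Q i l n * root_of_one (2 ^ n) j)"

lemma sqrt_radial_node_bounds:
  assumes "i < R"
  shows "0 \<le> sqrt (radial_node R n i)" "sqrt (radial_node R n i) \<le> dyadic_radius (n + 2)" "sqrt (radial_node R n i) < 1"
    "0 \<le> radial_node R n i" "radial_node R n i \<le> 1"
proof -
  note b = radial_node_bounds[OF assms, of n]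
  show n0: "0 \<le> radial_node R n i" using b dyadic_radius_bounds(1)[of n] by linarith
  then show "0 \<le> sqrt (radial_node R n i)" by simp
  show "radial_node R n i \<le> 1" using b dyadic_radius_bounds(2)[of "Suc n"] by linarith
  have "dyadic_radius (Suc n) \<le> (dyadic_radius (n + 2))\<^sup>2"
    by (simp add: dyadic_radius_def power2_eq_square field_simps)
  then have "radial_node R n i \<le> (dyadic_radius (n + 2))\<^sup>2" using b by linarith
  then show "sqrt (radial_node R n i) \<le> dyadic_radius (n + 2)"
    using dyadic_radius_bounds(1)[of "n + 2"] by (metis real_sqrt_abs abs_of_nonneg real_sqrt_le_iff)
  then show "sqrt (radial_node R n i) < 1" using dyadic_radius_bounds(2)[of "n + 2"] by linarith
qed

lemma norm_node: "i < R \<Longrightarrow> cmod (node R Q i l n) \<le> dyadic_radius (n + 2)"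
  using sqrt_radial_node_bounds[of i R n] by (simp add: node_def norm_mult)

lemma radial_coeff_bounds:
  assumes "i < R"
  shows "0 \<le> radial_coeff M R n i"
    "radial_coeff M R n i \<le> (real M + 1) / (2 ^ (n * (M + 1)) * real R)"
proof -
  have t: "0 \<le> 1 - radial_node R n i" "1 - radial_node R n i \<le> 1 / 2 ^ n"
    using sqrt_radial_node_bounds[OF assms, of n] radial_node_bounds[OF assms, of n]
    by (auto simp: dyadic_radius_def)
  then show "0 \<le> radial_coeff M R n i" by (simp add: radial_coeff_def)
  have R: "0 < real R" using assms by simp
  have "radial_coeff M R n i \<le> (real M + 1) * (1 / 2 ^ n) ^ M / (2 ^ n * real R)"
    unfolding radial_coeff_def using t R by (intro frac_le mult_left_mono power_mono mult_right_mono) auto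
  also have "\<dots> = (real M + 1) / (2 ^ (n * (M + 1)) * real R)"
    by (simp add: power_one_over power_add flip: power_mult)
  finally show "radial_coeff M R n i \<le> (real M + 1) / (2 ^ (n * (M + 1)) * real R)" .
qed

text \<open>
  Discretising the reproducing formula with \<open>R\<close> radii in every dyadic annulus and \<open>2\<^sup>n Q\<close> equally spaced points on each circle of level \<open>n\<close>
  leaves \<open>R Q\<close> sums with one node in each dyadic box. The parameters are chosen in the order \<open>L\<close>, \<open>R\<close>, \<open>Q\<close>. The tolerance of the second estimate
  may depend on the number \<open>L\<close> of levels because \<open>L\<close> is fixed before \<open>Q\<close>.
\<close>
lemma quadrature_approx:
  assumes f_def: "f = disc_poly c d"
    and q: "q > 1" and e: "e > 0" and \<delta>: "\<And>L. \<delta> L > 0"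
  shows "\<exists>L R Q. R > 0 \<and> Q > 0 \<and>
     (\<forall>z\<in>unit_disc. cmod (f z - (\<Sum>i<R. \<Sum>l<Q. atom_sum (M + 2) L (node R Q i l) (node_coeff M f R Q i l) z)) \<le> e) \<and>
     (\<forall>n<L. \<forall>i<R. (\<Sum>l<Q. \<Sum>j<2^n. cmod (f (node R Q i l n * root_of_one (2^n) j)) powr q) / (2 ^ n * real Q)
        \<le> pmean q f (dyadic_radius (n + 2)) + \<delta> L)"
proof -
  have fd: "f \<in> disc_holo" unfolding f_def by (rule disc_poly_disc_holo)
  have fh: "f holomorphic_on unit_disc" using fd by (simp add: disc_holo_def)
  define B where "B = (\<Sum>k<d. cmod (c k))"
  have B: "B \<ge> 0" by (auto simp: B_def intro: sum_nonneg)
  define e2 where "e2 = e / (2 * (B + 1))"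
  have e2: "e2 > 0" using e B by (simp add: e2_def)
  obtain L R0 where LR: "\<And>R k. R \<ge> R0 \<Longrightarrow> k < d \<Longrightarrow> \<bar>(\<Sum>n<L. \<Sum>i<R. radial_coeff M R n i *
     (real ((M + 1 + k) choose k) * radial_node R n i ^ k)) - 1\<bar> < e2"
    using radial_reproducing[OF e2, of d M] by blast
  define R where "R = Suc R0"
  have R: "R > 0" "R \<ge> R0" by (auto simp: R_def)
  define W where "W = (\<Sum>n<L. \<Sum>i<R. radial_coeff M R n i)"
  have w0: "0 \<le> radial_coeff M R n i" if "i < R" for n i by (rule radial_coeff_bounds(1)[OF that])
  have W: "W \<ge> 0" unfolding W_def by (intro sum_nonneg w0) auto
  define e1 where "e1 = e / (2 * (W + 1))"
  have e1: "e1 > 0" using e W by (simp add: e1_def)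
  define r where "r = (\<lambda>n i. sqrt (radial_node R n i))"
  have r: "0 \<le> r n i" "r n i < 1" "(r n i)\<^sup>2 = radial_node R n i" "r n i \<le> dyadic_radius (n + 2)" if "i < R" for n i
    using sqrt_radial_node_bounds[OF that, of n] by (auto simp: r_def)
  define G where "G = (\<lambda>n i z. \<Sum>k<d. c k * (of_nat ((M + 1 + k) choose k) * of_real (r n i) ^ (2 * k) * z ^ k))"
  define An where "An = (\<lambda>n i N z. (\<Sum>m<N. f (of_real (r n i) * root_of_one N m) / (1 - cnj (of_real (r n i) * root_of_one N m) * z) ^ (M + 2)) / of_nat N)"
  have ex: "\<exists>N1. \<forall>N\<ge>N1. (\<forall>z\<in>unit_disc. cmod (An n i N z - G n i z) \<le> e1) \<and>
      (\<Sum>m<N. cmod (f (of_real (r n i) * root_of_one N m)) powr q) / real N \<le> pmean q f (r n i) + \<delta> L" if i: "i < R" for n i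
  proof -
    obtain N1 where N1: "\<forall>N\<ge>N1. \<forall>z\<in>unit_disc. cmod (An n i N z - G n i z) \<le> e1"
      using angular_quadrature[OF r(1,2)[OF i, of n] e1, of c d "M + 1"] unfolding An_def G_def f_def by auto
    have cu: "continuous_on (cball 0 (r n i)) (\<lambda>z. cmod (f z) powr q)"
      using q r[OF i, of n] by (intro continuous_powr_holo[OF fh]) auto
    obtain N2 where N2: "\<forall>N\<ge>N2. \<forall>z. cmod z \<le> r n i \<longrightarrow> \<bar>circle_mean (\<lambda>z. cmod (f z) powr q) z -
        (\<Sum>j<N. cmod (f (z * root_of_one N j)) powr q) / real N\<bar> \<le> \<delta> L"
      using circle_mean_riemann[OF cu \<delta>[of L]] by blast
    have "(\<Sum>m<N. cmod (f (of_real (r n i) * root_of_one N m)) powr q) / real N \<le> pmean q f (r n i) + \<delta> L" if "N \<ge> N2" for N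
    proof -
      have "cmod (complex_of_real (r n i)) \<le> r n i" using r[OF i, of n] by simp
      then have "\<bar>pmean q f (r n i) - (\<Sum>j<N. cmod (f (of_real (r n i) * root_of_one N j)) powr q) / real N\<bar> \<le> \<delta> L"
        using N2 that by blast
      then show ?thesis by linarith
    qed
    then show ?thesis using N1 by (intro exI[of _ "max N1 N2"]) auto
  qed
  define good where "good = (\<lambda>n i N. (\<forall>z\<in>unit_disc. cmod (An n i N z - G n i z) \<le> e1) \<and>
      (\<Sum>m<N. cmod (f (of_real (r n i) * root_of_one N m)) powr q) / real N \<le> pmean q f (r n i) + \<delta> L)"
  define N1 where "N1 = (\<lambda>n i. SOME N1. \<forall>N\<ge>N1. good n i N)"
  have N1: "\<And>n i N. i < R \<Longrightarrow> N \<ge> N1 n i \<Longrightarrow> (\<forall>z\<in>unit_disc. cmod (An n i N z - G n i z) \<le> e1) \<and>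
      (\<Sum>m<N. cmod (f (of_real (r n i) * root_of_one N m)) powr q) / real N \<le> pmean q f (r n i) + \<delta> L"
  proof -
    fix n i N assume i: "i < R" and N: "N \<ge> N1 n i"
    have "\<exists>N1. \<forall>N\<ge>N1. good n i N" unfolding good_def by (rule ex[OF i])
    then have "\<forall>N\<ge>N1 n i. good n i N" unfolding N1_def by (rule someI_ex)
    then have "good n i N" using N by blast
    then show "(\<forall>z\<in>unit_disc. cmod (An n i N z - G n i z) \<le> e1) \<and>
      (\<Sum>m<N. cmod (f (of_real (r n i) * root_of_one N m)) powr q) / real N \<le> pmean q f (r n i) + \<delta> L"
      unfolding good_def .
  qed
  define Q where "Q = Suc (\<Sum>n<L. \<Sum>i<R. N1 n i)"
  have Q: "Q > 0" by (simp add: Q_def)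
  have QN: "N1 n i \<le> 2 ^ n * Q" if "n < L" "i < R" for n i
  proof -
    have "N1 n i \<le> (\<Sum>i<R. N1 n i)" using that by (intro member_le_sum) auto
    also have "\<dots> \<le> (\<Sum>n<L. \<Sum>i<R. N1 n i)" using that by (intro member_le_sum[of n _ "\<lambda>n. \<Sum>i<R. N1 n i"]) auto
    also have "\<dots> \<le> 1 * Q" by (simp add: Q_def)
    also have "\<dots> \<le> 2 ^ n * Q" by (intro mult_right_mono) auto
    finally show ?thesis .
  qed
  have nodeprod: "node R Q i l n * root_of_one (2^n) j = of_real (r n i) * (root_of_one (2^n * Q) l * root_of_one (2^n) j)" for i l n j
    by (simp add: node_def r_def)
  have one: "cmod (f z - (\<Sum>i<R. \<Sum>l<Q. atom_sum (M + 2) L (node R Q i l) (node_coeff M f R Q i l) z)) \<le> e"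
    if z: "z \<in> unit_disc" for z
  proof -
    define T where "T = (\<Sum>i<R. \<Sum>l<Q. atom_sum (M + 2) L (node R Q i l) (node_coeff M f R Q i l) z)"
    have "T = (\<Sum>i<R. \<Sum>l<Q. \<Sum>n<L. \<Sum>j<2^n. node_coeff M f R Q i l n j / (1 - cnj (node R Q i l n * root_of_one (2 ^ n) j) * z) ^ (M + 2))"
      using z by (simp add: T_def atom_sum_def del: power_Suc)
    also have "\<dots> = (\<Sum>i<R. \<Sum>n<L. \<Sum>l<Q. \<Sum>j<2^n. node_coeff M f R Q i l n j / (1 - cnj (node R Q i l n * root_of_one (2 ^ n) j) * z) ^ (M + 2))"
      by (intro sum.cong refl sum.swap)
    also have "\<dots> = (\<Sum>n<L. \<Sum>i<R. \<Sum>l<Q. \<Sum>j<2^n. node_coeff M f R Q i l n j / (1 - cnj (node R Q i l n * root_of_one (2 ^ n) j) * z) ^ (M + 2))"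
      by (rule sum.swap)
    also have "\<dots> = (\<Sum>n<L. \<Sum>i<R. of_real (radial_coeff M R n i) * An n i (2^n * Q) z)"
    proof (intro sum.cong refl)
      fix n i
      define F where "F = (\<lambda>y. f (of_real (r n i) * y) / (1 - cnj (of_real (r n i) * y) * z) ^ (M + 2))"
      have "(\<Sum>l<Q. \<Sum>j<2^n. node_coeff M f R Q i l n j / (1 - cnj (node R Q i l n * root_of_one (2 ^ n) j) * z) ^ (M + 2))
        = (\<Sum>l<Q. \<Sum>j<2^n. of_real (radial_coeff M R n i / (2 ^ n * real Q)) * F (root_of_one (2^n * Q) l * root_of_one (2^n) j))"
        unfolding node_coeff_def nodeprod F_def by (simp only: times_divide_eq_right)
      also have "\<dots> = of_real (radial_coeff M R n i / (2 ^ n * real Q)) * (\<Sum>m<2^n * Q. F (root_of_one (2^n * Q) m))"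
        unfolding sum_distrib_left[symmetric] using Q by (subst sum_root_of_one_split) auto
      also have "\<dots> = of_real (radial_coeff M R n i) * An n i (2^n * Q) z"
        by (simp add: An_def F_def del: power_Suc)
      finally show "(\<Sum>l<Q. \<Sum>j<2^n. node_coeff M f R Q i l n j / (1 - cnj (node R Q i l n * root_of_one (2 ^ n) j) * z) ^ (M + 2))
         = of_real (radial_coeff M R n i) * An n i (2^n * Q) z" .
    qed
    finally have T: "T = (\<Sum>n<L. \<Sum>i<R. of_real (radial_coeff M R n i) * An n i (2^n * Q) z)" .
    define T' where "T' = (\<Sum>n<L. \<Sum>i<R. of_real (radial_coeff M R n i) * G n i z)"
    have "T - T' = (\<Sum>n<L. \<Sum>i<R. of_real (radial_coeff M R n i) * (An n i (2^n * Q) z - G n i z))"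
      unfolding T T'_def by (simp add: sum_subtractf right_diff_distrib)
    also have "cmod \<dots> \<le> (\<Sum>n<L. \<Sum>i<R. radial_coeff M R n i * e1)"
    proof (intro order_trans[OF norm_sum sum_mono])
      fix n i assume n: "n \<in> {..<L}" and i: "i \<in> {..<R}"
      then have nL: "n < L" and iR: "i < R" by auto
      have "cmod (An n i (2^n * Q) z - G n i z) \<le> e1" using N1[OF iR QN[OF nL iR]] z by blast
      then show "cmod (of_real (radial_coeff M R n i) * (An n i (2^n * Q) z - G n i z)) \<le> radial_coeff M R n i * e1"
        using w0[of i n] i by (simp add: norm_mult mult_left_mono)
    qed
    also have "\<dots> = W * e1" by (simp add: W_def sum_distrib_right)
    also have "\<dots> \<le> e / 2" using W e by (simp add: e1_def field_simps)
    finally have d1: "cmod (T - T') \<le> e / 2" .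
    define Y where "Y = (\<lambda>k. \<Sum>n<L. \<Sum>i<R. radial_coeff M R n i * (real ((M + 1 + k) choose k) * radial_node R n i ^ k))"
    have "T' = (\<Sum>n<L. \<Sum>i<R. \<Sum>k<d. c k * of_real (radial_coeff M R n i * (real ((M + 1 + k) choose k) * radial_node R n i ^ k)) * z ^ k)"
      unfolding T'_def G_def sum_distrib_left
    proof (intro sum.cong refl)
      fix n i k assume "i \<in> {..<R}"
      then have rr: "complex_of_real (r n i) ^ (2 * k) = of_real (radial_node R n i ^ k)"
        using r(3)[of i n] by (simp only: power_mult lessThan_iff of_real_power[symmetric])
      show "of_real (radial_coeff M R n i) * (c k * (of_nat ((M + 1 + k) choose k) * of_real (r n i) ^ (2 * k) * z ^ k))
        = c k * of_real (radial_coeff M R n i * (real ((M + 1 + k) choose k) * radial_node R n i ^ k)) * z ^ k"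
        unfolding rr by (simp only: of_real_mult of_real_of_nat_eq mult_ac)
    qed
    also have "\<dots> = (\<Sum>n<L. \<Sum>k<d. \<Sum>i<R. c k * of_real (radial_coeff M R n i * (real ((M + 1 + k) choose k) * radial_node R n i ^ k)) * z ^ k)"
      by (intro sum.cong refl sum.swap)
    also have "\<dots> = (\<Sum>k<d. \<Sum>n<L. \<Sum>i<R. c k * of_real (radial_coeff M R n i * (real ((M + 1 + k) choose k) * radial_node R n i ^ k)) * z ^ k)"
      by (rule sum.swap)
    also have "\<dots> = (\<Sum>k<d. c k * of_real (Y k) * z ^ k)"
      unfolding Y_def of_real_sum sum_distrib_left sum_distrib_right ..
    finally have T': "T' = (\<Sum>k<d. c k * of_real (Y k) * z ^ k)" .
    have "f z - T' = (\<Sum>k<d. c k * of_real (1 - Y k) * z ^ k)"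
      unfolding T' f_def using z by (simp add: disc_poly_def sum_subtractf algebra_simps)
    also have "cmod \<dots> \<le> (\<Sum>k<d. cmod (c k) * e2)"
    proof (intro order_trans[OF norm_sum sum_mono])
      fix k assume "k \<in> {..<d}"
      then have "\<bar>1 - Y k\<bar> \<le> e2" using LR[OF R(2), of k] by (simp add: Y_def abs_minus_commute less_imp_le)
      moreover have "cmod z ^ k \<le> 1" using z by (simp add: power_le_one)
      ultimately have "\<bar>1 - Y k\<bar> * cmod z ^ k \<le> e2 * 1" using e2 by (intro mult_mono) auto
      then show "cmod (c k * of_real (1 - Y k) * z ^ k) \<le> cmod (c k) * e2"
        by (simp only: norm_mult norm_power norm_of_real mult.assoc) (simp add: mult_left_mono)
    qed
    also have "\<dots> = B * e2" by (simp add: B_def sum_distrib_right)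
    also have "\<dots> \<le> e / 2" using B e by (simp add: e2_def field_simps)
    finally have "cmod (f z - T') \<le> e / 2" .
    then have "cmod (f z - T) \<le> e" using d1 norm_triangle_ineq4[of "f z - T'" "T - T'"] by simp
    then show ?thesis unfolding T_def .
  qed
  have two: "(\<Sum>l<Q. \<Sum>j<2^n. cmod (f (node R Q i l n * root_of_one (2^n) j)) powr q) / (2 ^ n * real Q)
        \<le> pmean q f (dyadic_radius (n + 2)) + \<delta> L" if n: "n < L" and i: "i < R" for n i
  proof -
    have "(\<Sum>l<Q. \<Sum>j<2^n. cmod (f (node R Q i l n * root_of_one (2^n) j)) powr q)
       = (\<Sum>m<2^n * Q. cmod (f (of_real (r n i) * root_of_one (2^n * Q) m)) powr q)"
      unfolding nodeprod using Q sum_root_of_one_split[of "2^n" Q "\<lambda>y. cmod (f (of_real (r n i) * y)) powr q"] by simp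
    also have "\<dots> / (2 ^ n * real Q) \<le> pmean q f (r n i) + \<delta> L"
      using N1[OF i QN[OF n i]] by simp
    also have "pmean q f (r n i) \<le> pmean q f (dyadic_radius (n + 2))"
      by (intro pmean_mono[OF fh q] r[OF i] dyadic_radius_bounds)
    finally show ?thesis by simp
  qed
  show ?thesis using R(1) Q one two by blast
qed

section \<open>Weak factorization\<close>

locale bergman_triple =
  fixes p1 p2 q :: real and \<omega> \<nu> \<eta> :: "complex \<Rightarrow> real"
  assumes p1: "1 < p1" and p2: "1 < p2" and q: "1 < q"
    and D1: "\<omega> \<in> D_class" and D2: "\<nu> \<in> D_class" and D: "\<eta> \<in> D_class"
    and exponents: "1 / q = 1 / p1 + 1 / p2"
    and comparable: "comparable_on {0..<1}
           (\<lambda>r. weight_tilde \<eta> r powr (1 / q))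
           (\<lambda>r. weight_tilde \<omega> r powr (1 / p1) * weight_tilde \<nu> r powr (1 / p2))"
begin

lemma radial_weights: "radial_weight \<omega>" "radial_weight \<nu>" "radial_weight \<eta>"
  by (intro D_class_radial D1 D2 D)+

lemma exponent_sum: "q / p1 + q / p2 = 1"
proof -
  have "q / p1 + q / p2 = q * (1 / p1 + 1 / p2)" by (simp add: distrib_left)
  then show ?thesis using q by (simp add: exponents[symmetric])
qed

sublocale factor_spaces "bergman p1 \<omega>" "bergman p2 \<nu>" "bergman_norm p1 \<omega>" "bergman_norm p2 \<nu>"
proof -
  interpret A: function_seminorm "bergman p1 \<omega>" "bergman_norm p1 \<omega>" by (rule bergman_seminorm[OF radial_weights(1) p1])
  interpret B: function_seminorm "bergman p2 \<nu>" "bergman_norm p2 \<nu>" by (rule bergman_seminorm[OF radial_weights(2) p2])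
  show "factor_spaces (bergman p1 \<omega>) (bergman p2 \<nu>) (bergman_norm p1 \<omega>) (bergman_norm p2 \<nu>)"
    by unfold_locales (rule bergman_scale[OF radial_weights(1) p1])
qed

sublocale P: function_seminorm "product_sums (bergman p1 \<omega>) (bergman p2 \<nu>)"
    "product_norm (bergman p1 \<omega>) (bergman_norm p1 \<omega>) (bergman p2 \<nu>) (bergman_norm p2 \<nu>)"
  by (rule product_sums_seminorm)

sublocale Y: function_seminorm "bergman q \<eta>" "bergman_norm q \<eta>"
  by (rule bergman_seminorm[OF radial_weights(3) q])

abbreviation "products \<equiv> product_sums (bergman p1 \<omega>) (bergman p2 \<nu>)"
abbreviation "pnorm \<equiv> product_norm (bergman p1 \<omega>) (bergman_norm p1 \<omega>) (bergman p2 \<nu>) (bergman_norm p2 \<nu>)"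

lemma atom_sum_bergman:
  assumes D: "\<mu> \<in> D_class" and p: "p > 1"
  shows "\<exists>t0. \<forall>t\<ge>t0. \<exists>C>0. \<forall>L v a X. (\<forall>n. cmod (v n) \<le> dyadic_radius (n + 2)) \<longrightarrow>
     (\<Sum>n<L. \<Sum>j<2^n. cmod (a n j) powr p * ((2 ^ (n * (t + 2))) powr p / 2 ^ n * dyadic_tail \<mu> n)) \<le> X \<longrightarrow>
     atom_sum (t + 2) L v a \<in> bergman p \<mu> \<and> bergman_norm p \<mu> (atom_sum (t + 2) L v a) \<le> (C * X) powr (1 / p)"
proof -
  have rw: "radial_weight \<mu>" by (rule D_class_radial[OF D])
  have p0: "p > 0" using p by simp
  obtain C2 where C2: "C2 > 0" "\<And>f. f \<in> disc_holo \<Longrightarrow> bergman_integral p \<mu> f \<le> ennreal C2 * dyadic_sum p (dyadic_tail \<mu>) f"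
    using bergman_integral_dyadic[OF D p] by blast
  obtain t0 where t0: "\<And>t. t \<ge> t0 \<Longrightarrow> \<exists>C>0. \<forall>L v a. (\<forall>n. cmod (v n) \<le> dyadic_radius (n + 2)) \<longrightarrow>
     dyadic_sum p (dyadic_tail \<mu>) (atom_sum (t + 2) L v a) \<le>
       ennreal (C * (\<Sum>n<L. \<Sum>j<2^n. cmod (a n j) powr p * ((2 ^ (n * (t + 2))) powr p / 2 ^ n * dyadic_tail \<mu> n)))"
    using atom_sum_bound[OF D_class_dyadic_tail(2)[OF D] p] by blast
  have "\<exists>C>0. \<forall>L v a X. (\<forall>n. cmod (v n) \<le> dyadic_radius (n + 2)) \<longrightarrow>
     (\<Sum>n<L. \<Sum>j<2^n. cmod (a n j) powr p * ((2 ^ (n * (t + 2))) powr p / 2 ^ n * dyadic_tail \<mu> n)) \<le> X \<longrightarrow>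
     atom_sum (t + 2) L v a \<in> bergman p \<mu> \<and> bergman_norm p \<mu> (atom_sum (t + 2) L v a) \<le> (C * X) powr (1 / p)"
    if t: "t \<ge> t0" for t
  proof -
    obtain C1 where C1: "C1 > 0" "\<And>L v a. (\<And>n. cmod (v n) \<le> dyadic_radius (n + 2)) \<Longrightarrow>
     dyadic_sum p (dyadic_tail \<mu>) (atom_sum (t + 2) L v a) \<le>
       ennreal (C1 * (\<Sum>n<L. \<Sum>j<2^n. cmod (a n j) powr p * ((2 ^ (n * (t + 2))) powr p / 2 ^ n * dyadic_tail \<mu> n)))"
      using t0[OF t] by blast
    have "atom_sum (t + 2) L v a \<in> bergman p \<mu> \<and> bergman_norm p \<mu> (atom_sum (t + 2) L v a) \<le> (C2 * C1 * X) powr (1 / p)"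
      if v: "\<forall>n. cmod (v n) \<le> dyadic_radius (n + 2)"
        and X: "(\<Sum>n<L. \<Sum>j<2^n. cmod (a n j) powr p * ((2 ^ (n * (t + 2))) powr p / 2 ^ n * dyadic_tail \<mu> n)) \<le> X" for L v a X
    proof -
      have v1: "cmod (v n) \<le> 1" for n using v[rule_format, of n] dyadic_radius_bounds(2)[of "n + 2"] by simp
      have fd: "atom_sum (t + 2) L v a \<in> disc_holo" by (rule atom_sum_disc_holo[OF v1])
      have X0: "0 \<le> X"
      proof (rule order_trans[OF _ X])
        show "0 \<le> (\<Sum>n<L. \<Sum>j<2^n. cmod (a n j) powr p * ((2 ^ (n * (t + 2))) powr p / 2 ^ n * dyadic_tail \<mu> n))"
          by (intro sum_nonneg mult_nonneg_nonneg divide_nonneg_nonneg) (auto simp: dyadic_tail_def)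
      qed
      have "bergman_integral p \<mu> (atom_sum (t + 2) L v a) \<le> ennreal C2 * dyadic_sum p (dyadic_tail \<mu>) (atom_sum (t + 2) L v a)"
        by (rule C2(2)[OF fd])
      also have "\<dots> \<le> ennreal C2 * ennreal (C1 * (\<Sum>n<L. \<Sum>j<2^n. cmod (a n j) powr p * ((2 ^ (n * (t + 2))) powr p / 2 ^ n * dyadic_tail \<mu> n)))"
        using v by (intro mult_left_mono C1(2)) auto
      also have "\<dots> \<le> ennreal C2 * ennreal (C1 * X)"
        using X C1(1) by (intro mult_left_mono ennreal_leI) auto
      also have "\<dots> = ennreal (((C2 * C1 * X) powr (1 / p)) powr p)"
        using C1(1) C2(1) X0 p0 by (simp add: ennreal_mult[symmetric] powr_powr mult.assoc)
      finally have le: "bergman_integral p \<mu> (atom_sum (t + 2) L v a) \<le> ennreal (((C2 * C1 * X) powr (1 / p)) powr p)" .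
      show ?thesis using bergman_normI[OF rw p0 fd powr_ge_zero le] by blast
    qed
    then show ?thesis using C1(1) C2(1) by (intro exI[of _ "C2 * C1"]) simp
  qed
  then show ?thesis by blast
qed

text \<open>
  The kernel of exponent \<open>2 t + 4\<close> is the square of the one of exponent \<open>t + 2\<close>. With \<open>A, B\<close> the weights of the two coefficient norms and
  \<open>x = |c| A\<^sup>1\<^sup>/\<^sup>p\<^sup>1 B\<^sup>1\<^sup>/\<^sup>p\<^sup>2\<close>, the choice \<open>|a|\<^sup>p\<^sup>1 A = |b|\<^sup>p\<^sup>2 B = x\<^sup>q\<close> is the equality case of Hoelder's inequality, so no
  loss occurs in the product of the two norms.
\<close>
lemma atom_sum_product_norm:
  "\<exists>t. \<exists>C>0. \<forall>L v c. (\<forall>n. cmod (v n) \<le> dyadic_radius (n + 2)) \<longrightarrow>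
     atom_sum (2 * t + 4) L v c \<in> products \<and>
     pnorm (atom_sum (2 * t + 4) L v c) \<le>
       C * (\<Sum>n<L. \<Sum>j<2^n. cmod (c n j) powr q * ((2 ^ (n * (2 * t + 4))) powr q / 2 ^ n * dyadic_tail \<eta> n)) powr (1 / q)"
proof -
  define h g k where "h = dyadic_tail \<omega>" and "g = dyadic_tail \<nu>" and "k = dyadic_tail \<eta>"
  have pos: "0 < h n" "0 < g n" "0 < k n" for n
    using D_class_dyadic_tail(2)[OF D1] D_class_dyadic_tail(2)[OF D2] D_class_dyadic_tail(2)[OF D]
    by (auto simp: h_def g_def k_def geometric_tail_def)
  obtain C0 where C0: "C0 > 0" "\<And>n. h n powr (1 / p1) * g n powr (1 / p2) \<le> C0 * k n powr (1 / q)"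
    using comparable_dyadic_tails[OF D1 D2 D exponents comparable] unfolding h_def g_def k_def by blast
  obtain t1 where t1: "\<forall>t\<ge>t1. \<exists>C>0. \<forall>L v a X. (\<forall>n. cmod (v n) \<le> dyadic_radius (n + 2)) \<longrightarrow>
     (\<Sum>n<L. \<Sum>j<2^n. cmod (a n j) powr p1 * ((2 ^ (n * (t + 2))) powr p1 / 2 ^ n * h n)) \<le> X \<longrightarrow>
     atom_sum (t + 2) L v a \<in> bergman p1 \<omega> \<and> bergman_norm p1 \<omega> (atom_sum (t + 2) L v a) \<le> (C * X) powr (1 / p1)"
    using atom_sum_bergman[OF D1 p1] unfolding h_def by blast
  obtain t2 where t2: "\<forall>t\<ge>t2. \<exists>C>0. \<forall>L v a X. (\<forall>n. cmod (v n) \<le> dyadic_radius (n + 2)) \<longrightarrow>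
     (\<Sum>n<L. \<Sum>j<2^n. cmod (a n j) powr p2 * ((2 ^ (n * (t + 2))) powr p2 / 2 ^ n * g n)) \<le> X \<longrightarrow>
     atom_sum (t + 2) L v a \<in> bergman p2 \<nu> \<and> bergman_norm p2 \<nu> (atom_sum (t + 2) L v a) \<le> (C * X) powr (1 / p2)"
    using atom_sum_bergman[OF D2 p2] unfolding g_def by blast
  define t where "t = max t1 t2"
  obtain C1 where C1: "C1 > 0" "\<forall>L v a X. (\<forall>n. cmod (v n) \<le> dyadic_radius (n + 2)) \<longrightarrow>
     (\<Sum>n<L. \<Sum>j<2^n. cmod (a n j) powr p1 * ((2 ^ (n * (t + 2))) powr p1 / 2 ^ n * h n)) \<le> X \<longrightarrow>
     atom_sum (t + 2) L v a \<in> bergman p1 \<omega> \<and> bergman_norm p1 \<omega> (atom_sum (t + 2) L v a) \<le> (C1 * X) powr (1 / p1)"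
    using t1[rule_format, of t] unfolding t_def by auto
  obtain C2 where C2: "C2 > 0" "\<forall>L v a X. (\<forall>n. cmod (v n) \<le> dyadic_radius (n + 2)) \<longrightarrow>
     (\<Sum>n<L. \<Sum>j<2^n. cmod (a n j) powr p2 * ((2 ^ (n * (t + 2))) powr p2 / 2 ^ n * g n)) \<le> X \<longrightarrow>
     atom_sum (t + 2) L v a \<in> bergman p2 \<nu> \<and> bergman_norm p2 \<nu> (atom_sum (t + 2) L v a) \<le> (C2 * X) powr (1 / p2)"
    using t2[rule_format, of t] unfolding t_def by auto
  define C where "C = C1 powr (1 / p1) * C2 powr (1 / p2) * C0"
  have C: "C > 0" using C0 C1 C2 by (simp add: C_def)
  have "atom_sum (2 * t + 4) L v c \<in> products \<and>
     pnorm (atom_sum (2 * t + 4) L v c) \<le>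
       C * (\<Sum>n<L. \<Sum>j<2^n. cmod (c n j) powr q * ((2 ^ (n * (2 * t + 4))) powr q / 2 ^ n * k n)) powr (1 / q)"
    if v: "\<forall>n. cmod (v n) \<le> dyadic_radius (n + 2)" for L v c
  proof -
    define A where "A = (\<lambda>n. (2 ^ (n * (t + 2))) powr p1 / 2 ^ n * h n)"
    define B where "B = (\<lambda>n. (2 ^ (n * (t + 2))) powr p2 / 2 ^ n * g n)"
    have AB: "A n > 0" "B n > 0" for n using pos by (auto simp: A_def B_def)
    define x where "x = (\<lambda>n j. cmod (c n j) * (A n powr (1 / p1) * B n powr (1 / p2)))"
    have x0: "0 \<le> x n j" for n j by (simp add: x_def)
    define a where "a = (\<lambda>n j. sgn (c n j) * of_real (x n j powr (q / p1) / A n powr (1 / p1)))"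
    define b where "b = (\<lambda>n j. complex_of_real (x n j powr (q / p2) / B n powr (1 / p2)))"
    have ab: "a n j * b n j = c n j" for n j
    proof -
      have "x n j powr (q / p1) * x n j powr (q / p2) = x n j"
        using x0[of n j] exponent_sum by (simp flip: powr_add)
      then have "x n j powr (q / p1) / A n powr (1 / p1) * (x n j powr (q / p2) / B n powr (1 / p2)) = cmod (c n j)"
        using AB[of n] by (simp add: x_def)
      then have "a n j * b n j = sgn (c n j) * of_real (cmod (c n j))"
        unfolding a_def b_def mult.assoc of_real_mult[symmetric] by (simp only:)
      also have "\<dots> = c n j" by (simp add: sgn_eq)
      finally show ?thesis .
    qed
    have a_le: "cmod (a n j) powr p1 * A n \<le> x n j powr q" for n j
    proof -
      have "cmod (a n j) \<le> x n j powr (q / p1) / A n powr (1 / p1)"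
        unfolding a_def norm_mult norm_of_real by (simp add: norm_sgn abs_divide)
      then have "cmod (a n j) powr p1 \<le> (x n j powr (q / p1) / A n powr (1 / p1)) powr p1"
        using p1 by (intro powr_mono2) auto
      also have "\<dots> = x n j powr q / A n" using p1 AB[of n] by (simp add: powr_divide powr_powr)
      finally show ?thesis using AB(1)[of n] by (simp add: field_simps)
    qed
    have b_le: "cmod (b n j) powr p2 * B n \<le> x n j powr q" for n j
    proof -
      have "cmod (b n j) powr p2 = (x n j powr (q / p2) / B n powr (1 / p2)) powr p2"
        unfolding b_def norm_of_real by (simp add: abs_divide)
      also have "\<dots> = x n j powr q / B n" using p2 AB[of n] by (simp add: powr_divide powr_powr)
      finally show ?thesis using AB(2)[of n] by simp
    qed
    define X where "X = (\<Sum>n<L. \<Sum>j<2^n. x n j powr q)"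
    have X0: "0 \<le> X" unfolding X_def by (intro sum_nonneg) simp
    define I where "I = Sigma {..<L} (\<lambda>n. {..<2^n} :: nat set)"
    have I: "finite I" by (simp add: I_def)
    define K where "K = (\<lambda>i z. if z \<in> unit_disc then 1 / (1 - cnj (v (fst i) * root_of_one (2^fst i) (snd i)) * z) ^ (t + 2) else 0)"
    have as: "(\<lambda>z. \<Sum>i\<in>I. w i * (u (fst i) (snd i) * K i z)) = atom_sum (t + 2) L v (\<lambda>n j. w (n, j) * u n j)" for w u
      by (rule ext) (simp add: atom_sum_def K_def I_def sum.Sigma case_prod_unfold mult.assoc del: power_Suc)
    have prod: "(\<lambda>z. \<Sum>i\<in>I. (a (fst i) (snd i) * K i z) * (b (fst i) (snd i) * K i z)) = atom_sum (2 * t + 4) L v c"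
    proof
      fix z
      have kk: "K i z * K i z = (if z \<in> unit_disc then 1 / (1 - cnj (v (fst i) * root_of_one (2^fst i) (snd i)) * z) ^ (2 * t + 4) else 0)" for i
      proof -
        have "2 * t + 4 = (t + 2) + (t + 2)" by simp
        then show ?thesis unfolding K_def by (simp only: power_add) simp
      qed
      have "(\<Sum>i\<in>I. (a (fst i) (snd i) * K i z) * (b (fst i) (snd i) * K i z)) = (\<Sum>i\<in>I. (a (fst i) (snd i) * b (fst i) (snd i)) * (K i z * K i z))"
        by (simp only: mult_ac)
      also have "\<dots> = atom_sum (2 * t + 4) L v c z"
        unfolding ab kk by (simp add: atom_sum_def I_def sum.Sigma case_prod_unfold del: power_Suc)
      finally show "(\<Sum>i\<in>I. (a (fst i) (snd i) * K i z) * (b (fst i) (snd i) * K i z)) = atom_sum (2 * t + 4) L v c z" .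
    qed
    have main: "(\<lambda>z. \<Sum>i\<in>I. (a (fst i) (snd i) * K i z) * (b (fst i) (snd i) * K i z)) \<in> products \<and>
       pnorm (\<lambda>z. \<Sum>i\<in>I. (a (fst i) (snd i) * K i z) * (b (fst i) (snd i) * K i z)) \<le> (C1 * X) powr (1 / p1) * (C2 * X) powr (1 / p2)"
    proof (rule product_norm_diagonal[OF I])
      fix w :: "nat \<times> nat \<Rightarrow> complex" assume w: "\<And>i. i \<in> I \<Longrightarrow> cmod (w i) = 1"
      have wi: "cmod (w (n, j)) = 1" if "n < L" "j < 2 ^ n" for n j using w that by (auto simp: I_def)
      have le1: "(\<Sum>n<L. \<Sum>j<2^n. cmod (w (n, j) * a n j) powr p1 * ((2 ^ (n * (t + 2))) powr p1 / 2 ^ n * h n)) \<le> X"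
        unfolding X_def using a_le wi by (intro sum_mono) (simp add: norm_mult A_def)
      show "(\<lambda>z. \<Sum>i\<in>I. w i * (a (fst i) (snd i) * K i z)) \<in> bergman p1 \<omega> \<and>
         bergman_norm p1 \<omega> (\<lambda>z. \<Sum>i\<in>I. w i * (a (fst i) (snd i) * K i z)) \<le> (C1 * X) powr (1 / p1)"
        unfolding as by (rule C1(2)[THEN spec, THEN spec, THEN spec, THEN spec, THEN mp, OF v, THEN mp, OF le1])
      have le2: "(\<Sum>n<L. \<Sum>j<2^n. cmod (w (n, j) * b n j) powr p2 * ((2 ^ (n * (t + 2))) powr p2 / 2 ^ n * g n)) \<le> X"
        unfolding X_def using b_le wi by (intro sum_mono) (simp add: norm_mult B_def)
      show "(\<lambda>z. \<Sum>i\<in>I. w i * (b (fst i) (snd i) * K i z)) \<in> bergman p2 \<nu> \<and>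
         bergman_norm p2 \<nu> (\<lambda>z. \<Sum>i\<in>I. w i * (b (fst i) (snd i) * K i z)) \<le> (C2 * X) powr (1 / p2)"
        unfolding as by (rule C2(2)[THEN spec, THEN spec, THEN spec, THEN spec, THEN mp, OF v, THEN mp, OF le2])
    qed
    define Z where "Z = (\<Sum>n<L. \<Sum>j<2^n. cmod (c n j) powr q * ((2 ^ (n * (2 * t + 4))) powr q / 2 ^ n * k n))"
    have XZ: "X \<le> C0 powr q * Z"
    proof -
      have "x n j powr q \<le> C0 powr q * (cmod (c n j) powr q * ((2 ^ (n * (2 * t + 4))) powr q / 2 ^ n * k n))" for n j
      proof -
        define T :: real where "T = 2 ^ (n * (t + 2))"
        define N :: real where "N = 2 ^ n"
        have TN: "T > 0" "N > 0" by (auto simp: T_def N_def)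
        have TT: "(2::real) ^ (n * (2 * t + 4)) = T * T"
          unfolding T_def power_add[symmetric] by (rule arg_cong[of _ _ "(^) 2"]) (simp add: algebra_simps)
        have e1: "A n powr (1 / p1) = T * (N powr (- (1 / p1)) * h n powr (1 / p1))"
          using p1 TN pos[of n] unfolding A_def T_def[symmetric] N_def[symmetric]
          by (simp add: powr_mult powr_divide powr_powr powr_minus_divide)
        have e2: "B n powr (1 / p2) = T * (N powr (- (1 / p2)) * g n powr (1 / p2))"
          using p2 TN pos[of n] unfolding B_def T_def[symmetric] N_def[symmetric]
          by (simp add: powr_mult powr_divide powr_powr powr_minus_divide)
        have "N powr (- (1 / p1)) * N powr (- (1 / p2)) = N powr (- (1 / q))"
          unfolding exponents by (simp flip: powr_add)
        then have "A n powr (1 / p1) * B n powr (1 / p2) = T * T * N powr (- (1 / q)) * (h n powr (1 / p1) * g n powr (1 / p2))"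
          unfolding e1 e2 by (simp add: mult_ac)
        also have "\<dots> \<le> T * T * N powr (- (1 / q)) * (C0 * k n powr (1 / q))"
          using TN C0(2)[of n] by (intro mult_left_mono) auto
        finally have "x n j \<le> cmod (c n j) * (T * T * N powr (- (1 / q)) * (C0 * k n powr (1 / q)))"
          unfolding x_def by (intro mult_left_mono) auto
        then have "x n j powr q \<le> (cmod (c n j) * (T * T * N powr (- (1 / q)) * (C0 * k n powr (1 / q)))) powr q"
          using q x0[of n j] by (intro powr_mono2) auto
        also have "\<dots> = C0 powr q * (cmod (c n j) powr q * ((T * T) powr q / N * k n))"
          using q TN C0(1) pos[of n] by (simp add: powr_mult powr_divide powr_powr powr_minus_divide)
        finally show ?thesis by (simp only: TT N_def)
      qed
      then show ?thesis unfolding X_def Z_def sum_distrib_left by (intro sum_mono)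
    qed
    have "(C1 * X) powr (1 / p1) * (C2 * X) powr (1 / p2) = C1 powr (1 / p1) * C2 powr (1 / p2) * X powr (1 / q)"
      using C1(1) C2(1) X0 by (simp add: powr_mult exponents powr_add)
    also have "\<dots> \<le> C1 powr (1 / p1) * C2 powr (1 / p2) * (C0 powr q * Z) powr (1 / q)"
      using XZ X0 q by (intro mult_left_mono powr_mono2) auto
    also have "(C0 powr q * Z) powr (1 / q) = C0 * Z powr (1 / q)"
      using C0(1) q by (simp add: powr_mult powr_powr)
    finally show ?thesis using main unfolding prod by (simp add: C_def Z_def mult.assoc)
  qed
  then show ?thesis using C unfolding k_def by blast
qed

end

lemma disc_poly_poly: "disc_poly c d = (\<lambda>z. if z \<in> unit_disc then poly (\<Sum>k<d. monom (c k) k) z else 0)"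
  by (rule ext) (simp add: disc_poly_def poly_sum poly_monom)

lemma poly_disc_poly: "(\<lambda>z. if z \<in> unit_disc then poly P z else 0) = disc_poly (coeff P) (Suc (degree P))"
  by (rule ext) (simp add: disc_poly_def poly_altdef lessThan_Suc_atMost)

context bergman_triple
begin

text \<open>
  The constant function \<open>1\<close> belongs to the second factor.
\<close>
lemma bergman_products:
  assumes f: "f \<in> bergman p1 \<omega>"
  shows "f \<in> products" "pnorm f \<le> bergman_norm p1 \<omega> f * bergman_norm p2 \<nu> disc_one"
proof -
  have "f = (\<lambda>z. f z * disc_one z)"
    using bergman_sub_disc_holo[OF f] by (auto simp: disc_holo_def disc_one_def)
  with product_mem[OF f disc_one_bergman[OF radial_weights(2)]]
  show "f \<in> products" "pnorm f \<le> bergman_norm p1 \<omega> f * bergman_norm p2 \<nu> disc_one" by simp_all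
qed

lemma products_bergman:
  "\<exists>C>0. \<forall>f\<in>products. f \<in> bergman q \<eta> \<and> bergman_norm q \<eta> f \<le> C * pnorm f"
proof -
  obtain C where C: "C > 0" "\<And>\<phi> \<psi>. \<phi> \<in> bergman p1 \<omega> \<Longrightarrow> \<psi> \<in> bergman p2 \<nu> \<Longrightarrow> (\<lambda>z. \<phi> z * \<psi> z) \<in> bergman q \<eta> \<and>
     bergman_norm q \<eta> (\<lambda>z. \<phi> z * \<psi> z) \<le> C * (bergman_norm p1 \<omega> \<phi> * bergman_norm p2 \<nu> \<psi>)"
    using bergman_mult[OF p1 p2 q D1 D2 D exponents comparable] by blast
  have fact: "f \<in> bergman q \<eta> \<and> bergman_norm q \<eta> f \<le> C * (\<Sum>k<n. bergman_norm p1 \<omega> (\<phi> k) * bergman_norm p2 \<nu> (\<psi> k))"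
    if f: "factorization (bergman p1 \<omega>) (bergman p2 \<nu>) f n \<phi> \<psi>" for f n \<phi> \<psi>
  proof -
    have m: "\<phi> k \<in> bergman p1 \<omega>" "\<psi> k \<in> bergman p2 \<nu>" if "k < n" for k
      using f that by (auto simp: factorization_def)
    have feq: "f = (\<lambda>z. \<Sum>k<n. \<phi> k z * \<psi> k z)" using f by (simp add: factorization_def)
    have "f \<in> bergman q \<eta>"
      unfolding feq by (rule Y.sum_mem) (use C(2) m in auto)
    moreover have "bergman_norm q \<eta> f \<le> (\<Sum>k<n. bergman_norm q \<eta> (\<lambda>z. \<phi> k z * \<psi> k z))"
      unfolding feq by (rule Y.norm_sum_le) (use C(2) m in auto)
    moreover have "\<dots> \<le> (\<Sum>k<n. C * (bergman_norm p1 \<omega> (\<phi> k) * bergman_norm p2 \<nu> (\<psi> k)))"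
      using C(2) m by (intro sum_mono) auto
    ultimately show ?thesis by (simp add: sum_distrib_left)
  qed
  have "f \<in> bergman q \<eta> \<and> bergman_norm q \<eta> f \<le> C * pnorm f" if f: "f \<in> products" for f
  proof -
    have "bergman_norm q \<eta> f \<le> C * pnorm f + e" if e: "e > 0" for e
    proof -
      have "e / C > 0" using e C by simp
      then obtain n \<phi> \<psi> where n: "factorization (bergman p1 \<omega>) (bergman p2 \<nu>) f n \<phi> \<psi>"
        "(\<Sum>k<n. bergman_norm p1 \<omega> (\<phi> k) * bergman_norm p2 \<nu> (\<psi> k)) < pnorm f + e / C"
        by (rule product_norm_approx[OF f])
      have "bergman_norm q \<eta> f \<le> C * (\<Sum>k<n. bergman_norm p1 \<omega> (\<phi> k) * bergman_norm p2 \<nu> (\<psi> k))"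
        using fact[OF n(1)] by blast
      also have "\<dots> \<le> C * (pnorm f + e / C)" using n(2) C(1) by (intro mult_left_mono) auto
      also have "\<dots> = C * pnorm f + e" using C(1) by (simp add: distrib_left)
      finally show ?thesis .
    qed
    then have "bergman_norm q \<eta> f \<le> C * pnorm f" by (rule field_le_epsilon)
    moreover have "f \<in> bergman q \<eta>" using f fact unfolding product_sums_def by blast
    ultimately show ?thesis by blast
  qed
  then show ?thesis using C(1) by blast
qed

text \<open>
  Apply \<open>atom_sum_product_norm\<close> to each of the \<open>R Q\<close> families of \<open>quadrature_approx\<close>. The average of the \<open>q\<close>-th roots of the family sums
  is bounded through \<open>x\<^sup>1\<^sup>/\<^sup>q \<le> m\<^sup>1\<^sup>/\<^sup>q (1 + x / m)\<close>, with \<open>m\<close> a bound for the average of the family sums. The quadrature error is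
  uniformly at most the norm of \<open>f\<close>, so its product norm is at most a multiple of it.
\<close>
lemma polynomial_product_norm:
  "\<exists>C>0. \<forall>c d. pnorm (disc_poly c d) \<le> C * bergman_norm q \<eta> (disc_poly c d)"
proof -
  define k where "k = dyadic_tail \<eta>"
  have geo: "geometric_tail k" unfolding k_def by (rule D_class_dyadic_tail(2)[OF D])
  then have kp: "\<And>n. 0 < k n" by (auto simp: geometric_tail_def)
  obtain A where A: "A \<ge> 1" "\<And>n. k n \<le> A * k (Suc n)" using geo by (auto simp: geometric_tail_def)
  obtain C3 where C3: "C3 > 0" "\<And>f. f \<in> disc_holo \<Longrightarrow> dyadic_sum q k f \<le> ennreal C3 * bergman_integral q \<eta> f"
    using bergman_integral_dyadic[OF D q] unfolding k_def by blast
  obtain t C1 where C1: "C1 > 0" "\<forall>L v c. (\<forall>n. cmod (v n) \<le> dyadic_radius (n + 2)) \<longrightarrow>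
     atom_sum (2 * t + 4) L v c \<in> products \<and>
     pnorm (atom_sum (2 * t + 4) L v c) \<le>
       C1 * (\<Sum>n<L. \<Sum>j<2^n. cmod (c n j) powr q * ((2 ^ (n * (2 * t + 4))) powr q / 2 ^ n * k n)) powr (1 / q)"
    using atom_sum_product_norm unfolding k_def by blast
  define M where "M = 2 * t + 2"
  have M: "2 * t + 4 = M + 2" by (simp add: M_def)
  note C1 = C1[unfolded M]
  define N1 where "N1 = bergman_norm p1 \<omega> disc_one * bergman_norm p2 \<nu> disc_one"
  have N1: "0 \<le> N1" by (simp add: N1_def bergman_norm_nonneg)
  define \<kappa> where "\<kappa> = A * C3 + 1"
  have \<kappa>: "\<kappa> > 0" using A C3 by (simp add: \<kappa>_def add_pos_pos)
  define C where "C = 2 * C1 * (real M + 1) * \<kappa> powr (1 / q) + N1 + 1"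
  have C: "C > 0" using C1(1) N1 by (simp add: C_def add_nonneg_pos)
  have "pnorm f \<le> C * bergman_norm q \<eta> f" if fdef: "f = disc_poly c d" for f c d
  proof -
    have fB: "f \<in> bergman q \<eta>" unfolding fdef by (rule disc_poly_bergman[OF radial_weights(3) q])
    have fd: "f \<in> disc_holo" by (rule bergman_sub_disc_holo[OF fB])
    have fP: "f \<in> products" unfolding fdef by (rule bergman_products(1)[OF disc_poly_bergman[OF radial_weights(1) p1]])
    define y where "y = bergman_norm q \<eta> f"
    have y0: "0 \<le> y" by (simp add: y_def bergman_norm_nonneg)
    show ?thesis
    proof (cases "y = 0")
      case True
      have "f z = 0" for z
      proof (cases "z \<in> unit_disc")
        case True
        obtain K where "\<forall>f\<in>bergman q \<eta>. \<forall>w. cmod w \<le> cmod z \<longrightarrow> cmod (f w) \<le> K * bergman_norm q \<eta> f"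
          using bergman_point_bound[OF D q, of "cmod z"] True by auto
        then have "cmod (f z) \<le> K * y" using fB by (simp add: y_def)
        then show ?thesis using \<open>y = 0\<close> by simp
      qed (use fd in \<open>auto simp: disc_holo_def\<close>)
      then have "f = (\<lambda>_. 0)" by blast
      then show ?thesis using P.norm_zero Y.norm_zero by simp
    next
      case False
      then have y: "y > 0" using y0 by simp
      \<comment> \<open>The tolerance makes the total error of the family sums at most \<open>y powr q\<close>; the summand \<open>1\<close> covers \<open>L = 0\<close>.\<close>
      define \<delta> where "\<delta> = (\<lambda>L. y powr q / (1 + (\<Sum>n<L. k n)))"
      have ks: "0 \<le> (\<Sum>n<L. k n)" for L using kp by (intro sum_nonneg) (auto intro: less_imp_le)
      have \<delta>: "\<delta> L > 0" for L using y ks[of L] by (simp add: \<delta>_def add_pos_nonneg)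
      obtain L R Q where R: "R > 0" and Q: "Q > 0"
        and T1: "\<forall>z\<in>unit_disc. cmod (f z - (\<Sum>i<R. \<Sum>l<Q. atom_sum (M + 2) L (node R Q i l) (node_coeff M f R Q i l) z)) \<le> y"
        and T2: "\<forall>n<L. \<forall>i<R. (\<Sum>l<Q. \<Sum>j<2^n. cmod (f (node R Q i l n * root_of_one (2^n) j)) powr q) / (2 ^ n * real Q)
           \<le> pmean q f (dyadic_radius (n + 2)) + \<delta> L"
        using quadrature_approx[where \<delta> = \<delta> and M = M, OF fdef q y \<delta>] by (elim exE conjE) (rule that)
      define S where "S = (\<lambda>i l. atom_sum (M + 2) L (node R Q i l) (node_coeff M f R Q i l))"
      define T where "T = (\<lambda>z. \<Sum>i<R. \<Sum>l<Q. S i l z)"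
      define Y where "Y = (\<lambda>i l. \<Sum>n<L. \<Sum>j<2^n. cmod (f (node R Q i l n * root_of_one (2^n) j)) powr q / 2 ^ n * k n)"
      have Y0: "0 \<le> Y i l" for i l
        unfolding Y_def using kp by (intro sum_nonneg mult_nonneg_nonneg divide_nonneg_nonneg) (auto intro: less_imp_le)
      define \<rho> where "\<rho> = (real M + 1) / (real R * real Q)"
      have \<rho>: "\<rho> > 0" using R Q by (simp add: \<rho>_def add_nonneg_pos)
      have Sb: "S i l \<in> products \<and> pnorm (S i l) \<le> C1 * (\<rho> * Y i l powr (1 / q))" if i: "i < R" for i l
      proof -
        define X where "X = (\<Sum>n<L. \<Sum>j<2^n. cmod (node_coeff M f R Q i l n j) powr q * ((2 ^ (n * (M + 2))) powr q / 2 ^ n * k n))"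
        have nb: "\<forall>n. cmod (node R Q i l n) \<le> dyadic_radius (n + 2)" using norm_node[OF i] by blast
        have s: "S i l \<in> products \<and> pnorm (S i l) \<le> C1 * X powr (1 / q)"
          unfolding S_def X_def by (rule C1(2)[THEN spec, THEN spec, THEN spec, THEN mp, OF nb])
        have "X \<le> (\<Sum>n<L. \<Sum>j<2^n. \<rho> powr q * (cmod (f (node R Q i l n * root_of_one (2^n) j)) powr q / 2 ^ n * k n))"
          unfolding X_def
        proof (intro sum_mono)
          fix n j
          define fw where "fw = cmod (f (node R Q i l n * root_of_one (2^n) j))"
          define E :: real where "E = 2 ^ (n * (M + 2))"
          have E: "E > 0" by (simp add: E_def)
          have E': "E = 2 ^ (n * (M + 1)) * 2 ^ n" by (simp add: E_def flip: power_add)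
          have w0: "0 \<le> radial_coeff M R n i" by (rule radial_coeff_bounds(1)[OF i])
          have "cmod (node_coeff M f R Q i l n j) = radial_coeff M R n i / (2 ^ n * real Q) * fw"
            unfolding node_coeff_def norm_mult norm_of_real fw_def using w0 by (simp add: abs_divide abs_mult)
          also have "\<dots> \<le> ((real M + 1) / (2 ^ (n * (M + 1)) * real R)) / (2 ^ n * real Q) * fw"
            using Q by (intro mult_right_mono divide_right_mono radial_coeff_bounds(2)[OF i]) (auto simp: fw_def)
          also have "\<dots> = \<rho> / E * fw" by (simp add: \<rho>_def E' mult_ac)
          finally have "cmod (node_coeff M f R Q i l n j) powr q \<le> (\<rho> / E * fw) powr q"
            using q by (intro powr_mono2) auto
          also have "\<dots> = \<rho> powr q / E powr q * fw powr q"
            using \<rho> E by (simp add: powr_mult powr_divide fw_def)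
          finally have "cmod (node_coeff M f R Q i l n j) powr q * (E powr q / 2 ^ n * k n) \<le> (\<rho> powr q / E powr q * fw powr q) * (E powr q / 2 ^ n * k n)"
            using kp[of n] by (intro mult_right_mono) (auto intro: less_imp_le)
          also have "\<dots> = \<rho> powr q * (fw powr q / 2 ^ n * k n)" using E by simp
          finally show "cmod (node_coeff M f R Q i l n j) powr q * ((2 ^ (n * (M + 2))) powr q / 2 ^ n * k n)
             \<le> \<rho> powr q * (cmod (f (node R Q i l n * root_of_one (2^n) j)) powr q / 2 ^ n * k n)"
            by (simp only: E_def fw_def)
        qed
        also have "\<dots> = \<rho> powr q * Y i l" by (simp add: Y_def sum_distrib_left)
        finally have XY: "X \<le> \<rho> powr q * Y i l" .
        have "0 \<le> X" unfolding X_def using kp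
          by (intro sum_nonneg mult_nonneg_nonneg divide_nonneg_nonneg) (auto intro: less_imp_le)
        then have "X powr (1 / q) \<le> (\<rho> powr q * Y i l) powr (1 / q)" using XY q by (intro powr_mono2) auto
        also have "\<dots> = \<rho> * Y i l powr (1 / q)" using \<rho> Y0 q by (simp add: powr_mult powr_powr)
        finally show ?thesis using s C1(1) by (meson less_imp_le mult_left_mono order_trans)
      qed
      have TP: "T \<in> products" unfolding T_def using Sb by (intro P.sum_mem) auto
      define mass where "mass = \<kappa> * y powr q"
      have lam: "mass > 0" using \<kappa> y by (simp add: mass_def)
      have Ysum: "(\<Sum>i<R. \<Sum>l<Q. Y i l) \<le> real R * real Q * mass"
      proof -
        have "(\<Sum>i<R. \<Sum>l<Q. Y i l) = (\<Sum>i<R. \<Sum>n<L. \<Sum>l<Q. \<Sum>j<2^n. cmod (f (node R Q i l n * root_of_one (2^n) j)) powr q / 2 ^ n * k n)"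
          unfolding Y_def by (intro sum.cong refl sum.swap)
        also have "\<dots> = (\<Sum>i<R. \<Sum>n<L. (\<Sum>l<Q. \<Sum>j<2^n. cmod (f (node R Q i l n * root_of_one (2^n) j)) powr q) / (2 ^ n * real Q) * (real Q * k n))"
          using Q by (simp add: sum_distrib_right sum_divide_distrib)
        also have "\<dots> \<le> (\<Sum>i<R. \<Sum>n<L. (pmean q f (dyadic_radius (n + 2)) + \<delta> L) * (real Q * k n))"
          using T2 by (intro sum_mono mult_right_mono mult_nonneg_nonneg less_imp_le[OF kp]) auto
        also have "\<dots> = real R * real Q * ((\<Sum>n<L. k n * pmean q f (dyadic_radius (n + 2))) + \<delta> L * (\<Sum>n<L. k n))"
          by (simp add: sum.distrib sum_distrib_left distrib_left distrib_right mult_ac)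
        also have "\<dots> \<le> real R * real Q * (A * (C3 * y powr q) + y powr q)"
        proof (intro mult_left_mono add_mono)
          define u where "u = (\<lambda>n. k n * pmean q f (dyadic_radius (Suc n)))"
          have u0: "0 \<le> u n" for n unfolding u_def using kp[of n] by (intro mult_nonneg_nonneg circle_mean_nonneg) auto
          have "(\<Sum>n<L. k n * pmean q f (dyadic_radius (n + 2))) \<le> (\<Sum>n<L. A * u (Suc n))"
          proof (rule sum_mono)
            fix n
            have "k n * pmean q f (dyadic_radius (n + 2)) \<le> (A * k (Suc n)) * pmean q f (dyadic_radius (n + 2))"
              by (intro mult_right_mono A circle_mean_nonneg) simp
            then show "k n * pmean q f (dyadic_radius (n + 2)) \<le> A * u (Suc n)" by (simp add: u_def mult.assoc)
          qed
          also have "\<dots> = A * (\<Sum>n<L. u (Suc n))" by (simp add: sum_distrib_left)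
          also have "\<dots> \<le> A * (C3 * y powr q)"
          proof (rule mult_left_mono)
            have "ennreal (\<Sum>n<L. u (Suc n)) = (\<Sum>n\<in>Suc ` {..<L}. ennreal (u n))"
              using u0 by (simp add: sum.reindex sum_ennreal)
            also have "\<dots> \<le> dyadic_sum q k f"
              unfolding dyadic_sum_def u_def by (rule sum_le_suminf) auto
            also have "\<dots> \<le> ennreal C3 * bergman_integral q \<eta> f" by (rule C3(2)[OF fd])
            also have "\<dots> \<le> ennreal C3 * ennreal (y powr q)"
              using q by (intro mult_left_mono bergman_normD[OF radial_weights(3) _ fB]) (auto simp: y_def)
            finally show "(\<Sum>n<L. u (Suc n)) \<le> C3 * y powr q"
              using C3(1) by (simp add: ennreal_mult[symmetric] ennreal_le_iff)
          qed (use A in simp)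
          finally show "(\<Sum>n<L. k n * pmean q f (dyadic_radius (n + 2))) \<le> A * (C3 * y powr q)" .
          have "\<delta> L * (\<Sum>n<L. k n) \<le> \<delta> L * (1 + (\<Sum>n<L. k n))" using \<delta>[of L] by (intro mult_left_mono) auto
          also have "\<dots> = y powr q" using ks[of L] by (simp add: \<delta>_def)
          finally show "\<delta> L * (\<Sum>n<L. k n) \<le> y powr q" .
        qed simp
        also have "A * (C3 * y powr q) + y powr q = mass" by (simp add: mass_def \<kappa>_def distrib_right mult.assoc)
        finally show ?thesis .
      qed
      have root: "x powr (1 / q) \<le> mass powr (1 / q) * (1 + x / mass)" if x: "0 \<le> x" for x
      proof -
        have "(x / mass) powr (1 / q) \<le> 1 + x / mass"
        proof (cases "x / mass \<le> 1")
          case True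
          then have "(x / mass) powr (1 / q) \<le> 1 powr (1 / q)" using x lam q by (intro powr_mono2) auto
          moreover have "0 \<le> x / mass" using x lam by simp
          ultimately show ?thesis by simp
        next
          case False
          then have "(x / mass) powr (1 / q) \<le> (x / mass) powr 1" using q by (intro powr_mono) auto
          then show ?thesis using False by simp
        qed
        then have "mass powr (1 / q) * (x / mass) powr (1 / q) \<le> mass powr (1 / q) * (1 + x / mass)" by (intro mult_left_mono) auto
        then show ?thesis using x lam by (simp add: powr_divide)
      qed
      have "pnorm T \<le> (\<Sum>i<R. \<Sum>l<Q. pnorm (S i l))"
      proof -
        have m: "\<And>i l. i < R \<Longrightarrow> S i l \<in> products" using Sb by blast
        have "pnorm T \<le> (\<Sum>i<R. pnorm (\<lambda>z. \<Sum>l<Q. S i l z))"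
          unfolding T_def by (rule P.norm_sum_le) (use m in \<open>auto intro!: P.sum_mem\<close>)
        also have "\<dots> \<le> (\<Sum>i<R. \<Sum>l<Q. pnorm (S i l))"
          by (intro sum_mono P.norm_sum_le) (use m in auto)
        finally show ?thesis .
      qed
      also have "\<dots> \<le> (\<Sum>i<R. \<Sum>l<Q. C1 * \<rho> * mass powr (1 / q) * (1 + Y i l / mass))"
      proof (intro sum_mono)
        fix i l assume "i \<in> {..<R}"
        then have "pnorm (S i l) \<le> C1 * (\<rho> * Y i l powr (1 / q))" using Sb by auto
        also have "\<dots> \<le> C1 * (\<rho> * (mass powr (1 / q) * (1 + Y i l / mass)))"
          using C1(1) \<rho> by (intro mult_left_mono root Y0) auto
        finally show "pnorm (S i l) \<le> C1 * \<rho> * mass powr (1 / q) * (1 + Y i l / mass)" by (simp add: mult.assoc)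
      qed
      also have "\<dots> = C1 * \<rho> * mass powr (1 / q) * (real R * real Q + (\<Sum>i<R. \<Sum>l<Q. Y i l) / mass)"
        by (simp add: sum_distrib_left[symmetric] sum.distrib sum_divide_distrib[symmetric])
      also have "\<dots> \<le> C1 * \<rho> * mass powr (1 / q) * (real R * real Q + real R * real Q)"
        using Ysum lam C1(1) \<rho> by (intro mult_left_mono add_left_mono) (auto simp: divide_le_eq)
      also have "\<dots> = 2 * C1 * (real M + 1) * mass powr (1 / q)"
      proof -
        have "\<rho> * (real R * real Q) = real M + 1" using R Q by (simp add: \<rho>_def)
        moreover have "C1 * r * m * (x + x) = 2 * C1 * (r * x) * m" for r m x :: real
          by (simp add: algebra_simps)
        ultimately show ?thesis by (simp only:)
      qed
      also have "mass powr (1 / q) = \<kappa> powr (1 / q) * y"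
        using \<kappa> y q by (simp add: mass_def powr_mult powr_powr)
      finally have pT: "pnorm T \<le> 2 * C1 * (real M + 1) * \<kappa> powr (1 / q) * y" by (simp add: mult.assoc)
      have "T \<in> bergman q \<eta>" using products_bergman TP by blast
      then have dd: "(\<lambda>z. f z - T z) \<in> disc_holo" using disc_holo_diff[OF fd] bergman_sub_disc_holo by blast
      have dl: "cmod (f z - T z) \<le> y" if "z \<in> unit_disc" for z
        using T1 that unfolding T_def S_def by blast
      note bb = bergman_bounded[OF radial_weights(1) p1 dd y0 dl]
      have "pnorm (\<lambda>z. f z - T z) \<le> bergman_norm p1 \<omega> (\<lambda>z. f z - T z) * bergman_norm p2 \<nu> disc_one"
        by (rule bergman_products(2)[OF bb(1)])
      also have "\<dots> \<le> (y * bergman_norm p1 \<omega> disc_one) * bergman_norm p2 \<nu> disc_one"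
        by (intro mult_right_mono bb(2) bergman_norm_nonneg)
      also have "\<dots> = N1 * y" by (simp add: N1_def)
      finally have pD: "pnorm (\<lambda>z. f z - T z) \<le> N1 * y" .
      have "pnorm f \<le> pnorm T + pnorm (\<lambda>z. f z - T z)"
        using P.norm_add[OF TP bergman_products(1)[OF bb(1)]] by simp
      also have "\<dots> \<le> (2 * C1 * (real M + 1) * \<kappa> powr (1 / q) + N1) * y" using pT pD by (simp add: distrib_right)
      also have "\<dots> \<le> C * y" using y by (intro mult_right_mono) (auto simp: C_def)
      finally show ?thesis by (simp add: y_def)
    qed
  qed
  then show ?thesis using C by blast
qed

lemma product_poly_approx:
  assumes ph: "\<phi> \<in> bergman p1 \<omega>" and ps: "\<psi> \<in> bergman p2 \<nu>" and e: "e > 0"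
  shows "\<exists>P. pnorm (\<lambda>z. \<phi> z * \<psi> z - (if z \<in> unit_disc then poly P z else 0)) < e"
proof -
  define a where "a = bergman_norm p1 \<omega> \<phi>"
  define b where "b = bergman_norm p2 \<nu> \<psi>"
  have ab: "0 \<le> a" "0 \<le> b" by (simp_all add: a_def b_def bergman_norm_nonneg)
  define e1 where "e1 = e / (2 * (b + 1))"
  have e1: "e1 > 0" using e ab by (simp add: e1_def)
  obtain c d where u: "bergman_norm p1 \<omega> (\<lambda>z. \<phi> z - disc_poly c d z) < e1"
    using disc_poly_dense[OF D1 p1 ph e1] by blast
  define u where "u = disc_poly c d"
  have uB: "u \<in> bergman p1 \<omega>" unfolding u_def by (rule disc_poly_bergman[OF radial_weights(1) p1])
  define m where "m = bergman_norm p1 \<omega> u"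
  have m: "0 \<le> m" by (simp add: m_def bergman_norm_nonneg)
  define e2 where "e2 = e / (2 * (m + 1))"
  have e2: "e2 > 0" using e m by (simp add: e2_def)
  obtain c' d' where v: "bergman_norm p2 \<nu> (\<lambda>z. \<psi> z - disc_poly c' d' z) < e2"
    using disc_poly_dense[OF D2 p2 ps e2] by blast
  define v where "v = disc_poly c' d'"
  have vB: "v \<in> bergman p2 \<nu>" unfolding v_def by (rule disc_poly_bergman[OF radial_weights(2) p2])
  have d1: "(\<lambda>z. \<phi> z - u z) \<in> bergman p1 \<omega>" by (rule A.diff_mem[OF ph uB])
  have d2: "(\<lambda>z. \<psi> z - v z) \<in> bergman p2 \<nu>" by (rule B.diff_mem[OF ps vB])
  have "(\<lambda>z. \<phi> z * \<psi> z - u z * v z) = (\<lambda>z. (\<phi> z - u z) * \<psi> z + u z * (\<psi> z - v z))"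
    by (simp add: algebra_simps)
  then have "pnorm (\<lambda>z. \<phi> z * \<psi> z - u z * v z) \<le> pnorm (\<lambda>z. (\<phi> z - u z) * \<psi> z) + pnorm (\<lambda>z. u z * (\<psi> z - v z))"
    using P.norm_add[OF product_mem(1)[OF d1 ps] product_mem(1)[OF uB d2]] by simp
  also have "\<dots> \<le> bergman_norm p1 \<omega> (\<lambda>z. \<phi> z - u z) * b + m * bergman_norm p2 \<nu> (\<lambda>z. \<psi> z - v z)"
    using product_mem(2)[OF d1 ps] product_mem(2)[OF uB d2] by (simp add: b_def m_def)
  also have "\<dots> \<le> e1 * b + m * e2"
    using u v ab m by (intro add_mono mult_right_mono mult_left_mono) (auto simp: u_def v_def)
  also have "\<dots> < e"
  proof -
    have "e1 * b < e1 * (b + 1)" using e1 by simp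
    also have "\<dots> = e / 2"
    proof -
      have "b + 1 \<noteq> 0" using ab by linarith
      then show ?thesis by (simp only: e1_def) (simp add: divide_simps)
    qed
    finally have 1: "e1 * b < e / 2" .
    have "m * e2 \<le> (m + 1) * e2" using e2 by simp
    also have "\<dots> = e / 2"
    proof -
      have "m + 1 \<noteq> 0" using m by linarith
      then show ?thesis by (simp only: e2_def) (simp add: divide_simps)
    qed
    finally show ?thesis using 1 by simp
  qed
  finally have lt: "pnorm (\<lambda>z. \<phi> z * \<psi> z - u z * v z) < e" .
  have "(\<lambda>z. \<phi> z * \<psi> z - u z * v z) = (\<lambda>z. \<phi> z * \<psi> z -
      (if z \<in> unit_disc then poly ((\<Sum>k<d. monom (c k) k) * (\<Sum>k<d'. monom (c' k) k)) z else 0))"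
    unfolding u_def v_def disc_poly_poly by (rule ext) simp
  then show ?thesis using lt by (intro exI[of _ "(\<Sum>k<d. monom (c k) k) * (\<Sum>k<d'. monom (c' k) k)"]) simp
qed

lemma products_poly_approx:
  assumes f: "f \<in> products" and e: "e > 0"
  shows "\<exists>c d. pnorm (\<lambda>z. f z - disc_poly c d z) < e"
proof -
  obtain n \<phi> \<psi> where fac: "factorization (bergman p1 \<omega>) (bergman p2 \<nu>) f n \<phi> \<psi>"
    using f by (auto simp: product_sums_def)
  define e' where "e' = e / (real n + 1)"
  have e': "e' > 0" using e by (simp add: e'_def add_nonneg_pos)
  have m: "\<phi> k \<in> bergman p1 \<omega>" "\<psi> k \<in> bergman p2 \<nu>" if "k < n" for k
    using fac that by (auto simp: factorization_def)
  have feq: "f = (\<lambda>z. \<Sum>k<n. \<phi> k z * \<psi> k z)" using fac by (simp add: factorization_def)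
  have "\<exists>P. pnorm (\<lambda>z. \<phi> k z * \<psi> k z - (if z \<in> unit_disc then poly P z else 0)) < e'" if "k < n" for k
    by (rule product_poly_approx[OF m[OF that] e'])
  then obtain P where P: "\<And>k. k < n \<Longrightarrow> pnorm (\<lambda>z. \<phi> k z * \<psi> k z - (if z \<in> unit_disc then poly (P k) z else 0)) < e'"
    by metis
  have mem: "(\<lambda>z. \<phi> k z * \<psi> k z - (if z \<in> unit_disc then poly (P k) z else 0)) \<in> products" if "k < n" for k
  proof (rule P.diff_mem[OF product_mem(1)[OF m[OF that]]])
    show "(\<lambda>z. if z \<in> unit_disc then poly (P k) z else 0) \<in> products"
      unfolding poly_disc_poly by (intro bergman_products(1) disc_poly_bergman radial_weights p1)
  qed
  define PP where "PP = (\<Sum>k<n. P k)"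
  have "(\<lambda>z. f z - disc_poly (coeff PP) (Suc (degree PP)) z)
     = (\<lambda>z. \<Sum>k<n. \<phi> k z * \<psi> k z - (if z \<in> unit_disc then poly (P k) z else 0))"
    unfolding poly_disc_poly[symmetric] feq PP_def by (rule ext) (simp add: poly_sum sum_subtractf)
  then have "pnorm (\<lambda>z. f z - disc_poly (coeff PP) (Suc (degree PP)) z)
     \<le> (\<Sum>k<n. pnorm (\<lambda>z. \<phi> k z * \<psi> k z - (if z \<in> unit_disc then poly (P k) z else 0)))"
    using P.norm_sum_le[of "{..<n}" "\<lambda>k z. \<phi> k z * \<psi> k z - (if z \<in> unit_disc then poly (P k) z else 0)"] mem by simp
  also have "\<dots> \<le> (\<Sum>k<n. e')" using P by (intro sum_mono) (auto intro: less_imp_le)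
  also have "\<dots> = real n * e'" by simp
  also have "\<dots> < e" using e by (simp add: e'_def field_simps)
  finally show ?thesis by blast
qed

text \<open>
  The remainder after polynomial approximation is small in the product norm, and by continuity of multiplication also in \<open>A\<^sup>q\<^sub>\<eta>\<close>; so the
  estimate for polynomials suffices.
\<close>
lemma products_norm_le:
  "\<exists>C>0. \<forall>f\<in>products. pnorm f \<le> C * bergman_norm q \<eta> f"
proof -
  obtain C where C: "C > 0" "\<And>c d. pnorm (disc_poly c d) \<le> C * bergman_norm q \<eta> (disc_poly c d)"
    using polynomial_product_norm by blast
  obtain C' where C': "C' > 0" "\<And>f. f \<in> products \<Longrightarrow> f \<in> bergman q \<eta> \<and> bergman_norm q \<eta> f \<le> C' * pnorm f"
    using products_bergman by blast
  have "pnorm f \<le> C * bergman_norm q \<eta> f" if f: "f \<in> products" for f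
  proof (rule field_le_epsilon)
    fix e :: real assume e: "e > 0"
    define e' where "e' = e / (1 + C * C')"
    have e': "e' > 0" using e C C' by (simp add: e'_def add_pos_pos)
    obtain c d where cd: "pnorm (\<lambda>z. f z - disc_poly c d z) < e'"
      using products_poly_approx[OF f e'] by blast
    define P where "P = disc_poly c d"
    have PP: "P \<in> products" unfolding P_def by (intro bergman_products(1) disc_poly_bergman radial_weights p1)
    have dP: "(\<lambda>z. f z - P z) \<in> products" by (rule P.diff_mem[OF f PP])
    have fB: "f \<in> bergman q \<eta>" and PB: "P \<in> bergman q \<eta>" using C'(2) f PP by blast+
    have "pnorm f \<le> pnorm P + e'"
      using P.norm_reverse[OF f PP] cd by (simp add: P_def abs_le_iff)
    also have "pnorm P \<le> C * bergman_norm q \<eta> P" unfolding P_def by (rule C(2))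
    also have "bergman_norm q \<eta> P \<le> bergman_norm q \<eta> f + C' * e'"
    proof -
      have "bergman_norm q \<eta> P \<le> bergman_norm q \<eta> f + bergman_norm q \<eta> (\<lambda>z. f z - P z)"
        using Y.norm_reverse[OF fB PB] by (simp add: abs_le_iff)
      also have "bergman_norm q \<eta> (\<lambda>z. f z - P z) \<le> C' * pnorm (\<lambda>z. f z - P z)" using C'(2)[OF dP] by blast
      also have "\<dots> \<le> C' * e'" using cd C'(1) by (simp add: P_def)
      finally show ?thesis by simp
    qed
    finally have "pnorm f \<le> C * (bergman_norm q \<eta> f + C' * e') + e'" using C(1) by simp
    also have "\<dots> = C * bergman_norm q \<eta> f + (1 + C * C') * e'" by (simp add: algebra_simps)
    also have "(1 + C * C') * e' = e"
    proof -
      have "1 + C * C' > 0" using C(1) C'(1) by (simp add: add_pos_pos)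
      then show ?thesis by (simp add: e'_def)
    qed
    finally show "pnorm f \<le> C * bergman_norm q \<eta> f + e" .
  qed
  then show ?thesis using C(1) by blast
qed

lemma weak_factorization:
  "same_function_space
     (weak_factored (bergman p1 \<omega>) (bergman_norm p1 \<omega>) (bergman p2 \<nu>) (bergman_norm p2 \<nu>))
     (weak_factored_norm (bergman p1 \<omega>) (bergman_norm p1 \<omega>) (bergman p2 \<nu>) (bergman_norm p2 \<nu>))
     (bergman q \<eta>) (bergman_norm q \<eta>)"
proof -
  obtain C where C: "C > 0" "\<And>f. f \<in> products \<Longrightarrow> pnorm f \<le> C * bergman_norm q \<eta> f"
    using products_norm_le by blast
  obtain C' where C': "C' > 0" "\<And>f. f \<in> products \<Longrightarrow> f \<in> bergman q \<eta> \<and> bergman_norm q \<eta> f \<le> C' * pnorm f"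
    using products_bergman by blast
  show ?thesis
    unfolding weak_factored_def weak_factored_norm_def
  proof (rule same_function_space_completion[where C = "max C C'"])
    show "function_seminorm products pnorm" by (rule P.function_seminorm_axioms)
    show "function_seminorm (bergman q \<eta>) (bergman_norm q \<eta>)" by (rule Y.function_seminorm_axioms)
    show "products \<subseteq> bergman q \<eta>" using C'(2) by blast
    show "max C C' > 0" using C(1) by simp
    show "bergman_norm q \<eta> f \<le> max C C' * pnorm f" if "f \<in> products" for f
      using C'(2)[OF that] mult_right_mono[OF max.cobounded2 P.norm_nonneg[OF that], of C' C] by linarith
    show "pnorm f \<le> max C C' * bergman_norm q \<eta> f" if "f \<in> products" for f
      using C(2)[OF that] mult_right_mono[OF max.cobounded1 bergman_norm_nonneg[of q \<eta> f], of C C'] by linarith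
    show "\<exists>K. \<forall>f\<in>bergman q \<eta>. cmod (f z) \<le> K * bergman_norm q \<eta> f" for z
    proof (cases "z \<in> unit_disc")
      case True
      then show ?thesis using bergman_point_bound[OF D q, of "cmod z"] by auto
    next
      case False
      then show ?thesis by (intro exI[of _ 0]) (auto simp: bergman_def disc_holo_def)
    qed
    show "\<exists>f\<in>bergman q \<eta>. (\<lambda>n. bergman_norm q \<eta> (\<lambda>z. F n z - f z)) \<longlonglongrightarrow> 0"
      if "F \<in> cauchy_seqs (bergman q \<eta>) (bergman_norm q \<eta>)" for F
      by (rule bergman_complete[OF D q that])
    show "\<exists>g\<in>products. bergman_norm q \<eta> (\<lambda>z. f z - g z) < e" if f: "f \<in> bergman q \<eta>" and e: "e > 0" for f e
    proof -
      obtain c d where "bergman_norm q \<eta> (\<lambda>z. f z - disc_poly c d z) < e"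
        using disc_poly_dense[OF D q f e] by blast
      moreover have "disc_poly c d \<in> products" by (intro bergman_products(1) disc_poly_bergman radial_weights p1)
      ultimately show ?thesis by blast
    qed
  qed
qed

end

theorem theorem2:
  fixes p1 p2 q :: real and \<omega> \<nu> \<eta> :: "complex \<Rightarrow> real"
  assumes "1 < p1" and "1 < p2" and "1 < q"
    and "\<omega> \<in> D_class" and "\<nu> \<in> D_class" and "\<eta> \<in> D_class"
    and "1 / q = 1 / p1 + 1 / p2"
    and "comparable_on {0..<1}
           (\<lambda>r. weight_tilde \<eta> r powr (1 / q))
           (\<lambda>r. weight_tilde \<omega> r powr (1 / p1) * weight_tilde \<nu> r powr (1 / p2))"
  shows "same_function_space
           (weak_factored (bergman p1 \<omega>) (bergman_norm p1 \<omega>) (bergman p2 \<nu>) (bergman_norm p2 \<nu>))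
           (weak_factored_norm (bergman p1 \<omega>) (bergman_norm p1 \<omega>) (bergman p2 \<nu>) (bergman_norm p2 \<nu>))
           (bergman q \<eta>) (bergman_norm q \<eta>)"
  by (rule bergman_triple.weak_factorization) (unfold_locales, fact assms)+

end
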